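(* Let $p$ and $q$ be distinct odd primes. Then the number $E(pq)$ of Reinhardt polygons with $pq$ sides (under dihedral equivalence) is \[ E(pq) = 2^{(p-3)/2} + \frac{2^{p-1}+p-1}{2p} + 2^{(q-3)/2} + \frac{2^{q-1}+q-1}{2q} - 1. \]
   Context: A Reuleaux polygon is a closed convex region in the plane of constant width whose boundary consists of a finite number of circular arcs, each with the same curvature; its vertices are the points where two adjacent arcs of its boundary meet (there is an odd number of them). Connecting all pairs of vertices of a Reuleaux polygon $R$ at maximal distance from one another gives a star polygon $S$: a closed path consisting of an odd number of line segments, each intersecting all the others, all of length equal to the diameter of $R$; the angles at its vertices sum to $\pi$. Let $n\ge 3$ be an integer, not a power of two. A Reinhardt polygon with $n$ sides is an equilateral convex $n$-gon $P$ that can be inscribed in a Reuleaux polygon $R$ having the same diameter as $P$ in such a way that every vertex of $R$ is a vertex of $P$. If $S$ has $r$ vertices ($r$ odd), the angle of $S$ at each vertex $v$ equals $k\pi/n$, where $k$ is the number of sides of $P$ inscribed in the arc of $R$ opposite $v$. Reading off these integers while traversing $S$ gives a composition $[k_1,\dots,k_r]$ of $n$ into an odd number $r$ of positive parts. Two compositions are equivalent if one is obtained from the other by a combination of cyclic shifts and list reversals (corresponding to rotations and flips of the polygon); an equivalence class is called a dihedral composition. Characterization (Reinhardt): a composition $[k_1,\dots,k_r]$ of $n$ with $r$ odd corresponds to a Reinhardt polygon if and only if $\Phi_{2n}(z)$ divides $F(z)=1-z^{k_1}+z^{k_1+k_2}-\cdots+z^{k_1+\cdots+k_{r-1}}$,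 where $\Phi_m$ is the $m$th cyclotomic polynomial. $E(n)$ denotes the number of Reinhardt polygons with $n$ sides, two polygons being counted as distinct only if one cannot be obtained from the other by a combination of rotations and flips (i.e. one counts the corresponding dihedral compositions). *)

theory Defs
  imports "HOL-Complex_Analysis.Complex_Analysis" "HOL-Computational_Algebra.Primes"
begin

text \<open>The Euclidean plane is the type \<^typ>\<open>complex\<close>.\<close>

definition constant_width :: "complex set \<Rightarrow> real \<Rightarrow> bool" where
  "constant_width R w \<longleftrightarrow>
     (\<forall>u. norm u = 1 \<longrightarrow> (SUP x\<in>R. x \<bullet> u) - (INF x\<in>R. x \<bullet> u) = w)"

text \<open>
  The boundary of a Reuleaux polygon \<open>R\<close> is traversed once, counterclockwise, along \<open>m\<close> arcs of
  the same radius \<open>\<rho>\<close>; \<open>V\<close> is the set of its vertices. Adjacent arcs have to lie on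
  different circles, so that every vertex is a genuine corner. This excludes the disc, whose
  boundary can also be cut into arcs of the same curvature. That \<open>\<rho>\<close> is the width, that the arcs
  are centred at the vertices and that \<open>m\<close> is odd are consequences.
\<close>

definition reuleaux_polygon :: "complex set \<Rightarrow> complex set \<Rightarrow> bool" where
  "reuleaux_polygon R V \<longleftrightarrow>
     R \<noteq> {} \<and> compact R \<and> convex R \<and> (\<exists>w>0. constant_width R w) \<and>
     (\<exists>(m::nat) (c :: nat \<Rightarrow> complex) (\<rho>::real) (a :: nat \<Rightarrow> real) (b :: nat \<Rightarrow> real).
        let \<gamma> = (\<lambda>i. part_circlepath (c i) \<rho> (a i) (b i)) in
        \<rho> > 0 \<and>
        (\<forall>i<m. a i < b i \<and> b i < a i + 2 * pi) \<and>
        (\<forall>i<m. pathfinish (\<gamma> i) = pathstart (\<gamma> (Suc i mod m)) \<and> c i \<noteq> c (Suc i mod m)) \<and>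
        (\<forall>i<m. \<forall>j<m. i \<noteq> j \<longrightarrow>
           path_image (\<gamma> i) \<inter> path_image (\<gamma> j) \<subseteq> {pathstart (\<gamma> i), pathfinish (\<gamma> i)}) \<and>
        frontier R = (\<Union>i<m. path_image (\<gamma> i)) \<and>
        V = (\<lambda>i. pathstart (\<gamma> i)) ` {..<m})"

definition polygon_vertices :: "complex set \<Rightarrow> complex set" where
  "polygon_vertices P = {v. v extreme_point_of P}"

definition convex_polygon :: "nat \<Rightarrow> complex set \<Rightarrow> bool" where
  "convex_polygon n P \<longleftrightarrow> polytope P \<and> aff_dim P = 2 \<and> card (polygon_vertices P) = n"

definition equilateral :: "complex set \<Rightarrow> bool" where
  "equilateral P \<longleftrightarrow> (\<exists>s. \<forall>e. e edge_of P \<longrightarrow> diameter e = s)"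

definition reinhardt_polygon :: "nat \<Rightarrow> complex set \<Rightarrow> bool" where
  "reinhardt_polygon n P \<longleftrightarrow>
     convex_polygon n P \<and> equilateral P \<and>
     (\<exists>R V. reuleaux_polygon R V \<and> polygon_vertices P \<subseteq> frontier R \<and>
            diameter P = diameter R \<and> V \<subseteq> polygon_vertices P)"

text \<open>
  The size and the position of a polygon are disregarded, so rotations and flips are combined with
  translations and scalings.
\<close>

definition similarity :: "(complex set \<times> complex set) set" where
  "similarity = {(P, Q). \<exists>a b. a \<noteq> 0 \<and>
     (Q = (\<lambda>z. a * z + b) ` P \<or> Q = (\<lambda>z. a * cnj z + b) ` P)}"

definition E :: "nat \<Rightarrow> nat" where
  "E n = card ({P. reinhardt_polygon n P} // similarity)"

end

theory Submission
  imports Defs "HOL-Number_Theory.Cong"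
begin

text \<open>
  A body of constant width \<open>w\<close> has in each direction \<open>cis \<phi>\<close> exactly one support point \<open>x \<phi>\<close>, and
  \<open>x \<phi> - x (\<phi> + pi) = w * cis \<phi>\<close>. For a Reuleaux polygon whose vertices are among those of an
  inscribed equilateral polygon, call a direction special if \<open>x \<phi>\<close> and \<open>x (\<phi> + pi)\<close> are both vertices
  of the inscribed polygon. Between consecutive special directions one of the two support points
  rests and the other one runs through the arc over a side, so all these directions are equally
  spaced. Hence a Reinhardt polygon with \<open>n\<close> sides is, up to similarity, the hull of a
  doubly infinite sequence \<open>v\<close> with \<open>v j - v (j + n) = \<zeta> ^ j\<close>, \<open>\<zeta> = cis (pi / n)\<close>, of
  which exactly one of the steps at \<open>j\<close> and \<open>j + n\<close> is nonzero, and all such sequences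
  occur. They correspond to the signs \<open>\<epsilon> j\<close> with \<open>(\<Sum>j<n. \<epsilon> j * \<zeta> ^ j) = 0\<close>, which is Reinhardt's
  divisibility condition.

  For odd \<open>n\<close> the signs \<open>(-1) ^ j * \<epsilon> j\<close> are \<open>n\<close>-periodic and form a vanishing sum of powers of the
  primitive \<open>n\<close>-th root of unity \<open>- \<zeta>\<close>. For \<open>n = p * q\<close> such a sum is stable under Galois conjugation,
  so by Fourier inversion the mixed second differences with steps \<open>p\<close> and \<open>q\<close> vanish, and signs with
  this property are \<open>p\<close>-periodic or \<open>q\<close>-periodic. Burnside's lemma counts both kinds up to
  translation, reflection and a change of sign; only the constant patterns are of both kinds.
\<close>

section \<open>Support points of a body of constant width\<close>

text \<open>The definition of a Reuleaux polygon prescribes neither the radius of its arcs nor the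
  position of their centres. Both are extracted from one observation: where two arcs with different
  centres meet, one point supports a whole interval of directions, so the opposite support points
  sweep an arc of radius \<open>w\<close>, and this forces \<open>\<rho> = w\<close>. Each centre
  then supports an interval of directions as well, which makes it a vertex. In the converse
  construction the single steps of a walk cannot serve as arcs, because neighbouring steps may turn
  about the same centre; maximal runs of moving steps do. That polygons are similar exactly when
  their words agree up to symmetry rests on the diameters: they occur only in the directions
  \<open>root_angle n j\<close>, so a similarity has to permute these directions. In the final count
  the indices of odd parity fix no pattern, because they complement a pattern of odd period; the
  power of two with exponent \<open>(p - 3) div 2\<close> stems from the reflections, the fraction
  from the translations.\<close>

lemma cis_inner_self [simp]: "cis \<phi> \<bullet> cis \<phi> = 1"
  by (simp add: dot_square_norm)

locale cw_body =
  fixes R :: "complex set" and w :: real and x :: "real \<Rightarrow> complex"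
  assumes w_pos: "w > 0"
    and x_in: "\<And>\<phi>. x \<phi> \<in> R"
    and x_max: "\<And>\<phi> y. y \<in> R \<Longrightarrow> y \<bullet> cis \<phi> \<le> x \<phi> \<bullet> cis \<phi>"
    and x_width: "\<And>\<phi>. (x \<phi> - x (\<phi> + pi)) \<bullet> cis \<phi> = w"
begin

lemma x_min: "y \<in> R \<Longrightarrow> x (\<phi> + pi) \<bullet> cis \<phi> \<le> y \<bullet> cis \<phi>"
  using x_max[of y "\<phi> + pi"] by (simp add: inner_complex_def)

text \<open>The distance of two points is the extent of the pair in the direction of their
  difference, so it cannot exceed the width of \<open>R\<close>.\<close>

lemma norm_diff_le:
  assumes "y \<in> R" "y' \<in> R"
  shows "norm (y - y') \<le> w"
proof -
  define \<phi> where "\<phi> = Arg (y - y')"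
  have eq: "y - y' = complex_of_real (norm (y - y')) * cis \<phi>"
    unfolding \<phi>_def using rcis_cmod_Arg[of "y - y'"] by (simp add: rcis_def)
  have "(y - y') \<bullet> cis \<phi> = norm (y - y')"
    by (subst eq) (simp flip: scaleR_conv_of_real)
  moreover have "(y - y') \<bullet> cis \<phi> \<le> (x \<phi> - x (\<phi> + pi)) \<bullet> cis \<phi>"
    using x_max[OF assms(1), of \<phi>] x_min[OF assms(2), of \<phi>] by (simp add: inner_diff_left)
  ultimately show ?thesis using x_width by simp
qed

text \<open>Equality case of Cauchy-Schwarz, read off from the squared distance of the two
  sides.\<close>

lemma norm_le_inner_eq:
  fixes z :: complex
  assumes "norm z \<le> w" "z \<bullet> cis \<phi> = w"
  shows "z = complex_of_real w * cis \<phi>"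
proof -
  have "(norm (z - complex_of_real w * cis \<phi>))\<^sup>2 = (norm z)\<^sup>2 - 2 * w * (z \<bullet> cis \<phi>) + w\<^sup>2"
    unfolding power2_norm_eq_inner scaleR_conv_of_real[symmetric]
    by (simp add: inner_diff_left inner_diff_right inner_commute power2_eq_square)
  also have "\<dots> = (norm z)\<^sup>2 - w\<^sup>2" using assms(2) by (simp add: power2_eq_square)
  also have "\<dots> \<le> 0" using assms(1) w_pos by (simp add: power_mono)
  finally show ?thesis by simp
qed

text \<open>Exchanging one end of the pair for a support point keeps the extent \<open>w\<close>, so
  by the equality case of Cauchy-Schwarz all these differences are \<open>w * cis \<phi>\<close>.
  Uniqueness of support points follows.\<close>

lemma diameter_ends:
  assumes "y \<in> R" "y' \<in> R" "(y - y') \<bullet> cis \<phi> = w"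
  shows "y = x \<phi>" "y' = x (\<phi> + pi)"
proof -
  have a: "y \<bullet> cis \<phi> = x \<phi> \<bullet> cis \<phi>" "y' \<bullet> cis \<phi> = x (\<phi> + pi) \<bullet> cis \<phi>"
    using x_max[OF assms(1), of \<phi>] x_min[OF assms(2), of \<phi>] assms(3) x_width[of \<phi>]
    by (simp_all add: inner_diff_left)
  have "y - x (\<phi> + pi) = w * cis \<phi>" "x \<phi> - x (\<phi> + pi) = w * cis \<phi>" "x \<phi> - y' = w * cis \<phi>"
    using a assms x_in x_width
    by (auto intro!: norm_le_inner_eq norm_diff_le simp: inner_diff_left)
  thus "y = x \<phi>" "y' = x (\<phi> + pi)" by (simp_all add: algebra_simps)
qed

lemma x_diff: "x \<phi> - x (\<phi> + pi) = complex_of_real w * cis \<phi>"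
  using x_in x_width by (intro norm_le_inner_eq norm_diff_le) auto

lemma x_unique:
  assumes "y \<in> R" "y \<bullet> cis \<phi> = x \<phi> \<bullet> cis \<phi>"
  shows "y = x \<phi>"
  using diameter_ends(1)[OF assms(1) x_in[of "\<phi> + pi"], of \<phi>] assms(2) x_width[of \<phi>]
  by (simp add: inner_diff_left)

lemma x_cis_cong:
  assumes "cis \<phi> = cis \<psi>"
  shows "x \<phi> = x \<psi>"
proof (rule x_unique[OF x_in])
  show "x \<phi> \<bullet> cis \<psi> = x \<psi> \<bullet> cis \<psi>"
    using x_max[OF x_in[of \<phi>], of \<psi>] x_max[OF x_in[of \<psi>], of \<phi>] assms by simp
qed

lemma x_neq_antipode: "x \<phi> \<noteq> x (\<phi> + pi)"
  using x_diff[of \<phi>] w_pos by auto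

text \<open>Cramer's rule: \<open>cis \<phi>\<close> is written in terms of \<open>cis s\<close> and
  \<open>cis t\<close>, and the result is paired with \<open>D\<close>.\<close>

lemma mono_identity:
  fixes D :: complex
  shows "sin (t - s) * (D \<bullet> cis \<phi>) = sin (t - \<phi>) * (D \<bullet> cis s) - sin (s - \<phi>) * (D \<bullet> cis t)"
  by (simp add: inner_complex_def sin_diff algebra_simps)

text \<open>
  As \<open>cis \<phi>\<close> is a combination of \<open>cis s\<close> and \<open>cis t\<close> with coefficients of opposite signs,
  maximality of \<open>x s\<close> and \<open>x t\<close> in their own directions suffices; no regularity of \<open>x\<close> is needed.
\<close>

lemma x_antimono:
  assumes "\<phi> \<le> s" "s \<le> t" "t \<le> \<phi> + pi"
  shows "x t \<bullet> cis \<phi> \<le> x s \<bullet> cis \<phi>"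
proof (cases "s = t \<or> s = \<phi>")
  case True
  thus ?thesis using x_max[OF x_in[of t], of \<phi>] by auto
next
  case False
  hence st: "s < t" "t - s < pi" using assms by auto
  define D where "D = x t - x s"
  have "sin (t - s) > 0" using st by (intro sin_gt_zero) auto
  moreover have "sin (t - \<phi>) \<ge> 0" "sin (s - \<phi>) \<ge> 0" using assms by (intro sin_ge_zero; auto)+
  moreover have "D \<bullet> cis s \<le> 0" "D \<bullet> cis t \<ge> 0"
    unfolding D_def using x_max[OF x_in] by (simp_all add: inner_diff_left)
  ultimately have "sin (t - s) * (D \<bullet> cis \<phi>) \<le> 0"
    using mono_identity[of t s D \<phi>] mult_nonneg_nonpos[of "sin (t - \<phi>)" "D \<bullet> cis s"]
      mult_nonneg_nonneg[of "sin (s - \<phi>)" "D \<bullet> cis t"] by linarith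
  with \<open>sin (t - s) > 0\<close> have "D \<bullet> cis \<phi> \<le> 0" by (simp add: mult_le_0_iff)
  thus ?thesis by (simp add: D_def inner_diff_left)
qed

text \<open>Equality makes the two terms of \<open>mono_identity\<close> agree although they have
  opposite signs, so both vanish and \<open>x s\<close> is also a support point in direction
  \<open>t\<close>. This later isolates the vertices on a supporting line.\<close>

lemma x_antimono_strict:
  assumes "\<phi> < s" "s \<le> t" "t \<le> \<phi> + pi" "s < \<phi> + pi" "x t \<bullet> cis \<phi> = x s \<bullet> cis \<phi>"
  shows "x t = x s"
proof (cases "s = t")
  case False
  define D where "D = x t - x s"
  have "sin (t - \<phi>) \<ge> 0" using assms by (intro sin_ge_zero) auto
  moreover have sp: "sin (s - \<phi>) > 0" using assms by (intro sin_gt_zero) auto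
  moreover have D: "D \<bullet> cis s \<le> 0" "D \<bullet> cis t \<ge> 0"
    unfolding D_def using x_max[OF x_in] by (simp_all add: inner_diff_left)
  moreover have "D \<bullet> cis \<phi> = 0" using assms(5) by (simp add: D_def inner_diff_left)
  hence "sin (t - \<phi>) * (D \<bullet> cis s) = sin (s - \<phi>) * (D \<bullet> cis t)"
    using mono_identity[of t s D \<phi>] by simp
  ultimately have "sin (s - \<phi>) * (D \<bullet> cis t) \<le> 0" by (metis mult_nonneg_nonpos)
  hence "D \<bullet> cis t = 0" using sp D by (smt (verit) mult_pos_pos)
  hence "x s = x t" by (intro x_unique x_in) (simp add: D_def inner_diff_left)
  thus ?thesis by simp
qed auto

lemma x_mono_left:
  assumes "\<phi> - pi \<le> s" "s \<le> t" "t \<le> \<phi>"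
  shows "x s \<bullet> cis \<phi> \<le> x t \<bullet> cis \<phi>"
  using x_antimono[of "\<phi> - pi" s t] assms by (simp add: inner_complex_def cos_diff sin_diff)

lemma x_mono_left_strict:
  assumes "\<phi> - pi \<le> s" "s \<le> t" "t < \<phi>" "x s \<bullet> cis \<phi> = x t \<bullet> cis \<phi>" "\<phi> - pi < t"
  shows "x s = x t"
proof (cases "s = t")
  case False
  define D where "D = x t - x s"
  have "sin (\<phi> - s) \<ge> 0" using assms by (intro sin_ge_zero) auto
  moreover have sp: "sin (\<phi> - t) > 0" using assms by (intro sin_gt_zero) auto
  moreover have D: "D \<bullet> cis s \<le> 0" "D \<bullet> cis t \<ge> 0"
    unfolding D_def using x_max[OF x_in] by (simp_all add: inner_diff_left)
  moreover have "D \<bullet> cis \<phi> = 0" using assms(4) by (simp add: D_def inner_diff_left)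
  hence "sin (\<phi> - t) * (D \<bullet> cis s) = sin (\<phi> - s) * (D \<bullet> cis t)"
    using mono_identity[of t s D \<phi>] sin_minus[of "\<phi> - t"] sin_minus[of "\<phi> - s"] by simp
  ultimately have "sin (\<phi> - t) * (D \<bullet> cis s) \<ge> 0" by simp
  hence "D \<bullet> cis s = 0" using sp D by (smt (verit) mult_pos_neg)
  hence "x t = x s" by (intro x_unique x_in) (simp add: D_def inner_diff_left)
  thus ?thesis by simp
qed auto

text \<open>By monotonicity the height of \<open>x s\<close> over \<open>\<phi>\<close> is squeezed
  between two equal values. So a corner supports a full interval of directions.\<close>

lemma x_const_between:
  assumes "\<phi> \<le> s" "s \<le> t" "t < \<phi> + pi" "x t = x \<phi>"
  shows "x s = x \<phi>"
proof (rule x_unique[OF x_in])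
  show "x s \<bullet> cis \<phi> = x \<phi> \<bullet> cis \<phi>"
    using x_antimono[of \<phi> s t] x_max[OF x_in[of s], of \<phi>] assms by simp
qed

text \<open>Along the arc the height in direction \<open>\<psi>\<close> is a constant plus
  \<open>\<rho> * cos (t - \<psi>)\<close>. It has a local maximum at the inner angle
  \<open>\<theta>\<close>, so the derivative vanishes there. This converts equality of boundary
  points into equality of directions.\<close>

lemma arc_normal_unique:
  assumes arc: "\<And>t. \<alpha> < t \<Longrightarrow> t < \<beta> \<Longrightarrow> c + complex_of_real \<rho> * cis t \<in> R"
    and \<theta>: "\<alpha> < \<theta>" "\<theta> < \<beta>" and \<rho>: "\<rho> > 0"
    and eq: "x \<psi> = c + complex_of_real \<rho> * cis \<theta>"
  shows "cis \<psi> = cis \<theta>"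
proof -
  have le: "cos (t - \<psi>) \<le> cos (\<theta> - \<psi>)" if "\<alpha> < t" "t < \<beta>" for t
  proof -
    have "(c + complex_of_real \<rho> * cis t) \<bullet> cis \<psi> \<le> (c + complex_of_real \<rho> * cis \<theta>) \<bullet> cis \<psi>"
      using x_max[OF arc[OF that], of \<psi>] by (simp only: eq)
    hence "\<rho> * (cos t * cos \<psi> + sin t * sin \<psi>) \<le> \<rho> * (cos \<theta> * cos \<psi> + sin \<theta> * sin \<psi>)"
      by (simp add: inner_complex_def algebra_simps)
    thus ?thesis using \<rho> by (simp add: cos_diff)
  qed
  define d where "d = min (\<theta> - \<alpha>) (\<beta> - \<theta>)"
  have d: "d > 0" using \<theta> by (simp add: d_def)
  have "((\<lambda>t. cos (t - \<psi>)) has_real_derivative - sin (\<theta> - \<psi>)) (at \<theta>)"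
    by (auto intro!: derivative_eq_intros)
  hence "- sin (\<theta> - \<psi>) = 0"
    by (rule DERIV_local_max[OF _ d]) (auto intro!: le simp: d_def)
  hence s0: "sin (\<theta> - \<psi>) = 0" by simp
  \<comment> \<open>A critical point with cosine -1 is a minimum; a small step \<open>e\<close>
    along the arc would exceed it.\<close>
  have "cos (\<theta> - \<psi>) \<noteq> -1"
  proof
    assume m: "cos (\<theta> - \<psi>) = -1"
    define e where "e = min (d / 2) 1"
    have e: "0 < e" "e < d" "e \<le> 1" using d by (auto simp: e_def)
    have "cos (\<theta> + e - \<psi>) = - cos e"
      using m s0 cos_add[of "\<theta> - \<psi>" e] by (simp add: algebra_simps)
    moreover have "cos (\<theta> + e - \<psi>) \<le> -1" using le[of "\<theta> + e"] e \<theta> m by (simp add: d_def)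
    moreover have "cos e < cos 0" using e pi_gt3 by (intro cos_monotone_0_pi) auto
    ultimately show False by simp
  qed
  moreover have "(cos (\<theta> - \<psi>))\<^sup>2 = 1" using s0 sin_cos_squared_add[of "\<theta> - \<psi>"] by simp
  ultimately have c1: "cos (\<theta> - \<psi>) = 1" by (simp add: power2_eq_1_iff)
  have "cis (\<theta> - \<psi>) = 1" using c1 s0 by (simp add: complex_eq_iff)
  thus ?thesis by (simp add: cis_divide[symmetric])
qed

lemma x_frontier: "x \<phi> \<in> frontier R"
proof -
  have "x \<phi> \<notin> interior R"
  proof
    assume "x \<phi> \<in> interior R"
    then obtain e where e: "e > 0" "cball (x \<phi>) e \<subseteq> R" by (auto simp: mem_interior_cball)
    have "x \<phi> + complex_of_real e * cis \<phi> \<in> R" using e by (auto simp: dist_norm norm_mult)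
    from x_max[OF this, of \<phi>] have "(complex_of_real e * cis \<phi>) \<bullet> cis \<phi> \<le> 0" by (simp add: inner_add_left)
    thus False using e by (simp flip: scaleR_conv_of_real)
  qed
  thus ?thesis using x_in[of \<phi>] closure_subset unfolding frontier_def by auto
qed

text \<open>A boundary point has a supporting line; its outer normal is some
  \<open>cis \<phi>\<close>, and the support point in that direction is unique.\<close>

lemma frontier_eq_range:
  assumes "compact R" "convex R"
  shows "frontier R = range x"
proof
  show "range x \<subseteq> frontier R" using x_frontier by auto
  show "frontier R \<subseteq> range x"
  proof
    fix y assume y: "y \<in> frontier R"
    hence yR: "y \<in> R" using assms(1) compact_imp_closed frontier_subset_closed by blast
    have "\<exists>a. a \<noteq> 0 \<and> (\<forall>z\<in>closure R. a \<bullet> y \<le> a \<bullet> z)"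
    proof (cases "interior R = {}")
      case False
      hence "rel_frontier R = frontier R" by (simp add: rel_frontier_nonempty_interior)
      hence "y \<in> rel_frontier R" using y by simp
      hence "y \<in> closure R" "y \<notin> rel_interior R" by (auto simp: rel_frontier_def)
      from supporting_hyperplane_rel_boundary[OF assms(2) yR this(2)]
      obtain a where "a \<noteq> 0" "\<And>z. z \<in> closure R \<Longrightarrow> a \<bullet> y \<le> a \<bullet> z"
        using supporting_hyperplane_relative_frontier[OF assms(2) \<open>y \<in> closure R\<close> \<open>y \<notin> rel_interior R\<close>] by metis
      thus ?thesis by blast
    next
      \<comment> \<open>With empty interior \<open>R\<close> lies in a line, which then supports it
        at each of its points.\<close>
      case True
      from empty_interior_subset_hyperplane[OF assms(2) True] obtain a b where "a \<noteq> 0" "R \<subseteq> {x. a \<bullet> x = b}" .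
      thus ?thesis using yR assms(1) by (metis (mono_tags, lifting) closure_closed compact_imp_closed mem_Collect_eq order_refl subsetD)
    qed
    then obtain a where a: "a \<noteq> 0" "\<And>z. z \<in> R \<Longrightarrow> a \<bullet> y \<le> a \<bullet> z" using closure_subset by blast
    define \<phi> where "\<phi> = Arg (- a)"
    have eq: "- a = complex_of_real (norm a) * cis \<phi>"
      unfolding \<phi>_def using rcis_cmod_Arg[of "- a"] by (simp add: rcis_def)
    have "z \<bullet> cis \<phi> \<le> y \<bullet> cis \<phi>" if "z \<in> R" for z
    proof -
      have "z \<bullet> (- a) \<le> y \<bullet> (- a)" using a(2)[OF that] by (simp add: inner_commute)
      hence "norm a * (z \<bullet> cis \<phi>) \<le> norm a * (y \<bullet> cis \<phi>)"
        unfolding eq by (simp add: inner_complex_def algebra_simps)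
      thus ?thesis using a(1) by simp
    qed
    from this[OF x_in[of \<phi>]] x_max[OF yR, of \<phi>] have "y = x \<phi>" by (intro x_unique yR) auto
    thus "y \<in> range x" by auto
  qed
qed

end

section \<open>Vanishing sums of roots of unity\<close>

text \<open>Closure under differences alone yields all integer combinations of \<open>g 0\<close>,
  ..., \<open>g (n - 1)\<close>. The generators may be dependent, and the bound \<open>n\<close>
  lets an induction drop one of them at a time.\<close>

inductive_set zspan :: "(nat \<Rightarrow> complex) \<Rightarrow> nat \<Rightarrow> complex set" for g n where
  zspan_0: "0 \<in> zspan g n"
| zspan_gen: "i < n \<Longrightarrow> g i \<in> zspan g n"
| zspan_diff: "a \<in> zspan g n \<Longrightarrow> b \<in> zspan g n \<Longrightarrow> a - b \<in> zspan g n"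

lemma zspan_uminus: "a \<in> zspan g n \<Longrightarrow> - a \<in> zspan g n"
  using zspan_diff[OF zspan_0, of a g n] by simp

lemma zspan_add: "a \<in> zspan g n \<Longrightarrow> b \<in> zspan g n \<Longrightarrow> a + b \<in> zspan g n"
  using zspan_diff[of a g n "- b"] zspan_uminus[of b] by simp

lemma zspan_sum: "(\<And>i. i \<in> A \<Longrightarrow> f i \<in> zspan g n) \<Longrightarrow> sum f A \<in> zspan g n"
  by (induction A rule: infinite_finite_induct) (auto intro: zspan_0 zspan_add)

lemma zspan_of_nat_mult: "a \<in> zspan g n \<Longrightarrow> of_nat k * a \<in> zspan g n"
  by (induction k) (auto intro: zspan_0 zspan_add simp: distrib_right)

lemma zspan_of_int_mult: "a \<in> zspan g n \<Longrightarrow> of_int k * a \<in> zspan g n"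
  by (cases k) (auto simp del: of_nat_Suc intro: zspan_of_nat_mult dest: zspan_of_nat_mult[THEN zspan_uminus])

lemma zspan_Suc:
  assumes "y \<in> zspan g (Suc n)"
  shows "\<exists>a\<in>zspan g n. \<exists>k::int. y = a + of_int k * g n"
  using assms
proof (induction rule: zspan.induct)
  case zspan_0
  show ?case by (rule bexI[of _ 0], rule exI[of _ 0]) (auto intro: zspan.zspan_0)
next
  case (zspan_gen i)
  show ?case
  proof (cases "i = n")
    case True
    show ?thesis by (rule bexI[of _ 0], rule exI[of _ 1]) (auto intro: zspan.zspan_0 simp: True)
  next
    case False
    show ?thesis by (rule bexI[of _ "g i"], rule exI[of _ 0]) (use False zspan_gen in \<open>auto intro: zspan.zspan_gen\<close>)
  qed
next
  case (zspan_diff a b)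
  then obtain a' k b' l where "a' \<in> zspan g n" "b' \<in> zspan g n" "a = a' + of_int k * g n" "b = b' + of_int l * g n"
    by blast
  thus ?case by (intro bexI[of _ "a' - b'"] exI[of _ "k - l"]) (auto intro: zspan.zspan_diff simp: algebra_simps)
qed

text \<open>A finitely generated subgroup of the complex numbers is free, so only 0 is divisible by
  infinitely many integers. The induction on \<open>n\<close> replaces the choice of a basis: either
  a nonzero multiple of \<open>g n\<close> lies in the span of the earlier generators, or the
  coefficient of \<open>g n\<close> is unique.\<close>

lemma zspan_infinitely_divisible:
  fixes L :: "nat set"
  assumes "infinite L" and "\<And>l. l \<in> L \<Longrightarrow> \<exists>z\<in>zspan g n. y = of_nat l * z"
  shows "y = 0"
  using assms(2)
proof (induction n arbitrary: y)
  case 0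
  from assms(1) obtain l where l: "l \<in> L" by (metis finite.emptyI ex_in_conv)
  have "z = 0" if "z \<in> zspan g 0" for z using that by (induction rule: zspan.induct) auto
  thus ?case using 0[OF l] by auto
next
  case (Suc n)
  show ?case
  proof (cases "\<exists>D::int. D \<noteq> 0 \<and> of_int D * g n \<in> zspan g n")
    case True
    then obtain D :: int where D: "D \<noteq> 0" "of_int D * g n \<in> zspan g n" by blast
    \<comment> \<open>Multiplication by \<open>D\<close> moves every quotient into the span of the
      first \<open>n\<close> generators.\<close>
    have "of_int D * y = 0"
    proof (rule Suc.IH)
      fix l assume "l \<in> L"
      then obtain z where z: "z \<in> zspan g (Suc n)" "y = of_nat l * z" using Suc.prems by blast
      obtain a k where a: "a \<in> zspan g n" "z = a + of_int k * g n" using zspan_Suc[OF z(1)] by blast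
      have "of_int D * z = of_int D * a + of_int k * (of_int D * g n)" using a(2) by (simp add: algebra_simps)
      hence "of_int D * z \<in> zspan g n" using a D by (auto intro!: zspan_add zspan_of_int_mult)
      thus "\<exists>z\<in>zspan g n. of_int D * y = of_nat l * z" using z(2) by (intro bexI[of _ "of_int D * z"]) auto
    qed
    thus ?thesis using D(1) by simp
  next
    case False
    from assms(1) obtain l0 where l0: "l0 \<in> L" by (metis finite.emptyI ex_in_conv)
    then obtain z0 where z0: "z0 \<in> zspan g (Suc n)" "y = of_nat l0 * z0" using Suc.prems by blast
    obtain a0 k0 where a0: "a0 \<in> zspan g n" "z0 = a0 + of_int k0 * g n" using zspan_Suc[OF z0(1)] by blast
    define b where "b = of_nat l0 * a0"
    define m where "m = int l0 * k0"
    have b: "b \<in> zspan g n" "y = b + of_int m * g n"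
      using a0 z0 zspan_of_nat_mult[OF a0(1), of l0] by (simp_all add: b_def m_def algebra_simps)
    \<comment> \<open>Uniqueness of the coefficient of \<open>g n\<close> makes \<open>m\<close> and
      \<open>b\<close> separately divisible by each \<open>l\<close>.\<close>
    have *: "\<exists>z\<in>zspan g n. \<exists>k. m = int l * k \<and> b = of_nat l * z" if "l \<in> L" for l
    proof -
      obtain z where z: "z \<in> zspan g (Suc n)" "y = of_nat l * z" using Suc.prems \<open>l \<in> L\<close> by blast
      obtain a k where a: "a \<in> zspan g n" "z = a + of_int k * g n" using zspan_Suc[OF z(1)] by blast
      have eq: "of_int (m - int l * k) * g n = of_nat l * a - b"
        using a z b by (simp add: algebra_simps)
      have "of_nat l * a - b \<in> zspan g n" using a b by (auto intro!: zspan_diff zspan_of_nat_mult)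
      hence "m - int l * k = 0" using False eq by metis
      thus ?thesis using a(1) eq by auto
    qed
    have "m = 0"
    proof (rule ccontr)
      assume m: "m \<noteq> 0"
      have "l \<le> nat \<bar>m\<bar>" if "l \<in> L" for l
      proof -
        have "int l dvd m" using *[OF that] by auto
        thus ?thesis using m using dvd_imp_le_int[of m "int l"] by (simp add: le_nat_iff)
      qed
      hence "L \<subseteq> {..nat \<bar>m\<bar>}" by auto
      thus False using assms(1) finite_subset by blast
    qed
    moreover have "b = 0" using * by (intro Suc.IH) auto
    ultimately show ?thesis using b(2) by simp
  qed
qed

locale root_span =
  fixes \<omega> :: complex and n :: nat
  assumes n_pos: "n > 0" and root: "\<omega> ^ n = 1"
begin

text \<open>Since \<open>\<omega> ^ n = 1\<close>, these \<open>n\<close> powers already span the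
  ring of all integer polynomials in \<open>\<omega>\<close>. Here \<open>\<omega>\<close> is any
  root of \<open>z ^ n = 1\<close>, so that the results can be applied again to its powers.\<close>

abbreviation "M \<equiv> zspan (\<lambda>j. \<omega> ^ j) n"

lemma power_in_M: "\<omega> ^ j \<in> M"
proof -
  have "\<omega> ^ j = (\<omega> ^ n) ^ (j div n) * \<omega> ^ (j mod n)"
    by (metis mult_div_mod_eq power_add power_mult)
  thus ?thesis using root n_pos zspan_gen[of "j mod n" n "\<lambda>j. \<omega> ^ j"] by simp
qed

lemma power_mult_M: "a \<in> M \<Longrightarrow> \<omega> ^ i * a \<in> M"
  by (induction rule: zspan.induct) (auto intro: zspan_0 zspan_diff power_in_M simp: right_diff_distrib simp flip: power_add)

lemma mult_M: "a \<in> M \<Longrightarrow> b \<in> M \<Longrightarrow> a * b \<in> M"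
  by (induction rule: zspan.induct) (auto intro: zspan_0 zspan_diff power_mult_M simp: left_diff_distrib)

lemma one_M: "1 \<in> M" using power_in_M[of 0] by simp

lemma power_M: "a \<in> M \<Longrightarrow> a ^ k \<in> M"
  by (induction k) (auto intro: one_M mult_M)

text \<open>The inner binomial coefficients are multiples of the prime \<open>l\<close>, and the
  quotient stays in \<open>M\<close> because \<open>M\<close> is a ring.\<close>

lemma frobenius_add:
  assumes "prime l" "a \<in> M" "b \<in> M"
  shows "\<exists>z\<in>M. (a + b) ^ l = a ^ l + b ^ l + of_nat l * z"
proof -
  have l: "l > 0" using assms(1) prime_gt_0_nat by blast
  define z where "z = (\<Sum>k\<in>{0<..<l}. of_nat ((l choose k) div l) * (a ^ k * b ^ (l - k)))"
  have "{..l} = insert 0 (insert l {0<..<l})" using l by auto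
  hence "(a + b) ^ l = a ^ l + b ^ l + (\<Sum>k\<in>{0<..<l}. of_nat (l choose k) * a ^ k * b ^ (l - k))"
    using l by (simp add: binomial_ring)
  also have "(\<Sum>k\<in>{0<..<l}. of_nat (l choose k) * a ^ k * b ^ (l - k)) = of_nat l * z"
    unfolding z_def sum_distrib_left
  proof (rule sum.cong)
    fix k assume k: "k \<in> {0<..<l}"
    hence "l dvd (l choose k)" using assms(1) by (intro dvd_choose_prime) auto
    hence "of_nat (l choose k) = (of_nat l * of_nat ((l choose k) div l) :: complex)"
      by (metis dvd_mult_div_cancel of_nat_mult)
    thus "of_nat (l choose k) * a ^ k * b ^ (l - k) = of_nat l * (of_nat ((l choose k) div l) * (a ^ k * b ^ (l - k)))"
      by simp
  qed auto
  finally show ?thesis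
    using assms by (intro bexI[of _ z]) (auto simp: z_def intro!: zspan_sum zspan_of_nat_mult mult_M power_M)
qed

lemma frobenius_sum:
  assumes "prime l" "finite A" "\<And>i. i \<in> A \<Longrightarrow> f i \<in> M"
  shows "\<exists>z\<in>M. (\<Sum>i\<in>A. f i) ^ l = (\<Sum>i\<in>A. f i ^ l) + of_nat l * z"
  using assms(2,3)
proof (induction A rule: finite_induct)
  case empty
  show ?case using assms(1) prime_gt_0_nat[of l] by (intro bexI[of _ 0]) (auto intro: zspan_0)
next
  case (insert i A)
  then obtain z where z: "z \<in> M" "(\<Sum>i\<in>A. f i) ^ l = (\<Sum>i\<in>A. f i ^ l) + of_nat l * z" by blast
  obtain z' where z': "z' \<in> M" "(f i + (\<Sum>i\<in>A. f i)) ^ l = f i ^ l + (\<Sum>i\<in>A. f i) ^ l + of_nat l * z'"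
    using frobenius_add[OF assms(1), of "f i" "\<Sum>i\<in>A. f i"] insert.prems by (auto intro!: zspan_sum)
  show ?case using insert z z' by (intro bexI[of _ "z + z'"]) (auto intro: zspan_add simp: algebra_simps)
qed

end

text \<open>
  If \<open>F\<close> is a sum of powers of \<open>\<omega>\<close> with coefficients \<open>1\<close> and \<open>-1\<close> that vanishes at \<open>\<omega>\<close>, then
  \<open>F (\<omega> ^ l)\<close> is divisible by the odd prime \<open>l\<close> in \<open>\<int>[\<omega>]\<close>, and it depends only on \<open>l\<close> modulo \<open>n\<close>. So
  it is zero if the residue class of \<open>l\<close> contains infinitely many primes. Every class coprime to \<open>n\<close>
  contains a number all of whose prime factors are of this kind, so Dirichlet's theorem is not needed.
\<close>

definition many_primes :: "nat \<Rightarrow> nat \<Rightarrow> bool" where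
  "many_primes n l \<longleftrightarrow> infinite {l'. prime l' \<and> [l' = l] (mod n)}"

lemma power_cong_root:
  fixes \<omega> :: complex
  assumes "\<omega> ^ n = 1" "[i = j] (mod n)"
  shows "\<omega> ^ i = \<omega> ^ j"
proof -
  have "\<omega> ^ i = \<omega> ^ (i mod n)" for i
    by (metis assms(1) mult_1 mult_div_mod_eq power_add power_mult power_one)
  thus ?thesis using assms(2) by (metis cong_def)
qed

lemma vanishing_sum_many_primes:
  fixes \<omega> :: complex and s :: "nat \<Rightarrow> int"
  assumes n: "n > 0" "\<omega> ^ n = 1" and s: "\<And>j. s j \<in> {-1, 1}"
    and zero: "(\<Sum>j<n. of_int (s j) * \<omega> ^ j) = 0" and l: "many_primes n l"
  shows "(\<Sum>j<n. of_int (s j) * (\<omega> ^ l) ^ j) = 0"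
proof -
  interpret root_span \<omega> n using n by unfold_locales
  \<comment> \<open>Only odd primes are kept, so that a sign equals its own \<open>l'\<close>-th
    power.\<close>
  define L where "L = {l'. prime l' \<and> [l' = l] (mod n)} - {2}"
  have "infinite L" using l unfolding L_def many_primes_def by simp
  thus ?thesis
  proof (rule zspan_infinitely_divisible)
    fix l' assume "l' \<in> L"
    hence l': "prime l'" "[l' = l] (mod n)" "odd l'"
      by (auto simp: L_def dest: primes_dvd_imp_eq[OF two_is_prime_nat])
    have sl: "s j ^ l' = s j" for j using s[of j] l'(3) by auto
    have "of_int (s j) * \<omega> ^ j \<in> M" for j by (intro zspan_of_int_mult power_in_M)
    then obtain z where z: "z \<in> M" "(\<Sum>j<n. of_int (s j) * \<omega> ^ j) ^ l' = (\<Sum>j<n. (of_int (s j) * \<omega> ^ j) ^ l') + of_nat l' * z"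
      using frobenius_sum[OF l'(1), of "{..<n}" "\<lambda>j. of_int (s j) * \<omega> ^ j"] by blast
    have "(of_int (s j) * \<omega> ^ j) ^ l' = of_int (s j) * (\<omega> ^ l) ^ j" for j
    proof -
      have "(of_int (s j) * \<omega> ^ j) ^ l' = of_int (s j ^ l') * (\<omega> ^ l') ^ j"
        by (simp add: power_mult_distrib power_mult[symmetric] mult.commute)
      thus ?thesis using sl power_cong_root[OF n(2) l'(2)] by simp
    qed
    hence "(\<Sum>j<n. of_int (s j) * (\<omega> ^ l) ^ j) = of_nat l' * (- z)"
      using z(2) zero prime_gt_0_nat[OF l'(1)] by (simp add: eq_neg_iff_add_eq_0 zero_power)
    thus "\<exists>z\<in>M. (\<Sum>j<n. of_int (s j) * (\<omega> ^ l) ^ j) = of_nat l' * z" using z(1) zspan_uminus by blast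
  qed
qed

lemma vanishing_sum_power:
  fixes \<omega> :: complex and s :: "nat \<Rightarrow> int"
  assumes n: "n > 0" and s: "\<And>j. s j \<in> {-1, 1}"
    and "m > 0" "\<And>l. prime l \<Longrightarrow> l dvd m \<Longrightarrow> many_primes n l" "\<omega> ^ n = 1" "(\<Sum>j<n. of_int (s j) * \<omega> ^ j) = 0"
  shows "(\<Sum>j<n. of_int (s j) * (\<omega> ^ m) ^ j) = 0"
  using assms(3-)
proof (induction m arbitrary: \<omega> rule: prime_divisors_induct)
  case (factor l m)
  have 1: "(\<Sum>j<n. of_int (s j) * (\<omega> ^ l) ^ j) = 0"
    using factor.hyps factor.prems by (intro vanishing_sum_many_primes[OF n _ s]) auto
  have "(\<Sum>j<n. of_int (s j) * ((\<omega> ^ l) ^ m) ^ j) = 0"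
  proof (rule factor.IH)
    show "m > 0" using factor.prems by simp
    show "many_primes n l'" if "prime l'" "l' dvd m" for l' using factor.prems(2)[of l'] that by simp
    have "(\<omega> ^ l) ^ n = (\<omega> ^ n) ^ l" by (simp add: power_mult[symmetric] mult.commute)
    thus "(\<omega> ^ l) ^ n = 1" using factor.prems(3) by simp
  qed (rule 1)
  thus ?case by (simp add: power_mult)
qed auto

text \<open>There are only \<open>n\<close> residue classes, and a class with finitely many primes
  contributes finitely many exceptions.\<close>

lemma few_primes_finite:
  assumes "n > 0"
  shows "finite {l. prime l \<and> \<not> many_primes n l}"
proof -
  have "{l. prime l \<and> \<not> many_primes n l} \<subseteq> (\<Union>r\<in>{r. r < n \<and> \<not> many_primes n r}. {l. prime l \<and> [l = r] (mod n)})"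
  proof
    fix l assume l: "l \<in> {l. prime l \<and> \<not> many_primes n l}"
    have "[l = l mod n] (mod n)" by (simp add: cong_def)
    moreover have "many_primes n (l mod n) = many_primes n l" by (simp add: many_primes_def cong_def)
    ultimately show "l \<in> (\<Union>r\<in>{r. r < n \<and> \<not> many_primes n r}. {l. prime l \<and> [l = r] (mod n)})"
      using l assms by (intro UN_I[of "l mod n"]) auto
  qed
  moreover have "finite (\<Union>r\<in>{r. r < n \<and> \<not> many_primes n r}. {l. prime l \<and> [l = r] (mod n)})"
    by (intro finite_UN_I) (auto simp: many_primes_def)
  ultimately show ?thesis by (rule finite_subset)
qed

lemma vanishing_sum_conjugate:
  fixes \<omega> :: complex and s :: "nat \<Rightarrow> int"
  assumes n: "n > 0" "\<omega> ^ n = 1" and s: "\<And>j. s j \<in> {-1, 1}"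
    and zero: "(\<Sum>j<n. of_int (s j) * \<omega> ^ j) = 0" and k: "coprime k n"
  shows "(\<Sum>j<n. of_int (s j) * (\<omega> ^ k) ^ j) = 0"
proof -
  \<comment> \<open>\<open>B\<close> collects the bad primes outside the divisors of
    \<open>n\<close>. A number congruent to \<open>k\<close> modulo \<open>n\<close> is coprime to
    \<open>n\<close>, and one congruent to 1 modulo the product of \<open>B\<close> has no prime
    factor in \<open>B\<close>; the Chinese remainder theorem combines the two.\<close>
  define B where "B = {l. prime l \<and> \<not> many_primes n l \<and> \<not> l dvd n}"
  have fB: "finite B" using few_primes_finite[OF n(1)] by (rule finite_subset[rotated]) (auto simp: B_def)
  define Q where "Q = \<Prod>B"
  have "coprime n Q" unfolding Q_def
    by (intro prod_coprime_right) (auto simp: B_def dest: prime_imp_coprime simp: coprime_commute)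
  then obtain m0 where m0: "[m0 = k] (mod n)" "[m0 = 1] (mod Q)"
    using binary_chinese_remainder_nat[of n Q k 1] by blast
  have Q0: "Q > 0" unfolding Q_def by (intro prod_pos) (auto simp: B_def prime_gt_0_nat)
  \<comment> \<open>Adding a multiple of both moduli makes the solution positive.\<close>
  define m where "m = m0 + n * Q"
  have m: "[m = k] (mod n)" "[m = 1] (mod Q)" "m > 0"
    using m0 n Q0 by (auto simp: m_def cong_def)
  have "many_primes n l" if l: "prime l" "l dvd m" for l
  proof (rule ccontr)
    assume c: "\<not> many_primes n l"
    have "\<not> l dvd n"
    proof
      assume "l dvd n"
      hence "[m = k] (mod l)" using m(1) by (meson cong_dvd_modulus_nat)
      hence "l dvd k" using l(2) by (meson cong_dvd_iff)
      thus False using k \<open>l dvd n\<close> l(1) by (meson coprime_common_divisor not_prime_unit)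
    qed
    hence "l \<in> B" using c l by (auto simp: B_def)
    hence "l dvd Q" unfolding Q_def using fB by (rule dvd_prodI[OF _ , rotated])
    hence "[m = 1] (mod l)" using m(2) by (meson cong_dvd_modulus_nat)
    hence "l dvd 1" using l(2) by (meson cong_dvd_iff)
    thus False using l(1) by (meson not_prime_unit)
  qed
  hence "(\<Sum>j<n. of_int (s j) * (\<omega> ^ m) ^ j) = 0"
    using vanishing_sum_power[OF n(1) s m(3) _ n(2) zero] by blast
  thus ?thesis using power_cong_root[OF n(2) m(1)] by simp
qed

section \<open>Periodic sign sequences and discrete Fourier inversion\<close>

definition periodic :: "nat \<Rightarrow> (int \<Rightarrow> 'a) \<Rightarrow> bool" where
  "periodic d f \<longleftrightarrow> (\<forall>j. f (j + int d) = f j)"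

lemma periodic_mult:
  assumes "periodic d f"
  shows "f (j + int d * k) = f j"
proof (induction k rule: int_induct[where k = 0])
  case (step1 i)
  have "f (j + int d * (i + 1)) = f ((j + int d * i) + int d)" by (simp add: algebra_simps)
  thus ?case using step1 assms by (simp add: periodic_def)
next
  case (step2 i)
  have "f (j + int d * (i - 1) + int d) = f (j + int d * i)" by (simp add: algebra_simps)
  thus ?case using step2 assms by (simp add: periodic_def)
qed simp

lemma periodic_cong:
  assumes "periodic d f" "[i = j] (mod int d)"
  shows "f i = f j"
proof -
  from assms(2) obtain k where "i = j + int d * k" by (metis cong_iff_lin cong_sym)
  thus ?thesis using periodic_mult[OF assms(1)] by simp
qed

lemma sum_shift_periodic:
  fixes f :: "nat \<Rightarrow> 'a::comm_monoid_add"
  assumes "\<And>j. f (j + n) = f j"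
  shows "(\<Sum>j<n. f (j + k)) = (\<Sum>j<n. f j)"
proof (induction k)
  case (Suc k)
  show ?case
  proof (cases n)
    case (Suc m)
    have "f (Suc m + k) = f k" using assms[of k] Suc by (simp add: add.commute)
    hence "(\<Sum>j<n. f (j + Suc k)) = (\<Sum>j<n. f (j + k))"
      unfolding Suc by (subst (2) sum.lessThan_Suc_shift) (simp add: add.commute)
    thus ?thesis using \<open>(\<Sum>j<n. f (j + k)) = (\<Sum>j<n. f j)\<close> by simp
  qed simp
qed simp

locale primitive_root =
  fixes \<eta> :: complex and n :: nat
  assumes n_pos: "n > 0" and root: "\<eta> ^ n = 1" and prim: "\<And>k. \<eta> ^ k = 1 \<Longrightarrow> n dvd k"
begin

lemma power_eq_1_iff: "\<eta> ^ k = 1 \<longleftrightarrow> n dvd k"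
  using prim root by (auto simp: power_mult)

lemma sum_powers: "(\<Sum>k<n. (\<eta> ^ i) ^ k) = (if n dvd i then of_nat n else 0)"
proof (cases "n dvd i")
  case True
  hence "\<eta> ^ i = 1" by (simp add: power_eq_1_iff)
  thus ?thesis using True by simp
next
  case False
  hence "\<eta> ^ i \<noteq> 1" by (simp add: power_eq_1_iff)
  moreover have "(\<eta> ^ i) ^ n = 1" using root by (metis power_mult mult.commute power_one)
  ultimately show ?thesis using False by (simp add: geometric_sum)
qed

text \<open>Shifting the index by \<open>d\<close> multiplies the sum by \<open>\<eta> ^ d\<close>,
  which is not 1, and yet leaves it unchanged because the terms are
  \<open>n\<close>-periodic.\<close>

lemma vanishing_sum_if_periodic:
  fixes s :: "int \<Rightarrow> int"
  assumes "periodic d s" "d dvd n" "d < n"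
  shows "(\<Sum>j<n. of_int (s (int j)) * \<eta> ^ j) = 0"
proof -
  define f where "f = (\<lambda>j. of_int (s (int j)) * \<eta> ^ j)"
  obtain e where e: "n = d * e" using assms(2) by blast
  have d0: "d > 0" using n_pos e by (cases d) auto
  have fn: "f (j + n) = f j" for j
    using periodic_mult[OF assms(1), of "int j" "int e"] e root by (simp add: f_def power_add)
  have fd: "f (j + d) = \<eta> ^ d * f j" for j
    using assms(1) by (simp add: f_def periodic_def power_add)
  have "\<eta> ^ d * (\<Sum>j<n. f j) = (\<Sum>j<n. f (j + d))" by (simp add: fd sum_distrib_left)
  also have "\<dots> = (\<Sum>j<n. f j)" by (rule sum_shift_periodic) (rule fn)
  finally have "(\<eta> ^ d - 1) * (\<Sum>j<n. f j) = 0" by (simp add: algebra_simps)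
  moreover have "\<eta> ^ d \<noteq> 1" using assms(3) d0 by (auto simp: power_eq_1_iff dest: dvd_imp_le)
  ultimately show ?thesis by (simp add: f_def)
qed

text \<open>The exponent \<open>(n - 1) * t\<close> stands for \<open>- t\<close> modulo
  \<open>n\<close> and keeps all powers natural.\<close>

lemma fourier_inversion:
  fixes s :: "int \<Rightarrow> int"
  assumes "periodic n s"
  shows "of_nat n * of_int (s (int t)) = (\<Sum>k<n. (\<Sum>i<n. of_int (s (int i)) * (\<eta> ^ k) ^ i) * (\<eta> ^ k) ^ ((n - 1) * t))"
proof -
  have term_eq: "c * (\<eta> ^ k) ^ i * (\<eta> ^ k) ^ m = c * (\<eta> ^ (i + m)) ^ k" for c k i m
    by (simp add: power_mult[symmetric] power_add[symmetric] algebra_simps)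
  have "(\<Sum>k<n. (\<Sum>i<n. of_int (s (int i)) * (\<eta> ^ k) ^ i) * (\<eta> ^ k) ^ ((n - 1) * t))
      = (\<Sum>k<n. \<Sum>i<n. of_int (s (int i)) * (\<eta> ^ (i + (n - 1) * t)) ^ k)"
    unfolding sum_distrib_right by (intro sum.cong refl term_eq)
  also have "\<dots> = (\<Sum>i<n. of_int (s (int i)) * (\<Sum>k<n. (\<eta> ^ (i + (n - 1) * t)) ^ k))"
    by (subst sum.swap) (simp add: sum_distrib_left)
  also have "\<dots> = (\<Sum>i<n. if i = t mod n then of_int (s (int i)) * of_nat n else 0)"
  proof (rule sum.cong)
    fix i assume i: "i \<in> {..<n}"
    have "int (n - 1) = int n - 1" using n_pos by simp
    hence "n dvd i + (n - 1) * t \<longleftrightarrow> int n dvd int i + (int n - 1) * int t"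
      by (metis of_nat_add of_nat_dvd_iff of_nat_mult)
    also have "\<dots> \<longleftrightarrow> int n dvd (int i - int t) + int n * int t" by (simp add: algebra_simps)
    also have "\<dots> \<longleftrightarrow> int n dvd int i - int t" by (meson dvd_add_left_iff dvd_triv_left)
    also have "\<dots> \<longleftrightarrow> [int i = int t] (mod int n)" by (simp add: cong_iff_dvd_diff)
    also have "\<dots> \<longleftrightarrow> i = t mod n" unfolding cong_int_iff using i by (simp add: cong_def)
    finally show "of_int (s (int i)) * (\<Sum>k<n. (\<eta> ^ (i + (n - 1) * t)) ^ k) =
         (if i = t mod n then of_int (s (int i)) * of_nat n else 0)" by (simp add: sum_powers)
  qed auto
  also have "\<dots> = of_int (s (int (t mod n))) * of_nat n" using n_pos by (simp add: sum.delta)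
  also have "s (int (t mod n)) = s (int t)"
    by (rule periodic_cong[OF assms]) (simp add: cong_int_iff)
  finally show ?thesis by (simp add: mult.commute)
qed

text \<open>On the Fourier side the mixed difference multiplies the coefficient at \<open>k\<close>
  by \<open>(1 - g p k) * (1 - g q k)\<close>. For \<open>k\<close> coprime to \<open>n\<close> the
  coefficient is a conjugate of the vanishing sum; any other \<open>k\<close> is divisible by
  \<open>p\<close> or \<open>q\<close>, and then one of the two factors is zero.\<close>

lemma second_difference_zero:
  fixes s :: "int \<Rightarrow> int"
  assumes per: "periodic n s" and pm: "\<And>j. s j \<in> {-1, 1}"
    and pq: "n = p * q" "prime p" "prime q"
    and zero: "(\<Sum>j<n. of_int (s (int j)) * \<eta> ^ j) = 0"
  shows "s j - s (j + int p) = s (j + int q) - s (j + int p + int q)"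
proof -
  define hat where "hat k = (\<Sum>i<n. of_int (s (int i)) * (\<eta> ^ k) ^ i)" for k
  define g where "g t k = (\<eta> ^ k) ^ ((n - 1) * t)" for t k
  have inv: "of_nat n * of_int (s (int t)) = (\<Sum>k<n. hat k * g t k)" for t
    unfolding hat_def g_def by (rule fourier_inversion[OF per])
  have g_add: "g (t + t') k = g t k * g t' k" for t t' k by (simp only: g_def distrib_left power_add)
  have term0: "hat k * g t k - hat k * g (t + p) k - hat k * g (t + q) k + hat k * g (t + p + q) k = 0" for t k
  proof -
    have "hat k = 0 \<or> g p k = 1 \<or> g q k = 1"
    proof (cases "coprime k n")
      case True
      have "hat k = 0" unfolding hat_def
        using vanishing_sum_conjugate[OF n_pos root _ zero True] pm by simp
      thus ?thesis ..
    next
      case False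
      hence "p dvd k \<or> q dvd k" using pq
        by (meson coprime_commute coprime_mult_right_iff prime_imp_coprime)
      moreover have "g q k = 1" if "p dvd k"
      proof -
        have "n dvd k * ((n - 1) * q)" using that by (auto simp: pq(1))
        thus ?thesis by (simp add: g_def power_eq_1_iff flip: power_mult)
      qed
      moreover have "g p k = 1" if "q dvd k"
      proof -
        have "n dvd k * ((n - 1) * p)" using that by (auto simp: pq(1))
        thus ?thesis by (simp add: g_def power_eq_1_iff flip: power_mult)
      qed
      ultimately show ?thesis by blast
    qed
    moreover have "hat k * g t k - hat k * g (t + p) k - hat k * g (t + q) k + hat k * g (t + p + q) k
       = hat k * g t k * (1 - g p k) * (1 - g q k)" by (simp add: g_add algebra_simps)
    ultimately show ?thesis by auto
  qed
  define t where "t = nat (j mod int n)"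
  have t: "[int t = j] (mod int n)" using n_pos by (simp add: t_def cong_def)
  have st: "s (int (t + a)) = s (j + int a)" for a
    by (rule periodic_cong[OF per]) (use t in \<open>simp add: cong_add_rcancel\<close>)
  have "of_nat n * (of_int (s (int t)) - of_int (s (int (t + p))) - of_int (s (int (t + q))) + of_int (s (int (t + p + q)))) = (0::complex)"
    by (simp only: ring_distribs inv sum_subtractf[symmetric] sum.distrib[symmetric] term0 sum.neutral_const)
  hence "of_int (s (int t) - s (int (t + p)) - s (int (t + q)) + s (int (t + p + q))) = (0::complex)"
    using n_pos by simp
  hence "s (int t) - s (int (t + p)) - s (int (t + q)) + s (int (t + p + q)) = 0"
    unfolding of_int_eq_0_iff .
  thus ?thesis using st[of 0] st[of p] st[of q] st[of "p + q"] by (simp add: add.assoc)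
qed

end

lemma coprime_class_meet:
  fixes p q :: nat
  assumes "coprime p q"
  shows "\<exists>a b. (j::int) + int q * a = i + int p * b"
proof -
  have "coprime (int p) (int q)" using assms by simp
  then obtain z where "[z = j] (mod int q)" "[z = i] (mod int p)"
    using binary_chinese_remainder_int[of "int q" "int p" j i] by (auto simp: coprime_commute)
  thus ?thesis by (metis cong_iff_lin cong_sym)
qed

text \<open>If \<open>p\<close>-periodicity fails at \<open>j\<close>, then
  \<open>s j - s (j + p)\<close> is 2 or -2 and determines \<open>s j\<close>; as this difference is
  \<open>q\<close>-periodic, \<open>s\<close> is constant on the class of \<open>j\<close> modulo
  \<open>q\<close>. Likewise a failure of \<open>q\<close>-periodicity at \<open>i\<close> makes
  \<open>s\<close> constant on the classes of \<open>i\<close> and of \<open>i + q\<close> modulo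
  \<open>p\<close>. Both of these meet the first class, so \<open>s i = s (i + q)\<close>, a
  contradiction.\<close>

lemma periodic_or_periodic:
  fixes s :: "int \<Rightarrow> int"
  assumes pm: "\<And>j. s j \<in> {-1, 1}" and "coprime p q"
    and diff: "\<And>j. s j - s (j + int p) = s (j + int q) - s (j + int p + int q)"
  shows "periodic p s \<or> periodic q s"
proof (rule ccontr)
  have pm: "s j = -1 \<or> s j = 1" for j using pm[of j] by auto
  assume "\<not> (periodic p s \<or> periodic q s)"
  then obtain j i where j: "s (j + int p) \<noteq> s j" and i: "s (i + int q) \<noteq> s i"
    unfolding periodic_def by blast
  have perq: "periodic q (\<lambda>j. s j - s (j + int p))"
    using diff by (simp add: periodic_def algebra_simps)
  have sj: "s (j + int q * a) = s j" for a
  proof -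
    have "s (j + int q * a) - s (j + int q * a + int p) = s j - s (j + int p)"
      using periodic_mult[OF perq, of j a] by simp
    thus ?thesis using pm[of j] pm[of "j + int p"] pm[of "j + int q * a"] pm[of "j + int q * a + int p"] j
      by linarith
  qed
  have perp: "periodic p (\<lambda>j. s j - s (j + int q))"
    using diff by (simp add: periodic_def algebra_simps)
  have si: "s (i + int p * b) = s i" "s (i + int q + int p * b) = s (i + int q)" for b
  proof -
    have "s (i + int p * b) - s (i + int p * b + int q) = s i - s (i + int q)"
      using periodic_mult[OF perp, of i b] by simp
    thus "s (i + int p * b) = s i" "s (i + int q + int p * b) = s (i + int q)"
      using pm[of i] pm[of "i + int q"] pm[of "i + int p * b"] pm[of "i + int p * b + int q"] i
      by (simp_all add: algebra_simps) linarith+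
  qed
  have "s j = s i" "s j = s (i + int q)"
    using sj si coprime_class_meet[OF assms(2), of j i] coprime_class_meet[OF assms(2), of j "i + int q"] by metis+
  thus False using i by simp
qed

lemma (in primitive_root) vanishing_sum_iff_periodic:
  fixes s :: "int \<Rightarrow> int"
  assumes "periodic n s" "\<And>j. s j \<in> {-1, 1}" "n = p * q" "prime p" "prime q" "p \<noteq> q"
  shows "(\<Sum>j<n. of_int (s (int j)) * \<eta> ^ j) = 0 \<longleftrightarrow> periodic p s \<or> periodic q s"
proof
  assume "(\<Sum>j<n. of_int (s (int j)) * \<eta> ^ j) = 0"
  from second_difference_zero[OF assms(1-5) this] show "periodic p s \<or> periodic q s"
    using assms by (intro periodic_or_periodic primes_coprime) auto
next
  have "p > 1" "q > 1" using assms prime_gt_1_nat by auto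
  hence "p < n" "q < n" using assms(3) by auto
  thus "periodic p s \<or> periodic q s \<Longrightarrow> (\<Sum>j<n. of_int (s (int j)) * \<eta> ^ j) = 0"
    using vanishing_sum_if_periodic assms(3) by auto
qed

section \<open>Sign patterns up to dihedral symmetry\<close>

text \<open>\<open>G\<close> is a mere set of indices: \<open>trans\<close> supplies left
  multiplication by \<open>h\<close> as a permutation of it. This permits a finite system of
  representatives of an infinite group.\<close>

lemma burnside_class:
  fixes r :: "('x \<times> 'x) set" and act :: "'g \<Rightarrow> 'x \<Rightarrow> 'x"
  assumes fin: "finite G" "finite X" and eq: "equiv UNIV r"
    and orbit: "\<And>x. x \<in> X \<Longrightarrow> r `` {x} = (\<lambda>g. act g x) ` G" and closed: "\<And>g x. g \<in> G \<Longrightarrow> x \<in> X \<Longrightarrow> act g x \<in> X"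
    and inj: "\<And>h. h \<in> G \<Longrightarrow> inj_on (act h) X"
    and trans: "\<And>h. h \<in> G \<Longrightarrow> \<exists>\<sigma>. bij_betw \<sigma> G G \<and> (\<forall>g\<in>G. \<forall>x\<in>X. act (\<sigma> g) x = act h (act g x))"
    and C: "C \<in> X // r"
  shows "(\<Sum>x\<in>C. card {g\<in>G. act g x = x}) = card G"
proof -
  obtain x0 where x0: "x0 \<in> X" "C = r `` {x0}" using C by (auto simp: quotient_def)
  have CX: "C \<subseteq> X" using x0 orbit closed by auto
  have finC: "finite C" using CX fin(2) finite_subset by blast
  have stab: "card C * card {g\<in>G. act g x = x} = card G" if x: "x \<in> C" for x
  proof -
    have xX: "x \<in> X" using x CX by auto
    have Cx: "C = (\<lambda>g. act g x) ` G"
      using x x0 orbit[OF xX] equiv_class_eq[OF eq] by fastforce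
    \<comment> \<open>The indices that carry \<open>x\<close> to \<open>y\<close> form a coset of
      the stabiliser, namely its image under left multiplication by \<open>h\<close>.\<close>
    have N: "card {g\<in>G. act g x = y} = card {g\<in>G. act g x = x}" if "y \<in> C" for y
    proof -
      obtain h where h: "h \<in> G" "y = act h x" using \<open>y \<in> C\<close> unfolding Cx by blast
      obtain \<sigma> where \<sigma>: "bij_betw \<sigma> G G" "\<And>g. g \<in> G \<Longrightarrow> act (\<sigma> g) x = act h (act g x)"
        using trans[OF h(1)] xX by blast
      have iff: "act (\<sigma> g) x = y \<longleftrightarrow> act g x = x" if "g \<in> G" for g
        unfolding \<sigma>(2)[OF that] h(2) using inj_on_eq_iff[OF inj[OF h(1)] closed[OF that xX] xX] .
      have surj: "\<sigma> ` G = G" using \<sigma>(1) by (simp add: bij_betw_def)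
      have "\<sigma> ` {g\<in>G. act g x = x} = {g\<in>G. act g x = y}"
      proof (intro equalityI subsetI)
        fix z assume z: "z \<in> {g\<in>G. act g x = y}"
        then obtain g where "g \<in> G" "z = \<sigma> g" using surj by blast
        moreover from this have "act g x = x" using z iff by simp
        ultimately show "z \<in> \<sigma> ` {g\<in>G. act g x = x}" by simp
      next
        fix z assume "z \<in> \<sigma> ` {g\<in>G. act g x = x}"
        then obtain g where "g \<in> G" "act g x = x" "z = \<sigma> g" by blast
        hence "z \<in> G" "act z x = y" using iff[of g] bij_betwE[OF \<sigma>(1)] by auto
        thus "z \<in> {g\<in>G. act g x = y}" by simp
      qed
      moreover have "card (\<sigma> ` {g\<in>G. act g x = x}) = card {g\<in>G. act g x = x}"
        by (rule card_image, rule inj_on_subset[OF bij_betw_imp_inj_on[OF \<sigma>(1)]]) auto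
      ultimately show ?thesis by simp
    qed
    have "card G = (\<Sum>y\<in>C. card {g\<in>G. act g x = y})"
      using sum.image_gen[OF fin(1), of "\<lambda>_. 1::nat" "\<lambda>g. act g x"] unfolding Cx by simp
    also have "\<dots> = (\<Sum>y\<in>C. card {g\<in>G. act g x = x})" by (intro sum.cong refl N)
    also have "\<dots> = card C * card {g\<in>G. act g x = x}" by simp
    finally show ?thesis ..
  qed
  have ne: "x0 \<in> C" using x0 eq by (auto simp: equiv_def refl_on_def)
  hence "card C > 0" using finC card_gt_0_iff by blast
  hence "card {g\<in>G. act g x = x} = card {g\<in>G. act g x0 = x0}" if "x \<in> C" for x
    using stab[OF that] stab[OF ne] by (metis mult_left_cancel neq0_conv)
  hence "(\<Sum>x\<in>C. card {g\<in>G. act g x = x}) = card C * card {g\<in>G. act g x0 = x0}" by simp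
  thus ?thesis using stab[OF ne] by simp
qed

lemma burnside:
  fixes r :: "('x \<times> 'x) set" and act :: "'g \<Rightarrow> 'x \<Rightarrow> 'x"
  assumes fin: "finite G" "finite X" and eq: "equiv UNIV r"
    and orbit: "\<And>x. x \<in> X \<Longrightarrow> r `` {x} = (\<lambda>g. act g x) ` G" and closed: "\<And>g x. g \<in> G \<Longrightarrow> x \<in> X \<Longrightarrow> act g x \<in> X"
    and inj: "\<And>h. h \<in> G \<Longrightarrow> inj_on (act h) X"
    and trans: "\<And>h. h \<in> G \<Longrightarrow> \<exists>\<sigma>. bij_betw \<sigma> G G \<and> (\<forall>g\<in>G. \<forall>x\<in>X. act (\<sigma> g) x = act h (act g x))"
  shows "card (X // r) * card G = (\<Sum>g\<in>G. card {x\<in>X. act g x = x})"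
proof -
  have "X \<subseteq> \<Union>(X // r)" using eq by (auto simp: quotient_def equiv_def refl_on_def)
  moreover have "\<Union>(X // r) \<subseteq> X" using orbit closed by (auto simp: quotient_def)
  ultimately have X: "X = \<Union>(X // r)" by (rule equalityI)
  have "(\<Sum>g\<in>G. card {x\<in>X. act g x = x}) = (\<Sum>x\<in>X. card {g\<in>G. act g x = x})"
    using sum_multicount_gen[OF fin, of "\<lambda>g x. act g x = x" "\<lambda>x. card {g\<in>G. act g x = x}"] by simp
  also have "\<dots> = (\<Sum>x\<in>\<Union>(X // r). card {g\<in>G. act g x = x})" by (rule sum.cong[OF X refl])
  also have "\<dots> = (\<Sum>C\<in>X // r. \<Sum>x\<in>C. card {g\<in>G. act g x = x})"
  proof (subst sum.Union_disjoint)
    show "\<forall>A\<in>X // r. finite A" using orbit fin by (auto simp: quotient_def)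
    show "\<forall>A\<in>X // r. \<forall>B\<in>X // r. A \<noteq> B \<longrightarrow> A \<inter> B = {}"
    proof -
      have "X // r \<subseteq> UNIV // r" by (auto simp: quotient_def)
      thus ?thesis using quotient_disj[OF eq] by (meson subsetD)
    qed
  qed simp
  also have "\<dots> = (\<Sum>C\<in>X // r. card G)"
    using burnside_class[OF assms] by (intro sum.cong refl) blast
  finally show ?thesis by simp
qed

text \<open>A translation by an odd number comes with a complement, because \<open>f\<close> stands for the word \<open>\<lambda>j. f j \<noteq> odd j\<close>.\<close>

definition dih :: "((int \<Rightarrow> bool) \<times> (int \<Rightarrow> bool)) set" where
  "dih = {(f, g). \<exists>k. (\<forall>j. g j = (f (j + k) \<noteq> odd k)) \<or> (\<forall>j. g j = (f (k - j) \<noteq> odd k))}"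

definition dih_act :: "int \<times> bool \<Rightarrow> (int \<Rightarrow> bool) \<Rightarrow> int \<Rightarrow> bool" where
  "dih_act h f j = (f (if snd h then fst h - j else j + fst h) \<noteq> odd (fst h))"

lemma dih_iff: "(f, g) \<in> dih \<longleftrightarrow> (\<exists>h. g = dih_act h f)"
  unfolding dih_def dih_act_def fun_eq_iff by (auto simp: split_paired_Ex ex_bool_eq)

lemma dih_act_comp:
  "dih_act (k, s) (dih_act (k', s') f) = dih_act (if s' then k' - k else k' + k, s \<noteq> s') f"
  by (cases s; cases s') (auto simp: fun_eq_iff dih_act_def algebra_simps)

lemma dih_act_0: "dih_act (0, False) f = f"
  by (auto simp: fun_eq_iff dih_act_def)

lemma dih_act_inverse: "dih_act (if s then k else - k, s) (dih_act (k, s) f) = f"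
  by (simp add: dih_act_comp dih_act_0)

lemma equiv_dih: "equiv UNIV dih"
proof (rule equivI)
  show "refl dih" unfolding refl_on_def dih_iff using dih_act_0 by (metis UNIV_I)
  show "sym dih" unfolding sym_def dih_iff using dih_act_inverse by (metis prod.collapse)
  show "trans dih" unfolding trans_def dih_iff using dih_act_comp by (metis prod.collapse)
qed simp

section \<open>Periodic words and the fixed points of the symmetries\<close>

definition periodics :: "nat \<Rightarrow> (int \<Rightarrow> bool) set" where
  "periodics d = {f. periodic d f}"

lemma dih_act_periodics: "f \<in> periodics d \<Longrightarrow> dih_act h f \<in> periodics d"
proof -
  assume "f \<in> periodics d"
  hence f: "f (j + int d) = f j" for j by (simp add: periodics_def periodic_def)
  have "f (fst h - (j + int d)) = f (fst h - j)" for j using f[of "fst h - (j + int d)"] by simp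
  moreover have "f (j + int d + fst h) = f (j + fst h)" for j
    using f[of "j + fst h"] by (simp add: algebra_simps)
  ultimately show ?thesis by (simp add: periodics_def periodic_def dih_act_def)
qed

lemma dih_periodics: "(f, g) \<in> dih \<Longrightarrow> f \<in> periodics d \<Longrightarrow> g \<in> periodics d"
  by (auto simp: dih_iff dih_act_periodics)

text \<open>The modulus is \<open>2 * d\<close> rather than \<open>d\<close>: the complement depends
  on the parity of \<open>k\<close>, which only an even modulus preserves.\<close>

lemma dih_act_mod:
  assumes "f \<in> periodics d"
  shows "dih_act (k mod (2 * int d), s) f = dih_act (k, s) f"
proof -
  have *: "k mod (2 * int d) = k + int d * (- 2 * (k div (2 * int d)))"
    by (simp add: minus_mult_div_eq_mod[symmetric] algebra_simps)
  have "f (k mod (2 * int d) - j) = f (k - j)" "f (j + k mod (2 * int d)) = f (j + k)" for j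
    using assms periodic_mult[of d f "k - j" "- 2 * (k div (2 * int d))"]
      periodic_mult[of d f "j + k" "- 2 * (k div (2 * int d))"] unfolding *
    by (simp_all add: periodics_def algebra_simps)
  moreover have "odd (k mod (2 * int d)) = odd k" unfolding * by simp
  ultimately show ?thesis by (auto simp: fun_eq_iff dih_act_def)
qed

lemma bij_betw_periodics:
  assumes "d > 0"
  shows "bij_betw (\<lambda>f. {i. i < d \<and> f (int i)}) (periodics d) (Pow {..<d})"
proof (rule bij_betw_byWitness[where f' = "\<lambda>S j. nat (j mod int d) \<in> S"])
  show "\<forall>f\<in>periodics d. (\<lambda>j. nat (j mod int d) \<in> {i. i < d \<and> f (int i)}) = f"
  proof
    fix f assume "f \<in> periodics d"
    hence "f (j mod int d) = f j" for j by (intro periodic_cong[of d f]) (auto simp: periodics_def cong_def)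
    thus "(\<lambda>j. nat (j mod int d) \<in> {i. i < d \<and> f (int i)}) = f"
      using assms by (auto simp: fun_eq_iff nat_less_iff)
  qed
qed (use assms in \<open>auto simp: periodics_def periodic_def\<close>)

lemma card_periodics: "d > 0 \<Longrightarrow> card (periodics d) = 2 ^ d"
  using bij_betw_same_card[OF bij_betw_periodics] by (simp add: card_Pow)

lemma finite_periodics: "d > 0 \<Longrightarrow> finite (periodics d)"
  using bij_betw_finite[OF bij_betw_periodics] by simp

text \<open>In a cycle of odd length \<open>2 * m + 1\<close> the reflection about \<open>l\<close>
  fixes \<open>l\<close> and pairs off the remaining positions, so \<open>m + 1\<close> values are
  free.\<close>

lemma bij_betw_palindromes:
  fixes l :: int
  shows "bij_betw (\<lambda>f. {i. i \<le> m \<and> f (l + int i)}) {f \<in> periodics (2 * m + 1). \<forall>j. f (l + j) = f (l - j)} (Pow {..m})"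
proof -
  define d where "d = 2 * m + 1"
  \<comment> \<open>\<open>\<rho> j\<close> is the distance from \<open>j\<close> to
    \<open>l\<close> around the cycle of length \<open>d\<close>.\<close>
  define \<rho> where "\<rho> j = nat (min ((j - l) mod int d) ((l - j) mod int d))" for j
  have \<rho>: "\<rho> j \<le> m" "[j = l + int (\<rho> j)] (mod int d) \<or> [j = l - int (\<rho> j)] (mod int d)" for j
  proof -
    define a where "a = (j - l) mod int d"
    have a: "0 \<le> a" "a < int d" by (auto simp: a_def d_def)
    have b: "(l - j) mod int d = (if a = 0 then 0 else int d - a)"
      unfolding a_def using zmod_zminus1_eq_if[of "j - l" "int d"] by (simp add: minus_diff_eq)
    show "\<rho> j \<le> m" unfolding \<rho>_def a_def[symmetric] b using a by (auto simp: d_def min_def)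
    have "int (\<rho> j) = a \<or> int (\<rho> j) = (l - j) mod int d"
      unfolding \<rho>_def a_def[symmetric] using a by (auto simp: min_def d_def)
    moreover have "[j = l + a] (mod int d)"
    proof -
      have "j - (l + a) = (j - l) - (j - l) mod int d" by (simp add: a_def)
      thus ?thesis unfolding cong_iff_dvd_diff by (metis dvd_minus_mod)
    qed
    moreover have "[j = l - (l - j) mod int d] (mod int d)"
    proof -
      have "j - (l - (l - j) mod int d) = - ((l - j) - (l - j) mod int d)" by simp
      thus ?thesis unfolding cong_iff_dvd_diff by (metis dvd_minus_mod dvd_minus_iff)
    qed
    ultimately show "[j = l + int (\<rho> j)] (mod int d) \<or> [j = l - int (\<rho> j)] (mod int d)" by auto
  qed
  have \<rho>_small: "\<rho> (l + int i) = i" if "i \<le> m" for i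
  proof -
    have "(- int i) mod int d = (if i = 0 then 0 else int d - int i)"
      using that zmod_zminus1_eq_if[of "int i" "int d"] by (auto simp: d_def)
    thus ?thesis using that by (auto simp: \<rho>_def d_def min_def)
  qed
  have "bij_betw (\<lambda>f. {i. i \<le> m \<and> f (l + int i)}) {f \<in> periodics d. \<forall>j. f (l + j) = f (l - j)} (Pow {..m})"
  proof (rule bij_betw_byWitness[where f' = "\<lambda>S j. \<rho> j \<in> S"])
    show "\<forall>f\<in>{f \<in> periodics d. \<forall>j. f (l + j) = f (l - j)}. (\<lambda>j. \<rho> j \<in> {i. i \<le> m \<and> f (l + int i)}) = f"
    proof
      fix f assume f: "f \<in> {f \<in> periodics d. \<forall>j. f (l + j) = f (l - j)}"
      have "f (l + int (\<rho> j)) = f j" for j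
        using \<rho>(2)[of j] f periodic_cong[of d f] by (auto simp: periodics_def)
      thus "(\<lambda>j. \<rho> j \<in> {i. i \<le> m \<and> f (l + int i)}) = f" using \<rho>(1) by (auto simp: fun_eq_iff)
    qed
    show "\<forall>S\<in>Pow {..m}. {i. i \<le> m \<and> \<rho> (l + int i) \<in> S} = S" using \<rho>_small by auto
    have "\<rho> (j + int d) = \<rho> j" for j
    proof -
      have "(l - (j + int d)) mod int d = (l - j) mod int d" by (simp flip: diff_diff_eq)
      moreover have "(j + int d - l) mod int d = (j - l) mod int d" 
      proof -
        have "j + int d - l = (j - l) + int d" by simp
        thus ?thesis by (metis mod_add_self2)
      qed
      ultimately show ?thesis by (simp add: \<rho>_def)
    qed
    moreover have "\<rho> (l + j) = \<rho> (l - j)" for j by (simp add: \<rho>_def min.commute)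
    ultimately show "(\<lambda>S j. \<rho> j \<in> S) ` Pow {..m} \<subseteq> {f \<in> periodics d. \<forall>j. f (l + j) = f (l - j)}"
      by (auto simp: periodics_def periodic_def)
  qed auto
  thus ?thesis by (simp add: d_def)
qed

lemma card_palindromes:
  fixes l :: int
  shows "card {f \<in> periodics (2 * m + 1). \<forall>j. f (l + j) = f (l - j)} = 2 ^ (m + 1)"
  using bij_betw_same_card[OF bij_betw_palindromes[of m l]] by (simp add: card_Pow)

lemma coprime_periodic_const:
  assumes "coprime p q" "periodic p f" "periodic q f"
  shows "f i = f j"
  using coprime_class_meet[OF assms(1), of i j] periodic_mult[OF assms(2)] periodic_mult[OF assms(3)] by metis

lemma coprime_periodics_Int:
  assumes "coprime p q"
  shows "periodics p \<inter> periodics q = {\<lambda>_. True, \<lambda>_. False}"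
proof
  show "periodics p \<inter> periodics q \<subseteq> {\<lambda>_. True, \<lambda>_. False}"
  proof
    fix f assume "f \<in> periodics p \<inter> periodics q"
    hence "f j = f 0" for j using coprime_periodic_const[OF assms, of f j 0] by (simp add: periodics_def)
    hence "f = (\<lambda>_. f 0)" by blast
    thus "f \<in> {\<lambda>_. True, \<lambda>_. False}" by (cases "f 0") auto
  qed
qed (auto simp: periodics_def periodic_def)

text \<open>An odd translation complements the word; iterated \<open>d\<close> times, an odd number,
  it still does, although \<open>k * d\<close> is a multiple of the period. An odd reflection has a
  fixed position modulo the odd number \<open>d\<close>, where the value would differ from
  itself.\<close>

lemma fixed_odd:
  assumes "odd d" "odd k"
  shows "{f \<in> periodics d. dih_act (k, s) f = f} = {}"
proof -
  have False if f: "f \<in> periodics d" "dih_act (k, s) f = f" for f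
  proof (cases s)
    case False
    have step: "f (j + k) = (\<not> f j)" for j
      using fun_cong[OF f(2), of j] assms(2) False by (auto simp: dih_act_def)
    have "f (j + k * int i) = (f j = even i)" for i j
    proof (induction i)
      case (Suc i)
      have "f (j + k * int (Suc i)) = (\<not> f (j + k * int i))"
        using step[of "j + k * int i"] by (simp add: algebra_simps)
      thus ?case using Suc by simp
    qed simp
    from this[of 0 d] have "f (k * int d) \<noteq> f 0" using assms(1) by simp
    thus False using periodic_mult[of d f 0 k] f(1) by (simp add: periodics_def mult.commute)
  next
    case True
    have step: "f (k - j) = (\<not> f j)" for j
      using fun_cong[OF f(2), of j] assms(2) True by (auto simp: dih_act_def)
    obtain m where m: "k + int d = 2 * m" 
    proof -
      have "even (k + int d)" using assms by simp
      thus ?thesis using that by (elim evenE)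
    qed
    have "k - m = m + int d * (- 1)" using m by simp
    hence "f (k - m) = f m" using periodic_mult[of d f m "-1"] f(1) by (simp add: periodics_def)
    thus False using step by auto
  qed
  thus ?thesis by blast
qed

text \<open>\<open>2 * l\<close> is coprime to \<open>p\<close>, so a fixed word has two coprime
  periods and is constant.\<close>

lemma fixed_translation:
  assumes "prime p" "odd p" "0 < l" "l < int p"
  shows "card {f \<in> periodics p. dih_act (2 * l, False) f = f} = 2"
proof -
  have "{f \<in> periodics p. dih_act (2 * l, False) f = f} = periodics p \<inter> periodics (nat (2 * l))"
    using assms(3) by (auto simp: periodics_def periodic_def dih_act_def fun_eq_iff)
  moreover have "coprime p (nat (2 * l))"
  proof -
    have "nat (2 * l) = 2 * nat l" using assms(3) by simp
    moreover have "coprime p 2" using assms(2) by simp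
    moreover have "coprime p (nat l)" using assms by (intro prime_imp_coprime) (auto dest: dvd_imp_le)
    ultimately show ?thesis by simp
  qed
  moreover have "(\<lambda>_::int. True) \<noteq> (\<lambda>_. False)" by (simp add: fun_eq_iff)
  ultimately show ?thesis by (simp add: coprime_periodics_Int)
qed

lemma fixed_reflection:
  "{f \<in> periodics d. dih_act (2 * l, True) f = f} = {f \<in> periodics d. \<forall>j. f (l + j) = f (l - j)}"
proof -
  have "(\<forall>j. f (2 * l - j) = f j) \<longleftrightarrow> (\<forall>j. f (l + j) = f (l - j))" for f :: "int \<Rightarrow> bool"
  proof
    assume "\<forall>j. f (2 * l - j) = f j"
    hence "f (2 * l - (l - j)) = f (l - j)" for j by blast
    thus "\<forall>j. f (l + j) = f (l - j)" by (simp add: algebra_simps)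
  next
    assume "\<forall>j. f (l + j) = f (l - j)"
    hence "f (l + (l - j)) = f (l - (l - j))" for j by blast
    thus "\<forall>j. f (2 * l - j) = f j" by (simp add: algebra_simps)
  qed
  thus ?thesis by (auto simp: dih_act_def fun_eq_iff)
qed

lemma sum_even_int:
  fixes F :: "int \<Rightarrow> nat"
  assumes "\<And>k. odd k \<Longrightarrow> F k = 0"
  shows "(\<Sum>k\<in>{0..<2 * int d}. F k) = (\<Sum>l\<in>{0..<int d}. F (2 * l))"
proof -
  have "(\<Sum>l\<in>{0..<int d}. F (2 * l)) = (\<Sum>k\<in>(*) 2 ` {0..<int d}. F k)"
    by (subst sum.reindex) (auto intro: inj_onI)
  also have "\<dots> = (\<Sum>k\<in>{0..<2 * int d}. F k)"
  proof (rule sum.mono_neutral_left)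
    show "\<forall>k\<in>{0..<2 * int d} - (*) 2 ` {0..<int d}. F k = 0"
    proof
      fix k assume k: "k \<in> {0..<2 * int d} - (*) 2 ` {0..<int d}"
      have "odd k"
      proof
        assume "even k"
        then obtain l where "k = 2 * l" by (elim evenE)
        thus False using k by auto
      qed
      thus "F k = 0" by (rule assms)
    qed
  qed auto
  finally show ?thesis ..
qed

text \<open>Burnside with \<open>4 * p\<close> indices. Only even ones have fixed words: the
  identity has \<open>2 ^ p\<close>, the other \<open>p - 1\<close> even translations have 2 each,
  and the \<open>p\<close> even reflections have \<open>2 ^ ((p + 1) div 2)\<close> each.\<close>

lemma card_periodics_orbits:
  assumes "prime p" "odd p"
  shows "card (periodics p // dih) * (4 * p) = 2 ^ p + 2 * (p - 1) + p * 2 ^ ((p + 1) div 2)"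
proof -
  have p0: "p > 0" using assms(1) prime_gt_0_nat by blast
  define G where "G = {0..<2 * int p} \<times> (UNIV :: bool set)"
  have "card (periodics p // dih) * card G = (\<Sum>h\<in>G. card {f\<in>periodics p. dih_act h f = f})"
  proof (rule burnside)
    show "finite G" by (simp add: G_def)
    show "dih `` {f} = (\<lambda>h. dih_act h f) ` G" if "f \<in> periodics p" for f
    proof
      show "dih `` {f} \<subseteq> (\<lambda>h. dih_act h f) ` G"
      proof
        fix g assume "g \<in> dih `` {f}"
        then obtain k s where "g = dih_act (k, s) f" by (auto simp: dih_iff)
        hence "g = dih_act (k mod (2 * int p), s) f" using dih_act_mod[OF that] by simp
        thus "g \<in> (\<lambda>h. dih_act h f) ` G" using p0 by (auto simp: G_def)
      qed
    qed (use dih_iff in blast)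
    show "inj_on (dih_act h) (periodics p)" for h
      by (cases h) (metis dih_act_inverse inj_on_def)
    show "\<exists>\<sigma>. bij_betw \<sigma> G G \<and> (\<forall>g\<in>G. \<forall>f\<in>periodics p. dih_act (\<sigma> g) f = dih_act h (dih_act g f))" if "h \<in> G" for h
    proof -
      obtain k s where h: "h = (k, s)" by (cases h)
      \<comment> \<open>Left multiplication as given by \<open>dih_act_comp\<close>, reduced to the
        representatives modulo \<open>2 * p\<close>.\<close>
      define \<sigma> where "\<sigma> = (\<lambda>(k', s'). ((if s' then k' - k else k' + k) mod (2 * int p), s \<noteq> s'))"
      have "inj_on \<sigma> G"
      proof (rule inj_onI)
        fix g g' assume g: "g \<in> G" "g' \<in> G" "\<sigma> g = \<sigma> g'"
        obtain a b a' b' where ab: "g = (a, b)" "g' = (a', b')" by (cases g, cases g')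
        have "b = b'" using g(3) by (auto simp: ab \<sigma>_def)
        moreover have "[a = a'] (mod 2 * int p)"
        proof (cases b)
          case True
          hence "[a - k = a' - k] (mod 2 * int p)" using g(3) \<open>b = b'\<close> by (auto simp: ab \<sigma>_def cong_def)
          thus ?thesis by (simp add: cong_iff_dvd_diff)
        next
          case False
          hence "[a + k = a' + k] (mod 2 * int p)" using g(3) \<open>b = b'\<close> by (auto simp: ab \<sigma>_def cong_def)
          thus ?thesis by (simp add: cong_iff_dvd_diff)
        qed
        ultimately show "g = g'" using g(1,2) by (auto simp: ab G_def cong_def)
      qed
      moreover have "\<sigma> ` G \<subseteq> G" using p0 by (auto simp: \<sigma>_def G_def)
      ultimately have "bij_betw \<sigma> G G"
        unfolding bij_betw_def by (simp add: endo_inj_surj G_def)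
      moreover have "dih_act (\<sigma> g) f = dih_act h (dih_act g f)" if "f \<in> periodics p" for f g
        using that by (cases g) (simp add: \<sigma>_def h dih_act_comp dih_act_mod)
      ultimately show ?thesis by blast
    qed
  qed (use p0 in \<open>auto intro: finite_periodics equiv_dih dih_act_periodics\<close>)
  also have "card G = 4 * p" by (simp add: G_def card_cartesian_product)
  also have "(\<Sum>h\<in>G. card {f\<in>periodics p. dih_act h f = f})
     = (\<Sum>k\<in>{0..<2 * int p}. card {f\<in>periodics p. dih_act (k, False) f = f})
     + (\<Sum>k\<in>{0..<2 * int p}. card {f\<in>periodics p. dih_act (k, True) f = f})"
    unfolding G_def sum.cartesian_product' by (simp add: UNIV_bool sum.distrib add.commute)
  also have "(\<Sum>k\<in>{0..<2 * int p}. card {f\<in>periodics p. dih_act (k, False) f = f})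
     = (\<Sum>l\<in>{0..<int p}. card {f\<in>periodics p. dih_act (2 * l, False) f = f})"
    by (rule sum_even_int) (simp add: fixed_odd[OF assms(2)])
  also have "\<dots> = card {f\<in>periodics p. dih_act (2 * 0, False) f = f}
     + (\<Sum>l\<in>{0<..<int p}. card {f\<in>periodics p. dih_act (2 * l, False) f = f})"
  proof -
    have "{0..<int p} = insert 0 {0<..<int p}" using p0 by auto
    thus ?thesis by simp
  qed
  also have "(\<Sum>l\<in>{0<..<int p}. card {f\<in>periodics p. dih_act (2 * l, False) f = f}) = (\<Sum>l\<in>{0<..<int p}. 2)"
    by (intro sum.cong refl fixed_translation[OF assms]) auto
  also have "card {f\<in>periodics p. dih_act (2 * 0, False) f = f} = 2 ^ p"
    by (simp add: dih_act_0 card_periodics[OF p0])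
  also have "(\<Sum>k\<in>{0..<2 * int p}. card {f\<in>periodics p. dih_act (k, True) f = f})
     = (\<Sum>l\<in>{0..<int p}. card {f\<in>periodics p. dih_act (2 * l, True) f = f})"
    by (rule sum_even_int) (simp add: fixed_odd[OF assms(2)])
  also have "\<dots> = (\<Sum>l\<in>{0..<int p}. 2 ^ ((p + 1) div 2))"
  proof -
    obtain m where m: "p = 2 * m + 1" using assms(2) by (elim oddE)
    hence "card {f \<in> periodics p. \<forall>j. f (l + j) = f (l - j)} = 2 ^ ((p + 1) div 2)" for l :: int
      using card_palindromes[of m l] by simp
    thus ?thesis unfolding fixed_reflection by simp
  qed
  finally show ?thesis using p0 by (simp add: nat_diff_distrib')
qed

text \<open>The two constant words are exchanged by the translation by 1 with its complement. They
  form a single class, the only one counted twice; this is the source of the summand 1.\<close>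

lemma card_two_periodics_orbits:
  assumes "coprime p q" "p > 0" "q > 0"
  shows "card ((periodics p \<union> periodics q) // dih) + 1 = card (periodics p // dih) + card (periodics q // dih)"
proof -
  have un: "(periodics p \<union> periodics q) // dih = periodics p // dih \<union> periodics q // dih"
    by (auto simp: quotient_def)
  have fin: "finite (periodics d // dih)" if "d > 0" for d
    using finite_periodics[OF that] by (simp add: quotient_def)
  have tf: "dih `` {\<lambda>_. False} = dih `` {\<lambda>_. True}"
  proof (rule equiv_class_eq[OF equiv_dih])
    show "(\<lambda>_. False, \<lambda>_. True) \<in> dih" unfolding dih_def by (auto intro!: exI[of _ 1])
  qed
  have "periodics p // dih \<inter> periodics q // dih = {dih `` {\<lambda>_. True}}"
  proof
    show "periodics p // dih \<inter> periodics q // dih \<subseteq> {dih `` {\<lambda>_. True}}"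
    proof
      fix C assume "C \<in> periodics p // dih \<inter> periodics q // dih"
      then obtain f g where fg: "f \<in> periodics p" "g \<in> periodics q" "C = dih `` {f}" "C = dih `` {g}"
        by (auto simp: quotient_def)
      hence "(g, f) \<in> dih" using equiv_dih by (metis eq_equiv_class UNIV_I)
      hence "f \<in> periodics p \<inter> periodics q" using fg dih_periodics by blast
      hence "f = (\<lambda>_. True) \<or> f = (\<lambda>_. False)" unfolding coprime_periodics_Int[OF assms(1)] by simp
      thus "C \<in> {dih `` {\<lambda>_. True}}" using fg(3) tf by auto
    qed
    have "(\<lambda>_. True) \<in> periodics d" for d by (simp add: periodics_def periodic_def)
    thus "{dih `` {\<lambda>_. True}} \<subseteq> periodics p // dih \<inter> periodics q // dih"
      by (auto simp: quotient_def)
  qed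
  thus ?thesis unfolding un using card_Un_Int[OF fin[OF assms(2)] fin[OF assms(3)]] by simp
qed

section \<open>The Reuleaux polygon of a walk\<close>

lemma angle_near:
  fixes \<theta> \<phi> :: real
  obtains k :: int where "\<phi> - pi \<le> \<theta> + 2 * pi * of_int k" "\<theta> + 2 * pi * of_int k \<le> \<phi> + pi"
proof
  define k where "k = - \<lfloor>(\<theta> - \<phi> + pi) / (2 * pi)\<rfloor>"
  have "of_int (- k) \<le> (\<theta> - \<phi> + pi) / (2 * pi)" "(\<theta> - \<phi> + pi) / (2 * pi) < of_int (- k) + 1"
    unfolding k_def by (auto intro: of_int_floor_le)
  thus "\<phi> - pi \<le> \<theta> + 2 * pi * of_int k" "\<theta> + 2 * pi * of_int k \<le> \<phi> + pi"
    by (auto simp: field_simps)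
qed

definition root_angle :: "nat \<Rightarrow> int \<Rightarrow> real" where
  "root_angle n j = of_int j * pi / real n"

lemma cis_root_angle_Suc_neq:
  assumes "n \<ge> 2"
  shows "cis (root_angle n (j + 1)) \<noteq> cis (root_angle n j)"
proof
  assume "cis (root_angle n (j + 1)) = cis (root_angle n j)"
  hence "cis (root_angle n (j + 1) - root_angle n j) = 1" by (simp add: cis_divide[symmetric])
  moreover have "root_angle n (j + 1) - root_angle n j = pi / n"
    by (simp add: root_angle_def add_divide_distrib distrib_right)
  ultimately have "sin (pi / n) = 0" by (simp add: complex_eq_iff)
  moreover have "sin (pi / n) > 0" using assms by (intro sin_gt_zero) (auto simp: field_simps)
  ultimately show False by simp
qed

text \<open>
  \<open>v j\<close> is the vertex that supports the polygon in the direction \<open>cis (root_angle n j)\<close>. A vertex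
  is repeated as long as the opposite vertex moves.
\<close>

definition reuleaux_walk :: "nat \<Rightarrow> (int \<Rightarrow> complex) \<Rightarrow> bool" where
  "reuleaux_walk n v \<longleftrightarrow>
     (\<forall>j. v j - v (j + int n) = cis (root_angle n j)) \<and>
     (\<forall>j. v (j + 1) = v j \<or> v (j + 1 + int n) = v (j + int n))"

locale walk =
  fixes n :: nat and v :: "int \<Rightarrow> complex"
  assumes n2: "n \<ge> 2" and walk: "reuleaux_walk n v"
begin

abbreviation "ang \<equiv> root_angle n"
abbreviation "ed j \<equiv> v (j + 1) \<noteq> v j"

lemma antipode: "v j - v (j + int n) = cis (ang j)"
  using walk by (simp add: reuleaux_walk_def)

lemma ang_add: "ang (j + int n) = ang j + pi"
  using n2 by (simp add: root_angle_def field_simps)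

lemma cis_ang_antipode: "cis (ang (j + int n)) = - cis (ang j)"
  by (simp add: ang_add complex_eq_iff)

lemma v_periodic: "v (j + 2 * int n) = v j"
  using antipode[of j] antipode[of "j + int n"] cis_ang_antipode[of j]
  by (simp add: algebra_simps)

lemma v_mult: "v (j + 2 * int n * k) = v j"
proof (induction k rule: int_induct[where k = 0])
  case (step1 i)
  thus ?case using v_periodic[of "j + 2 * int n * i"] by (simp add: algebra_simps)
next
  case (step2 i)
  thus ?case using v_periodic[of "j + 2 * int n * (i - 1)"] by (simp add: algebra_simps)
qed simp

lemma v_cong: "[i = j] (mod (2 * int n)) \<Longrightarrow> v i = v j"
  by (metis cong_iff_lin v_mult)

lemma ang_less: "i < j \<longleftrightarrow> ang i < ang j"
  using n2 by (simp add: root_angle_def divide_less_cancel)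

lemma ang_le: "i \<le> j \<longleftrightarrow> ang i \<le> ang j"
  using n2 by (simp add: root_angle_def divide_le_cancel)

lemma cis_ang_Suc_neq: "cis (ang (j + 1)) \<noteq> cis (ang j)"
  using n2 by (rule cis_root_angle_Suc_neq)

text \<open>The walk condition forbids both ends to move. If both rested, their difference would
  too, whereas \<open>cis (ang j)\<close> changes with \<open>j\<close>.\<close>

lemma ed_antipode: "v (j + int n + 1) \<noteq> v (j + int n) \<longleftrightarrow> v (j + 1) = v j"
proof -
  have "v (j + 1) = v j \<or> v (j + 1 + int n) = v (j + int n)"
    using walk by (simp add: reuleaux_walk_def)
  moreover have "\<not> (v (j + 1) = v j \<and> v (j + int n + 1) = v (j + int n))"
    using antipode[of j] antipode[of "j + 1"] cis_ang_Suc_neq[of j] by (auto simp: algebra_simps)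
  ultimately show ?thesis by (auto simp: algebra_simps)
qed

lemma step: "v (j + 1) - v j = (if ed j then cis (ang (j + 1)) - cis (ang j) else 0)"
  using ed_antipode[of j] antipode[of j] antipode[of "j + 1"] by (auto simp: algebra_simps)

section \<open>The support map of a walk\<close>

definition idx :: "real \<Rightarrow> int" where
  "idx \<theta> = \<lfloor>\<theta> * real n / pi\<rfloor>"

text \<open>The support point of the Reuleaux polygon: it moves on the arc centred at \<open>v (j + int n)\<close> while \<open>ed j\<close>.\<close>

definition x :: "real \<Rightarrow> complex" where
  "x \<theta> = v (idx \<theta>) + (if ed (idx \<theta>) then cis \<theta> - cis (ang (idx \<theta>)) else 0)"

lemma idx_iff: "idx \<theta> = j \<longleftrightarrow> ang j \<le> \<theta> \<and> \<theta> < ang (j + 1)"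
  using n2 by (simp add: idx_def root_angle_def floor_eq_iff field_simps)

lemma idx_bounds: "ang (idx \<theta>) \<le> \<theta>" "\<theta> < ang (idx \<theta> + 1)"
  using idx_iff[of \<theta> "idx \<theta>"] by auto

text \<open>At the right end \<open>idx\<close> has already jumped to \<open>j + 1\<close>, but the
  formula for the step yields the same point. So neighbouring pieces fit together.\<close>

lemma x_on_piece:
  assumes "ang j \<le> \<theta>" "\<theta> \<le> ang (j + 1)"
  shows "x \<theta> = v j + (if ed j then cis \<theta> - cis (ang j) else 0)"
proof (cases "\<theta> = ang (j + 1)")
  case True
  hence "idx \<theta> = j + 1" using ang_less[of "j + 1" "j + 1 + 1"] by (subst idx_iff) simp
  hence "x \<theta> = v (j + 1)" by (simp add: x_def True)
  thus ?thesis using step[of j] True by (auto simp: algebra_simps)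
next
  case False
  hence "idx \<theta> = j" using assms by (subst idx_iff) simp
  thus ?thesis by (simp add: x_def)
qed

lemma x_ang: "x (ang j) = v j"
  using x_on_piece[of j "ang j"] ang_le[of j "j + 1"] by simp

lemma cis_add_pi: "cis (\<theta> + pi) = - cis \<theta>"
  by (simp add: complex_eq_iff)

lemma x_antipode: "x \<theta> - x (\<theta> + pi) = cis \<theta>"
proof -
  define j where "j = idx \<theta>"
  have j: "ang j \<le> \<theta>" "\<theta> \<le> ang (j + 1)" using idx_bounds[of \<theta>] by (auto simp: j_def)
  have "x \<theta> = v j + (if ed j then cis \<theta> - cis (ang j) else 0)" using j by (rule x_on_piece)
  moreover have "x (\<theta> + pi) = v (j + int n) + (if ed (j + int n) then cis (\<theta> + pi) - cis (ang (j + int n)) else 0)"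
    using j ang_add[of j] ang_add[of "j + 1"] by (intro x_on_piece) (simp_all add: algebra_simps)
  ultimately show ?thesis using antipode[of j] ed_antipode[of j] cis_ang_antipode[of j]
    by (auto simp: cis_add_pi cis_add_pi[of \<theta>, unfolded add.commute[of \<theta>]] algebra_simps)
qed

lemma x_2pi: "x (\<theta> + 2 * pi) = x \<theta>"
  using x_antipode[of \<theta>] x_antipode[of "\<theta> + pi"] by (simp add: cis_add_pi cis_add_pi[of \<theta>, unfolded add.commute[of \<theta>]] algebra_simps)

text \<open>On one piece \<open>x\<close> rests or moves on a unit circle with the normal angle as
  parameter; in the latter case its height over \<open>\<phi>\<close> is a constant plus the cosine
  of the angle to \<open>\<phi>\<close>.\<close>

lemma walk_antimono_piece:
  assumes "\<phi> \<le> s" "s \<le> t" "t \<le> \<phi> + pi" "ang j \<le> s" "t \<le> ang (j + 1)"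
  shows "x t \<bullet> cis \<phi> \<le> x s \<bullet> cis \<phi>"
proof -
  have "cos (t - \<phi>) \<le> cos (s - \<phi>)" using assms by (intro cos_monotone_0_pi_le) auto
  hence "cis t \<bullet> cis \<phi> \<le> cis s \<bullet> cis \<phi>" by (simp add: inner_complex_def cos_diff)
  thus ?thesis using x_on_piece[of j s] x_on_piece[of j t] assms
    by (auto simp: inner_add_left inner_diff_left)
qed

lemma walk_antimono:
  assumes "\<phi> \<le> s" "s \<le> t" "t \<le> \<phi> + pi"
  shows "x t \<bullet> cis \<phi> \<le> x s \<bullet> cis \<phi>"
  using assms
proof (induction "nat (idx t - idx s)" arbitrary: s)
  case 0
  hence "idx t \<le> idx s" by simp
  hence "ang (idx t + 1) \<le> ang (idx s + 1)" using ang_le[of "idx t + 1" "idx s + 1"] by simp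
  hence "t \<le> ang (idx s + 1)" using idx_bounds(2)[of t] by simp
  thus ?case using 0 idx_bounds(1)[of s] by (intro walk_antimono_piece[of \<phi> s t "idx s"]) auto
next
  case (Suc d)
  define s' where "s' = ang (idx s + 1)"
  have i: "idx s' = idx s + 1" unfolding s'_def using ang_less[of "idx s + 1" "idx s + 1 + 1"] by (subst idx_iff) simp
  have "idx s + 1 \<le> idx t" using Suc.hyps(2) by simp
  hence "s' \<le> ang (idx t)" unfolding s'_def using ang_le[of "idx s + 1" "idx t"] by simp
  hence st: "s \<le> s'" "s' \<le> t" using idx_bounds(1)[of t] idx_bounds(2)[of s] by (auto simp: s'_def)
  have "x t \<bullet> cis \<phi> \<le> x s' \<bullet> cis \<phi>"
    by (rule Suc.hyps(1)) (use Suc i st in auto)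
  also have "\<dots> \<le> x s \<bullet> cis \<phi>"
    using st Suc.prems idx_bounds(1)[of s] by (intro walk_antimono_piece[of \<phi> s s' "idx s"]) (auto simp: s'_def)
  finally show ?case .
qed

lemma x_mult: "x (\<theta> + 2 * pi * of_int k) = x \<theta>"
proof (induction k rule: int_induct[where k = 0])
  case (step1 i)
  thus ?case using x_2pi[of "\<theta> + 2 * pi * of_int i"] by (simp add: algebra_simps)
next
  case (step2 i)
  thus ?case using x_2pi[of "\<theta> + 2 * pi * of_int (i - 1)"] by (simp add: algebra_simps)
qed simp

text \<open>Every angle has a representative within \<open>pi\<close> of \<open>\<phi>\<close>. To
  the right of \<open>\<phi>\<close> heights fall by \<open>walk_antimono\<close>; to the left the
  same lemma is applied from \<open>\<phi> - pi\<close>, whose direction is opposite.\<close>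

lemma x_support: "x \<theta> \<bullet> cis \<phi> \<le> x \<phi> \<bullet> cis \<phi>"
proof -
  obtain k :: int where k: "\<phi> - pi \<le> \<theta> + 2 * pi * of_int k" "\<theta> + 2 * pi * of_int k \<le> \<phi> + pi"
    by (rule angle_near)
  define t where "t = \<theta> + 2 * pi * of_int k"
  have "x t \<bullet> cis \<phi> \<le> x \<phi> \<bullet> cis \<phi>"
  proof (cases "\<phi> \<le> t")
    case True
    thus ?thesis using k by (intro walk_antimono) (auto simp: t_def)
  next
    case False
    have "x \<phi> \<bullet> cis (\<phi> - pi) \<le> x t \<bullet> cis (\<phi> - pi)" using k False by (intro walk_antimono) (auto simp: t_def)
    moreover have "cis (\<phi> - pi) = - cis \<phi>" by (simp add: complex_eq_iff)
    ultimately show ?thesis by simp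
  qed
  thus ?thesis by (simp add: t_def x_mult)
qed

text \<open>As an intersection of half-planes it is closed and convex, and \<open>x_support\<close>
  places the values of \<open>x\<close> in it.\<close>

definition R :: "complex set" where
  "R = {y. \<forall>\<phi>. y \<bullet> cis \<phi> \<le> x \<phi> \<bullet> cis \<phi>}"

sublocale cw_body R 1 x
proof
  show "(x \<phi> - x (\<phi> + pi)) \<bullet> cis \<phi> = 1" for \<phi> by (simp add: x_antipode)
qed (auto simp: R_def x_support)

lemma convex_R: "convex R"
proof -
  have "R = (\<Inter>\<phi>. {y. cis \<phi> \<bullet> y \<le> x \<phi> \<bullet> cis \<phi>})" by (auto simp: R_def inner_commute)
  thus ?thesis by (auto intro!: convex_Inter convex_halfspace_le)
qed

lemma compact_R: "compact R"
  unfolding compact_eq_bounded_closed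
proof
  have "R = (\<Inter>\<phi>. {y. cis \<phi> \<bullet> y \<le> x \<phi> \<bullet> cis \<phi>})" by (auto simp: R_def inner_commute)
  thus "closed R" by (auto intro!: closed_Inter closed_halfspace_le)
  have "R \<subseteq> cball (x 0) 1" using norm_diff_le[OF x_in[of 0]] by (auto simp: dist_norm)
  thus "bounded R" using bounded_cball bounded_subset by blast
qed

lemma unit_cis: "norm (u :: complex) = 1 \<Longrightarrow> \<exists>\<phi>. u = cis \<phi>"
  using rcis_cmod_Arg[of u] by (auto simp: rcis_def intro!: exI[of _ "Arg u"])

lemma constant_width_R: "constant_width R 1"
  unfolding constant_width_def
proof (intro allI impI)
  fix u :: complex assume "norm u = 1"
  then obtain \<phi> where u: "u = cis \<phi>" using unit_cis by blast
  have "(SUP y\<in>R. y \<bullet> u) = x \<phi> \<bullet> u" unfolding u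
    by (intro cSup_eq_maximum) (auto intro: x_in x_max)
  moreover have "(INF y\<in>R. y \<bullet> u) = x (\<phi> + pi) \<bullet> u" unfolding u
    by (intro cInf_eq_minimum) (auto intro: x_in x_min)
  ultimately show "(SUP y\<in>R. y \<bullet> u) - (INF y\<in>R. y \<bullet> u) = 1"
    using x_width[of \<phi>] by (simp add: u inner_diff_left)
qed

lemma v_in: "v j \<in> R" using x_in[of "ang j"] by (simp add: x_ang)

lemma diameter_eq_1:
  assumes "S \<subseteq> R" "range v \<subseteq> S"
  shows "diameter S = 1"
proof (rule antisym)
  have "S \<noteq> {}" using assms(2) by auto
  thus "diameter S \<le> 1"
    using norm_diff_le assms(1) by (intro diameter_le) (auto simp: dist_norm)
  have "bounded S" using assms(1) compact_R bounded_subset compact_imp_bounded by blast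
  hence "dist (v 0) (v (0 + int n)) \<le> diameter S" using assms(2) by (intro diameter_bounded_bound) auto
  thus "1 \<le> diameter S" using antipode[of 0] by (simp add: dist_norm)
qed

section \<open>The polygon inscribed in the body of a walk\<close>

definition P :: "complex set" where "P = convex hull (range v)"

lemma range_v: "range v = v ` {0..<2 * int n}"
proof
  show "range v \<subseteq> v ` {0..<2 * int n}"
  proof
    fix y assume "y \<in> range v"
    then obtain j where "y = v j" by blast
    hence "y = v (j mod (2 * int n))" using v_cong[of j "j mod (2 * int n)"] by (simp add: cong_def)
    thus "y \<in> v ` {0..<2 * int n}" using n2 by auto
  qed
qed auto

lemma finite_range_v: "finite (range v)" unfolding range_v by simp

lemma P_subset_R: "P \<subseteq> R"
  unfolding P_def using v_in convex_R by (intro hull_minimal) auto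

lemma v_in_P: "v j \<in> P" unfolding P_def by (rule hull_inc) auto

lemma diameter_P: "diameter P = 1"
  by (rule diameter_eq_1[OF P_subset_R]) (auto simp: v_in_P)

lemma x_extreme: "x \<phi> extreme_point_of R"
proof -
  have "(R \<inter> {y. cis \<phi> \<bullet> y = x \<phi> \<bullet> cis \<phi>}) face_of R"
    using convex_R x_max by (intro face_of_Int_supporting_hyperplane_le) (auto simp: inner_commute)
  moreover have "R \<inter> {y. cis \<phi> \<bullet> y = x \<phi> \<bullet> cis \<phi>} = {x \<phi>}"
    using x_unique[of _ \<phi>] x_in by (auto simp: inner_commute)
  ultimately show ?thesis by (simp add: face_of_singleton)
qed

lemma extreme_points_P: "polygon_vertices P = range v"
proof
  show "polygon_vertices P \<subseteq> range v"
    unfolding polygon_vertices_def P_def using extreme_point_of_convex_hull by blast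
  show "range v \<subseteq> polygon_vertices P"
  proof
    fix y assume "y \<in> range v"
    then obtain j where "y = x (ang j)" by (auto simp: x_ang)
    hence "y extreme_point_of R" using x_extreme by simp
    moreover have "y \<in> P" using \<open>y \<in> range v\<close> v_in_P by auto
    ultimately show "y \<in> polygon_vertices P"
      unfolding polygon_vertices_def using P_subset_R by (auto simp: extreme_point_of_def)
  qed
qed

text \<open>A support point that recurs within less than half a turn is constant in between.\<close>

lemma v_eq_between:
  assumes "i < j" "j < i + int n" "v i = v j"
  shows "\<not> ed i"
proof -
  have "x (ang (i + 1)) = x (ang i)"
  proof (rule x_const_between[of _ _ "ang j"])
    show "ang j < ang i + pi" using ang_less[of j "i + int n"] assms by (simp add: ang_add)
  qed (use assms ang_le[of i "i + 1"] ang_le[of "i + 1" j] in \<open>auto simp: x_ang\<close>)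
  thus ?thesis by (simp add: x_ang)
qed

lemma inj_on_ed: "inj_on v {j \<in> {0..<2 * int n}. ed j}"
proof (rule linorder_inj_onI')
  fix i j assume ij: "i \<in> {j \<in> {0..<2 * int n}. ed j}" "j \<in> {j \<in> {0..<2 * int n}. ed j}" "i < j"
  show "v i \<noteq> v j"
  proof
    assume eq: "v i = v j"
    consider "j < i + int n" | "j = i + int n" | "j > i + int n" by linarith
    thus False
    proof cases
      case 1
      thus False using v_eq_between[of i j] ij eq by auto
    next
      case 2
      thus False using antipode[of i] eq by simp
    next
      case 3
      \<comment> \<open>Beyond half a turn the comparison goes the other way round, from
        \<open>j\<close> to the next copy of \<open>i\<close>.\<close>
      hence "\<not> ed j" using ij eq v_periodic[of i] by (intro v_eq_between[of j "i + 2 * int n"]) auto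
      thus False using ij by simp
    qed
  qed
qed

text \<open>A vertex cannot rest for more than \<open>n\<close> steps, since its antipode moves
  while it rests. Together with \<open>inj_on_ed\<close> each vertex has exactly one moving index
  per turn.\<close>

lemma next_ed: "\<exists>k. j \<le> k \<and> k \<le> j + int n \<and> ed k \<and> v k = v j"
proof -
  have ex: "\<exists>d::nat. ed (j + int d) \<and> d \<le> n"
  proof (cases "ed j")
    case True
    thus ?thesis by (intro exI[of _ 0]) simp
  next
    case False
    hence "ed (j + int n)" using ed_antipode[of j] by simp
    thus ?thesis by blast
  qed
  define d where "d = (LEAST d. ed (j + int d))"
  have d: "ed (j + int d)" unfolding d_def using ex LeastI by (metis (mono_tags, lifting))
  have less: "\<not> ed (j + int e)" if "e < d" for e using that not_less_Least unfolding d_def by blast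
  have dn: "d \<le> n" using ex less by (meson le_trans linorder_not_le)
  have "v (j + int e) = v j" if "e \<le> d" for e
    using that
  proof (induction e)
    case (Suc e)
    thus ?case using less[of e] by (simp add: algebra_simps)
  qed simp
  thus ?thesis using d dn by (intro exI[of _ "j + int d"]) auto
qed

text \<open>Vertices correspond to the moving indices of one turn, and of each pair
  \<open>j\<close>, \<open>j + n\<close> exactly one is moving.\<close>

lemma card_range_v: "card (range v) = n"
proof -
  have fin: "finite {j. 0 \<le> j \<and> j < int n \<and> Q j}" for Q
    by (rule finite_subset[of _ "{0..<int n}"]) auto
  have "range v = v ` {j \<in> {0..<2 * int n}. ed j}"
  proof
    show "range v \<subseteq> v ` {j \<in> {0..<2 * int n}. ed j}"
    proof
      fix y assume "y \<in> range v"
      then obtain k where k: "ed k" "y = v k" using next_ed by (metis imageE)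
      define l where "l = k mod (2 * int n)"
      have "v l = v k" "v (l + 1) = v (k + 1)"
        by (rule v_cong; simp add: l_def cong_def mod_simps)+
      thus "y \<in> v ` {j \<in> {0..<2 * int n}. ed j}" using k n2 by (intro image_eqI[of _ _ l]) (auto simp: l_def)
    qed
  qed auto
  hence "card (range v) = card {j \<in> {0..<2 * int n}. ed j}" using inj_on_ed by (simp add: card_image)
  also have "{j \<in> {0..<2 * int n}. ed j} = {j \<in> {0..<int n}. ed j} \<union> (\<lambda>j. j + int n) ` {j \<in> {0..<int n}. \<not> ed j}"
  proof (intro equalityI subsetI)
    fix j assume j: "j \<in> {j \<in> {0..<2 * int n}. ed j}"
    show "j \<in> {j \<in> {0..<int n}. ed j} \<union> (\<lambda>j. j + int n) ` {j \<in> {0..<int n}. \<not> ed j}"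
    proof (cases "j < int n")
      case True
      thus ?thesis using j by simp
    next
      case False
      hence "j - int n \<in> {j \<in> {0..<int n}. \<not> ed j}" using j ed_antipode[of "j - int n"] by auto
      hence "(\<lambda>j. j + int n) (j - int n) \<in> (\<lambda>j. j + int n) ` {j \<in> {0..<int n}. \<not> ed j}" by (rule imageI)
      thus ?thesis by (simp only: diff_add_cancel Un_iff simp_thms)
    qed
  next
    fix j assume "j \<in> {j \<in> {0..<int n}. ed j} \<union> (\<lambda>j. j + int n) ` {j \<in> {0..<int n}. \<not> ed j}"
    then consider "j \<in> {j \<in> {0..<int n}. ed j}" | i where "i \<in> {0..<int n}" "\<not> ed i" "j = i + int n" by blast
    thus "j \<in> {j \<in> {0..<2 * int n}. ed j}"
    proof cases
      case 2
      thus ?thesis using ed_antipode[of i] by simp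
    qed simp
  qed
  also have "card ({j \<in> {0..<int n}. ed j} \<union> (\<lambda>j. j + int n) ` {j \<in> {0..<int n}. \<not> ed j})
      = card {j \<in> {0..<int n}. ed j} + card {j \<in> {0..<int n}. \<not> ed j}"
    using fin by (subst card_Un_disjoint) (auto simp: card_image inj_on_def)
  also have "\<dots> = card ({j \<in> {0..<int n}. ed j} \<union> {j \<in> {0..<int n}. \<not> ed j})"
    using fin by (intro card_Un_disjoint[symmetric]) auto
  also have "{j \<in> {0..<int n}. ed j} \<union> {j \<in> {0..<int n}. \<not> ed j} = {0..<int n}" by auto
  finally show ?thesis by simp
qed

end

section \<open>Edges of the inscribed polygon\<close>

lemma diameter_convex_hull_pair:
  fixes a b :: "'a::euclidean_space"
  shows "diameter (convex hull {a, b}) = dist a b"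
proof (rule antisym)
  show "diameter (convex hull {a, b}) \<le> dist a b"
  proof (rule diameter_le)
    fix y z assume "y \<in> convex hull {a, b}" "z \<in> convex hull {a, b}"
    moreover obtain u v where "u \<in> {a, b}" "v \<in> {a, b}"
      "\<forall>y\<in>convex hull {a, b}. \<forall>z\<in>convex hull {a, b}. norm (y - z) \<le> norm (u - v)"
      using simplex_extremal_le[of "{a, b}"] by blast
    ultimately show "norm (y - z) \<le> dist a b"
      by (fastforce simp: dist_norm norm_minus_commute)
  qed simp
  show "dist a b \<le> diameter (convex hull {a, b})"
    by (intro diameter_bounded_bound bounded_convex_hull) (auto intro: hull_inc)
qed

lemma face_of_convex_hull_supporting:
  fixes W :: "'a::euclidean_space set"
  assumes "finite W" "\<And>z. z \<in> W \<Longrightarrow> u \<bullet> z \<le> \<beta>"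
  shows "(convex hull W \<inter> {y. u \<bullet> y = \<beta>}) face_of convex hull W"
    and "convex hull W \<inter> {y. u \<bullet> y = \<beta>} = convex hull {z \<in> W. u \<bullet> z = \<beta>}"
proof -
  have "convex hull W \<subseteq> {y. u \<bullet> y \<le> \<beta>}"
    using assms(2) by (intro hull_minimal convex_halfspace_le) auto
  thus face: "(convex hull W \<inter> {y. u \<bullet> y = \<beta>}) face_of convex hull W"
    by (intro face_of_Int_supporting_hyperplane_le) auto
  obtain S where S: "S \<subseteq> W" "convex hull W \<inter> {y. u \<bullet> y = \<beta>} = convex hull S"
    using face_of_convex_hull_subset[OF finite_imp_compact[OF assms(1)] face] .
  have "S \<subseteq> {z \<in> W. u \<bullet> z = \<beta>}"
    using S hull_subset[of S convex] by auto
  moreover have "convex hull {z \<in> W. u \<bullet> z = \<beta>} \<subseteq> convex hull W \<inter> {y. u \<bullet> y = \<beta>}"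
    by (intro hull_minimal convex_Int convex_hyperplane) (auto intro: hull_inc)
  ultimately show "convex hull W \<inter> {y. u \<bullet> y = \<beta>} = convex hull {z \<in> W. u \<bullet> z = \<beta>}"
    using hull_mono[of S "{z \<in> W. u \<bullet> z = \<beta>}" convex] S(2) by auto
qed

lemma cis_eqD:
  assumes "cis a = cis b"
  obtains k :: int where "a = b + 2 * pi * of_int k"
proof -
  have "cis (a - b) = 1" using assms by (simp add: cis_divide[symmetric])
  hence "cos (a - b) = 1" by (simp add: complex_eq_iff)
  then obtain k :: int where "a - b = of_int k * 2 * pi" using cos_one_2pi_int[of "a - b"] by auto
  thus ?thesis using that[of k] by (simp add: algebra_simps)
qed

lemma cis_inj_near:
  assumes "cis a = cis b" "\<bar>a - b\<bar> < 2 * pi"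
  shows "a = b"
proof -
  obtain k :: int where k: "a = b + 2 * pi * of_int k" using assms(1) by (rule cis_eqD)
  hence "2 * pi * \<bar>of_int k\<bar> < 2 * pi * 1" using assms(2) by (simp add: abs_mult)
  hence "\<bar>of_int k\<bar> < (1::real)" by (subst (asm) mult_less_cancel_left_pos) auto
  hence "k = 0" by linarith
  thus ?thesis using k by simp
qed

context walk
begin

text \<open>A normal of a line containing \<open>P\<close> would be orthogonal to all diameters,
  among them those in the independent directions \<open>cis (ang 0)\<close> and
  \<open>cis (ang 1)\<close>.\<close>

lemma aff_dim_P: "aff_dim P = 2"
proof (rule ccontr)
  assume "aff_dim P \<noteq> 2"
  moreover have "aff_dim P \<le> 2" using aff_dim_le_DIM[of P] by simp
  ultimately have "aff_dim P < DIM(complex)" by simp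
  then obtain a b where a: "a \<noteq> 0" "P \<subseteq> {y. a \<bullet> y = b}" by (rule aff_lowdim_subset_hyperplane)
  have "a \<bullet> cis (ang j) = 0" for j
    using a(2) v_in_P[of j] v_in_P[of "j + int n"] by (auto simp flip: antipode simp: inner_diff_right)
  from this[of 0] this[of 1] have *: "Re a = 0" "Im a * sin (pi / n) = 0"
    by (auto simp: root_angle_def inner_complex_def)
  have "sin (pi / n) > 0" using n2 by (intro sin_gt_zero) (auto simp: field_simps)
  thus False using * a(1) by (auto simp: complex_eq_iff)
qed

lemma convex_polygon_P: "convex_polygon n P"
  unfolding convex_polygon_def extreme_points_P card_range_v
  using aff_dim_P finite_range_v by (simp add: P_def polytope_convex_hull)

lemma supporting_vertices:
  assumes max: "\<And>k. v k \<bullet> cis \<phi> \<le> v i \<bullet> cis \<phi>"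
  shows "v i = v (idx \<phi>) \<or> v i = v (idx \<phi> + 1)"
proof -
  define j where "j = idx \<phi>"
  have j: "ang j \<le> \<phi>" "\<phi> < ang (j + 1)" using idx_bounds[of \<phi>] by (auto simp: j_def)
  \<comment> \<open>The representative of \<open>i\<close> modulo \<open>2 * n\<close> whose angle
    lies within half a turn of \<open>\<phi>\<close>.\<close>
  define i' where "i' = j - int n + 1 + (i - (j - int n + 1)) mod (2 * int n)"
  have "[i' = i] (mod (2 * int n))" unfolding i'_def by (simp add: cong_def mod_simps)
  hence vi: "v i' = v i" by (rule v_cong)
  have i': "j - int n + 1 \<le> i'" "i' \<le> j + int n"
    using n2 pos_mod_sign[of "2 * int n" "i - (j - int n + 1)"] pos_mod_bound[of "2 * int n" "i - (j - int n + 1)"]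
    unfolding i'_def by linarith+
  show ?thesis
  proof (cases "j + 1 \<le> i'")
    case True
    have "ang i' \<le> \<phi> + pi" using i'(2) ang_le[of i' "j + int n"] ang_add[of j] j by simp
    moreover have "ang (j + 1) \<le> ang i'" using True ang_le by blast
    moreover have "ang (j + 1) < \<phi> + pi" using ang_less[of "j + 1" "j + int n"] ang_add[of j] j n2 by simp
    moreover have "x (ang i') \<bullet> cis \<phi> = x (ang (j + 1)) \<bullet> cis \<phi>"
      using calculation x_antimono[of \<phi> "ang (j + 1)" "ang i'"] j max[of "j + 1"] by (simp add: x_ang vi)
    ultimately have "x (ang i') = x (ang (j + 1))" using j by (intro x_antimono_strict) auto
    thus ?thesis by (simp add: x_ang vi j_def)
  next
    case False
    hence le: "ang i' \<le> ang j" using ang_le[of i' j] by simp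
    have lo: "\<phi> - pi < ang i'"
      using i'(1) ang_le[of "j - int n + 1" i'] ang_add[of "j - int n + 1"] j by (simp add: algebra_simps)
    have "x (ang i') = x (ang j)"
    proof (cases "ang j = \<phi>")
      case True
      have "x (ang i') = x \<phi>"
        using max[of j] x_max[OF x_in[of "ang i'"], of \<phi>] by (intro x_unique x_in) (simp add: x_ang vi flip: True)
      thus ?thesis by (simp add: True)
    next
      case False
      have "x (ang i') \<bullet> cis \<phi> = x (ang j) \<bullet> cis \<phi>"
        using x_mono_left[of \<phi> "ang i'" "ang j"] lo le j max[of j] by (simp add: x_ang vi)
      thus ?thesis using False lo le j by (intro x_mono_left_strict[of \<phi>]) auto
    qed
    thus ?thesis by (simp add: x_ang vi j_def)
  qed
qed

lemma dist_step: "ed j \<Longrightarrow> dist (v j) (v (j + 1)) = norm (cis (pi / n) - 1)"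
proof -
  assume "ed j"
  hence "dist (v j) (v (j + 1)) = norm (cis (ang (j + 1)) - cis (ang j))"
    using step[of j] by (simp add: dist_norm norm_minus_commute[of "v j"])
  also have "ang (j + 1) = ang j + pi / n" by (simp add: root_angle_def add_divide_distrib distrib_right)
  also have "cis (ang j + pi / n) - cis (ang j) = cis (ang j) * (cis (pi / n) - 1)"
    by (simp add: cis_mult[symmetric] right_diff_distrib)
  finally show ?thesis by (simp add: norm_mult)
qed

text \<open>An edge is exposed by some direction \<open>cis \<phi>\<close>, hence spanned by the
  vertices at the two ends of the piece containing \<open>\<phi>\<close>. They are distinct, so
  their distance is the chord of the angle \<open>pi / n\<close>.\<close>

lemma equilateral_P: "equilateral P"
  unfolding equilateral_def
proof (intro exI allI impI)
  fix e assume e: "e edge_of P"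
  have polyP: "polyhedron P" using finite_range_v by (simp add: P_def polyhedron_convex_hull)
  have "e exposed_face_of P" using e exposed_face_of_polyhedron[OF polyP] by (simp add: edge_of_def)
  moreover have "e \<noteq> {}" "e \<noteq> P" using e aff_dim_P by (auto simp: edge_of_def)
  ultimately obtain a b where a: "a \<noteq> 0" "P \<subseteq> {y. a \<bullet> y \<le> b}" "e = P \<inter> {y. a \<bullet> y = b}"
    unfolding exposed_face_of by blast
  obtain \<phi> where "a / of_real (norm a) = cis \<phi>" using a(1) unit_cis[of "a / of_real (norm a)"] by (auto simp: norm_divide)
  hence \<phi>: "a = norm a *\<^sub>R cis \<phi>" using a(1) by (simp add: field_simps scaleR_conv_of_real)
  define A where "A = {z \<in> range v. a \<bullet> z = b}"
  have eA: "e = convex hull A" unfolding a(3) A_def P_def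
    using a(2) v_in_P by (intro face_of_convex_hull_supporting(2) finite_range_v) auto
  have "A \<subseteq> {v (idx \<phi>), v (idx \<phi> + 1)}"
  proof
    fix z assume "z \<in> A"
    then obtain i where i: "z = v i" "a \<bullet> v i = b" by (auto simp: A_def)
    have "v k \<bullet> cis \<phi> \<le> v i \<bullet> cis \<phi>" for k
    proof -
      have "a \<bullet> v k \<le> a \<bullet> v i" using a(2) v_in_P[of k] i(2) by auto
      hence "norm a * (cis \<phi> \<bullet> v k) \<le> norm a * (cis \<phi> \<bullet> v i)"
        by (subst (asm) (1 2) \<phi>) simp
      thus ?thesis using a(1) by (simp add: inner_commute)
    qed
    from supporting_vertices[OF this] show "z \<in> {v (idx \<phi>), v (idx \<phi> + 1)}" using i by simp
  qed
  moreover have "A \<noteq> {}" "A \<noteq> {z}" for z using e unfolding edge_of_def eA by auto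
  ultimately have A: "A = {v (idx \<phi>), v (idx \<phi> + 1)}" "ed (idx \<phi>)" by blast+
  show "diameter e = norm (cis (pi / n) - 1)"
    unfolding eA A(1) diameter_convex_hull_pair by (rule dist_step) (rule A(2))
qed

section \<open>Arcs as maximal runs of moving steps\<close>

text \<open>During a run of moving steps the opposite vertex rests, so the pieces have a common
  centre and merge into one arc.\<close>

lemma x_on_run:
  assumes run: "\<And>k. s \<le> k \<Longrightarrow> k < e \<Longrightarrow> ed k" and "s < e" and \<theta>: "ang s \<le> \<theta>" "\<theta> \<le> ang e"
  shows "x \<theta> = v (s + int n) + cis \<theta>"
proof -
  have const: "v (k + int n) = v (s + int n)" if "s \<le> k" "k \<le> e" for k
    using that
  proof (induction k rule: int_ge_induct)
    case (step k)
    hence "v (k + 1 + int n) = v (k + int n)" using run[of k] ed_antipode[of k] by (simp add: algebra_simps)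
    thus ?case using step by simp
  qed simp
  define j where "j = min (idx \<theta>) (e - 1)"
  have "s \<le> idx \<theta>" using \<theta>(1) idx_bounds(2)[of \<theta>] ang_less[of s "idx \<theta> + 1"] by simp
  hence j: "s \<le> j" "j < e" using assms(2) by (auto simp: j_def)
  have "ang j \<le> \<theta>" using idx_bounds(1)[of \<theta>] ang_le[of j "idx \<theta>"] by (simp add: j_def)
  moreover have "\<theta> \<le> ang (j + 1)" using idx_bounds(2)[of \<theta>] \<theta>(2) by (simp add: j_def min_def)
  ultimately have "x \<theta> = v j + (if ed j then cis \<theta> - cis (ang j) else 0)" by (rule x_on_piece)
  also have "\<dots> = v (j + int n) + cis \<theta>" using run[OF j] antipode[of j] by (simp add: algebra_simps)
  finally show ?thesis using const[of j] j by simp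
qed

definition run_start :: "int \<Rightarrow> bool" where
  "run_start j \<longleftrightarrow> ed j \<and> v j = v (j - 1)"

lemma run_start_add_2n: "run_start (j + 2 * int n * k) \<longleftrightarrow> run_start j"
  using v_mult[of j k] v_mult[of "j + 1" k] v_mult[of "j - 1" k] by (simp add: run_start_def algebra_simps)

lemma run_start_between:
  assumes "\<not> ed i" "i \<le> k" "ed k"
  obtains j where "i < j" "j \<le> k" "run_start j"
proof -
  define d where "d = (LEAST d::nat. ed (i + int d))"
  have ex: "ed (i + int (nat (k - i)))" using assms by simp
  have d: "ed (i + int d)" unfolding d_def by (rule LeastI) (rule ex)
  have dle: "d \<le> nat (k - i)" unfolding d_def by (rule Least_le) (rule ex)
  have d0: "d > 0" using d assms(1) by (cases d) auto
  have "d - 1 < d" using d0 by simp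
  hence "\<not> ed (i + int (d - 1))" using not_less_Least[of "d - 1" "\<lambda>d. ed (i + int d)"] unfolding d_def by blast
  moreover have "int (d - 1) = int d - 1" using d0 by simp
  ultimately have "run_start (i + int d)" using d unfolding run_start_def by (simp add: add_diff_eq)
  thus ?thesis using that[of "i + int d"] d0 dle assms(2) by simp
qed

lemma ex_run_start: "\<exists>j. run_start j"
proof -
  obtain k where k: "ed k" using next_ed by blast
  have "\<not> ed (k - int n)" using k ed_antipode[of "k - int n"] by simp
  from run_start_between[OF this _ k] show ?thesis by auto
qed

definition run_end :: "int \<Rightarrow> int" where
  "run_end j = j + int (LEAST d. \<not> ed (j + int d))"

lemma run_end:
  assumes "ed j"
  shows "j < run_end j" "run_end j \<le> j + int n" "\<not> ed (run_end j)" "\<And>k. j \<le> k \<Longrightarrow> k < run_end j \<Longrightarrow> ed k"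
proof -
  define d where "d = (LEAST d. \<not> ed (j + int d))"
  have ex: "\<not> ed (j + int n)" using assms ed_antipode[of j] by simp
  show end_not: "\<not> ed (run_end j)" unfolding run_end_def by (rule LeastI) (rule ex)
  have "d \<le> n" unfolding d_def by (rule Least_le) (rule ex)
  thus "run_end j \<le> j + int n" by (simp add: run_end_def d_def)
  have "run_end j \<noteq> j" using end_not assms by auto
  thus "j < run_end j" by (simp add: run_end_def)
  show "ed k" if "j \<le> k" "k < run_end j" for k
  proof -
    have "nat (k - j) < d" using that by (simp add: run_end_def d_def)
    from not_less_Least[OF this[unfolded d_def]] show ?thesis using that by simp
  qed
qed

lemma reuleaux_polygon_R: "\<exists>V. reuleaux_polygon R V \<and> V \<subseteq> range v"
proof -
  obtain j0 where j0: "run_start j0" using ex_run_start by blast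
  define D where "D = {d::nat. run_start (j0 + int d)}"
  have "2 * n * k \<in> D" for k using j0 run_start_add_2n[of j0 "int k"] by (simp add: D_def)
  moreover have "inj (\<lambda>k. 2 * n * k)" using n2 by (auto simp: inj_on_def)
  ultimately have infD: "infinite D"
    by (meson finite_subset image_subsetI infinite_UNIV_nat range_inj_infinite)
  define s where "s i = j0 + int (enumerate D i)" for i
  define e where "e i = run_end (s i)" for i
  have "0 \<in> D" using j0 by (simp add: D_def)
  hence s0: "s 0 = j0" by (simp add: s_def enumerate_0)
  \<comment> \<open>By periodicity \<open>j0 + 2 * n\<close> starts a run again, so
    \<open>s 0\<close>, ..., \<open>s (m - 1)\<close> are the run starts of exactly one
    turn.\<close>
  obtain m where m: "enumerate D m = 2 * n" using enumerate_Ex[OF infD, of "2 * n"] \<open>2 * n * _ \<in> D\<close>[of 1] by auto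
  have sm: "s m = j0 + 2 * int n" by (simp add: s_def m)
  have start: "run_start (s i)" for i using enumerate_in_set[OF infD, of i] by (simp add: s_def D_def)
  have s_mono: "i < k \<Longrightarrow> s i < s k" for i k using enumerate_mono[OF _ infD, of i k] by (simp add: s_def)
  have s_mono_le: "i \<le> k \<Longrightarrow> s i \<le> s k" for i k using s_mono[of i k] by (cases "i = k") auto
  have s_next: "s (Suc i) \<le> k" if "run_start k" "s i < k" for i k
  proof -
    have "nat (k - j0) \<in> D" "enumerate D i < nat (k - j0)" using that by (auto simp: D_def s_def)
    hence "enumerate D (Suc i) \<le> nat (k - j0)" unfolding enumerate_Suc''[OF infD] by (intro Least_le) auto
    thus ?thesis using that by (simp add: s_def)
  qed
  have eds: "ed (s i)" for i using start[of i] unfolding run_start_def by blast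
  note re = run_end[OF eds, folded e_def]
  have gap: "\<not> ed k" if k: "e i \<le> k" "k < s (Suc i)" for i k
  proof
    assume "ed k"
    then obtain j where "e i < j" "j \<le> k" "run_start j" using run_start_between[OF re(3) k(1)] by blast
    thus False using s_next[of j i] re(1)[of i] k(2) by simp
  qed
  have es: "e i < s (Suc i)" for i
  proof (rule ccontr)
    assume "\<not> e i < s (Suc i)"
    hence "ed (s (Suc i) - 1)" using s_mono[of i "Suc i"] by (intro re(4)[of i]) auto
    thus False using start[of "Suc i"] by (simp add: run_start_def)
  qed
  have v_es: "v (e i) = v (s (Suc i))" for i
  proof -
    have "v k = v (e i)" if "e i \<le> k" "k \<le> s (Suc i)" for k
      using that
    proof (induction k rule: int_ge_induct)
      case (step k)
      thus ?case using gap[of i k] by simp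
    qed simp
    from this[of "s (Suc i)"] es[of i] show ?thesis by simp
  qed
  \<comment> \<open>At \<open>e i\<close> the walk rests, so its antipode \<open>e i + n\<close>
    moves. A rest thus spans at most half a turn.\<close>
  have es_n: "s (Suc i) \<le> e i + int n" for i
  proof (rule ccontr)
    assume "\<not> s (Suc i) \<le> e i + int n"
    hence "\<not> ed (e i + int n)" using gap[of i "e i + int n"] by simp
    thus False using re(3)[of i] ed_antipode[of "e i"] by blast
  qed
  define c where "c i = v (s i + int n)" for i
  have arc: "x \<theta> = c i + cis \<theta>" if "ang (s i) \<le> \<theta>" "\<theta> \<le> ang (e i)" for i \<theta>
    unfolding c_def using re[of i] that by (intro x_on_run[of "s i" "e i"]) auto
  have ang_se: "ang (s i) < ang (e i)" for i using re(1)[of i] ang_less by blast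
  have ang_es: "ang (e i) < ang (s (Suc i))" for i using es[of i] ang_less by blast
  define \<gamma> where "\<gamma> i = part_circlepath (c i) 1 (ang (s i)) (ang (e i))" for i
  have image: "path_image (\<gamma> i) = x ` {ang (s i)..ang (e i)}" for i
    using arc[of i] ang_se[of i] by (auto simp: \<gamma>_def path_image_part_circlepath' closed_segment_eq_real_ivl)
  have startp: "pathstart (\<gamma> i) = v (s i)" for i
    using arc[of i "ang (s i)"] ang_se[of i] by (simp add: \<gamma>_def x_ang cis_conv_exp)
  have finishp: "pathfinish (\<gamma> i) = v (e i)" for i
    using arc[of i "ang (e i)"] ang_se[of i] by (simp add: \<gamma>_def x_ang cis_conv_exp)
  have wrap: "v (s (Suc i mod m)) = v (s (Suc i))" "c (Suc i mod m) = c (Suc i)" if "i < m" for i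
  proof -
    have "v (s m) = v (s 0)" "c m = c 0"
      using v_periodic[of j0] v_periodic[of "j0 + int n"] by (simp_all add: sm s0 c_def algebra_simps)
    thus "v (s (Suc i mod m)) = v (s (Suc i))" "c (Suc i mod m) = c (Suc i)"
      using that by (auto simp: mod_Suc)
  qed
  have angles: "\<forall>i<m. ang (s i) < ang (e i) \<and> ang (e i) < ang (s i) + 2 * pi"
  proof (intro allI impI conjI)
    show "ang (s i) < ang (e i)" for i by (rule ang_se)
    show "ang (e i) < ang (s i) + 2 * pi" for i
      using re(2)[of i] ang_le[of "e i" "s i + int n"] ang_add[of "s i"] pi_gt_zero by linarith
  qed
  have joints: "\<forall>i<m. pathfinish (\<gamma> i) = pathstart (\<gamma> (Suc i mod m)) \<and> c i \<noteq> c (Suc i mod m)"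
  proof (intro allI impI conjI)
    fix i assume i: "i < m"
    show "pathfinish (\<gamma> i) = pathstart (\<gamma> (Suc i mod m))"
      using wrap(1)[OF i] by (simp add: finishp startp v_es)
    \<comment> \<open>With equal centres the common end point would have equal directions from both
      arcs, but these angles are distinct and at most half a turn apart.\<close>
    show "c i \<noteq> c (Suc i mod m)"
    proof
      assume "c i = c (Suc i mod m)"
      hence "cis (ang (e i)) = cis (ang (s (Suc i)))"
        using wrap(2)[OF i] arc[of i "ang (e i)"] arc[of "Suc i" "ang (s (Suc i))"] ang_se v_es[of i]
        by (simp add: x_ang less_imp_le)
      moreover have "\<bar>ang (e i) - ang (s (Suc i))\<bar> < 2 * pi"
        using ang_es[of i] es_n[of i] ang_le[of "s (Suc i)" "e i + int n"] ang_add[of "e i"] by simp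
      ultimately show False using cis_inj_near ang_es[of i] by fastforce
    qed
  qed
  have disjoint_arcs: "\<forall>i<m. \<forall>j<m. i \<noteq> j \<longrightarrow> path_image (\<gamma> i) \<inter> path_image (\<gamma> j) \<subseteq> {pathstart (\<gamma> i), pathfinish (\<gamma> i)}"
  proof (intro allI impI subsetI)
    fix i j y assume ij: "i < m" "j < m" "i \<noteq> j" and y: "y \<in> path_image (\<gamma> i) \<inter> path_image (\<gamma> j)"
      have "y \<in> x ` {ang (s i)..ang (e i)}" using y by (simp only: image Int_iff)
      then obtain \<theta> where "y = x \<theta>" "\<theta> \<in> {ang (s i)..ang (e i)}" by (rule imageE)
      hence \<theta>: "y = x \<theta>" "ang (s i) \<le> \<theta>" "\<theta> \<le> ang (e i)" by auto
      have "y \<in> x ` {ang (s j)..ang (e j)}" using y by (simp only: image Int_iff)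
      then obtain \<psi> where "y = x \<psi>" "\<psi> \<in> {ang (s j)..ang (e j)}" by (rule imageE)
      hence \<psi>: "y = x \<psi>" "ang (s j) \<le> \<psi>" "\<psi> \<le> ang (e j)" by auto
    show "y \<in> {pathstart (\<gamma> i), pathfinish (\<gamma> i)}"
    proof (cases "\<theta> = ang (s i) \<or> \<theta> = ang (e i)")
      case True
      thus ?thesis using \<theta>(1) by (auto simp: startp finishp x_ang)
    next
      case False
      hence in_arc: "ang (s i) < \<theta>" "\<theta> < ang (e i)" using \<theta> by auto
      \<comment> \<open>A point inside an arc has only one normal, which determines its angle within
        the turn.\<close>
      have "cis \<psi> = cis \<theta>"
      proof (rule arc_normal_unique[OF _ in_arc, of "c i" 1])
        show "c i + complex_of_real 1 * cis t \<in> R" if "ang (s i) < t" "t < ang (e i)" for t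
          using arc[of i t] x_in[of t] that by simp
        show "x \<psi> = c i + complex_of_real 1 * cis \<theta>" using arc[of i \<theta>] \<theta> \<psi> by simp
      qed simp
      moreover have rng: "ang j0 \<le> ang (s k)" "ang (e k) < ang j0 + 2 * pi" if "k < m" for k
      proof -
        show "ang j0 \<le> ang (s k)" using s_mono_le[of 0 k] ang_le[of j0 "s k"] by (simp add: s0)
        have "e k < j0 + 2 * int n" using es[of k] s_mono_le[of "Suc k" m] that by (simp add: sm)
        moreover have "ang (j0 + 2 * int n) = ang j0 + 2 * pi"
          using ang_add[of j0] ang_add[of "j0 + int n"] by (simp add: algebra_simps)
        ultimately show "ang (e k) < ang j0 + 2 * pi" using ang_less[of "e k" "j0 + 2 * int n"] by simp
      qed
      ultimately have eq: "\<psi> = \<theta>" using \<theta> \<psi> rng[OF ij(1)] rng[OF ij(2)] by (intro cis_inj_near) auto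
      have sep: "ang (e k) < ang (s l)" if "k < l" for k l
        using es[of k] s_mono_le[of "Suc k" l] that ang_less[of "e k" "s l"] by simp
      from sep[of i j] sep[of j i] show ?thesis using eq \<theta> \<psi> ij(3) by linarith
    qed
  qed
  have boundary: "frontier R = (\<Union>i<m. path_image (\<gamma> i))"
  proof
    show "(\<Union>i<m. path_image (\<gamma> i)) \<subseteq> frontier R" unfolding image using x_frontier by auto
    \<comment> \<open>Whole turns bring \<open>\<theta>\<close> into the turn that starts at
      \<open>j0\<close>; its index then belongs to the last run starting at or before it.\<close>
    have main: "x \<theta> \<in> (\<Union>i<m. path_image (\<gamma> i))" if edi: "ed (idx \<theta>)" for \<theta>
    proof -
      define k where "k = - ((idx \<theta> - j0) div (2 * int n))"
      define t where "t = \<theta> + 2 * pi * of_int k"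
      define j where "j = idx \<theta> + 2 * int n * k"
      have "idx t = j"
      proof -
        have "ang (i + 2 * int n * k) = ang i + 2 * pi * of_int k" for i
          using n2 by (simp add: root_angle_def field_simps)
        from this[of "idx \<theta>"] this[of "idx \<theta> + 1"] show ?thesis
          using idx_bounds[of \<theta>] by (subst idx_iff) (simp add: j_def t_def algebra_simps)
      qed
      hence tj: "ang j \<le> t" "t < ang (j + 1)" using idx_bounds[of t] by auto
      have "j = j0 + (idx \<theta> - j0) mod (2 * int n)"
        unfolding j_def k_def using minus_mult_div_eq_mod[of "idx \<theta> - j0" "2 * int n"] by (simp add: algebra_simps)
      hence jr: "j0 \<le> j" "j < s m" using n2 by (auto simp: sm)
      have edj: "ed j" using edi v_mult[of "idx \<theta>" k] v_mult[of "idx \<theta> + 1" k] by (simp add: j_def algebra_simps)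
      define i where "i = (LEAST i. j < s (Suc i))"
      have m0: "m \<noteq> 0" using sm s0 n2 by (metis add.right_neutral add_left_cancel mult_eq_0_iff of_nat_eq_0_iff not_numeral_le_zero zero_neq_numeral)
      hence ex: "j < s (Suc (m - 1))" using jr by simp
      have i1: "j < s (Suc i)" unfolding i_def by (rule LeastI) (rule ex)
      have "i \<le> m - 1" unfolding i_def by (rule Least_le) (rule ex)
      hence im: "i < m" using m0 by simp
      have i2: "s i \<le> j"
      proof (cases i)
        case (Suc i')
        thus ?thesis using not_less_Least[of i' "\<lambda>i. j < s (Suc i)"] unfolding i_def[symmetric] by simp
      qed (use jr s0 in simp)
      have "j < e i" using gap[of i j] edj i1 by (meson linorder_not_le)
      hence "ang (s i) \<le> t" "t \<le> ang (e i)" using tj i2 ang_le[of "s i" j] ang_le[of "j + 1" "e i"] by auto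
      hence "x t \<in> path_image (\<gamma> i)" by (auto simp: image)
      thus ?thesis using im by (auto simp: t_def x_mult)
    qed
    show "frontier R \<subseteq> (\<Union>i<m. path_image (\<gamma> i))"
    proof
      fix y assume "y \<in> frontier R"
      then obtain \<theta> where y: "y = x \<theta>" using frontier_eq_range[OF compact_R convex_R] by auto
      show "y \<in> (\<Union>i<m. path_image (\<gamma> i))"
      proof (cases "ed (idx \<theta>)")
        \<comment> \<open>A resting support point is a vertex, and \<open>next_ed\<close> finds this
          vertex at a moving index.\<close>
        case False
        obtain k where k: "ed k" "v k = v (idx \<theta>)" using next_ed by blast
        have "idx (ang k) = k" using ang_less[of k "k + 1"] by (subst idx_iff) simp
        hence "x (ang k) \<in> (\<Union>i<m. path_image (\<gamma> i))" using main k by simp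
        moreover have "y = x (ang k)" using False k y by (simp add: x_def[of \<theta>] x_ang)
        ultimately show ?thesis by simp
      qed (use main y in simp)
    qed
  qed
  have "reuleaux_polygon R (v ` s ` {..<m})"
    unfolding reuleaux_polygon_def Let_def
  proof (intro conjI)
    show "R \<noteq> {}" using x_in by blast
    show "compact R" by (rule compact_R)
    show "convex R" by (rule convex_R)
    show "\<exists>w>0. constant_width R w" using constant_width_R by (intro exI[of _ 1]) simp
  next
    have "v ` s ` {..<m} = (\<lambda>i. pathstart (\<gamma> i)) ` {..<m}" by (simp add: startp image_image)
    note arcs = conjI[OF zero_less_one conjI[OF angles conjI[OF joints conjI[OF disjoint_arcs conjI[OF boundary this]]]]]
    show "\<exists>m' c' \<rho> a b. 0 < \<rho> \<and> (\<forall>i<m'. a i < b i \<and> b i < a i + 2 * pi) \<and>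
        (\<forall>i<m'. pathfinish (part_circlepath (c' i) \<rho> (a i) (b i))
            = pathstart (part_circlepath (c' (Suc i mod m')) \<rho> (a (Suc i mod m')) (b (Suc i mod m')))
          \<and> c' i \<noteq> c' (Suc i mod m')) \<and>
        (\<forall>i<m'. \<forall>j<m'. i \<noteq> j \<longrightarrow> path_image (part_circlepath (c' i) \<rho> (a i) (b i)) \<inter>
            path_image (part_circlepath (c' j) \<rho> (a j) (b j))
          \<subseteq> {pathstart (part_circlepath (c' i) \<rho> (a i) (b i)), pathfinish (part_circlepath (c' i) \<rho> (a i) (b i))}) \<and>
        frontier R = (\<Union>i<m'. path_image (part_circlepath (c' i) \<rho> (a i) (b i))) \<and>
        v ` s ` {..<m} = (\<lambda>i. pathstart (part_circlepath (c' i) \<rho> (a i) (b i))) ` {..<m'}"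
      by (rule exI[of _ m], rule exI[of _ c], rule exI[of _ 1], rule exI[of _ "\<lambda>i. ang (s i)"],
          rule exI[of _ "\<lambda>i. ang (e i)"]) (rule arcs[unfolded \<gamma>_def])
  qed
  thus ?thesis by blast
qed

lemma reinhardt_polygon_P: "reinhardt_polygon n P"
proof -
  obtain V where "reuleaux_polygon R V" "V \<subseteq> range v" using reuleaux_polygon_R by blast
  moreover have "range v \<subseteq> frontier R" using x_frontier[of "ang _"] by (auto simp: x_ang)
  moreover have "diameter R = 1" by (rule diameter_eq_1) (auto simp: v_in)
  ultimately show ?thesis unfolding reinhardt_polygon_def extreme_points_P
    using convex_polygon_P equilateral_P diameter_P by auto
qed

end

section \<open>Similarity of the polygons of two walks\<close>

context walk
begin

lemma diameter_pair_in_P: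
  assumes "y \<in> P" "y - cis (ang j) \<in> P"
  shows "y = v j"
  using diameter_ends(1)[of y "y - cis (ang j)" "ang j"] assms P_subset_R by (auto simp: x_ang)

text \<open>A support point that belongs to \<open>P\<close> is extreme in \<open>P\<close>, hence
  some \<open>v i\<close>, and inside an arc its normal can only be
  \<open>cis (ang i)\<close>.\<close>

lemma arc_direction:
  assumes "x \<phi> \<in> P" "ed (idx \<phi>)"
  shows "\<exists>i. cis \<phi> = cis (ang i)"
proof (cases "\<phi> = ang (idx \<phi>)")
  case False
  hence \<phi>: "ang (idx \<phi>) < \<phi>" "\<phi> < ang (idx \<phi> + 1)" using idx_bounds[of \<phi>] by auto
  have "x \<phi> extreme_point_of P"
    using x_extreme[of \<phi>] assms(1) P_subset_R by (auto simp: extreme_point_of_def)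
  hence "x \<phi> \<in> range v" using extreme_points_P by (auto simp: polygon_vertices_def)
  then obtain i where i: "x \<phi> = v i" by blast
  have arc: "x t = v (idx \<phi> + int n) + cis t" if "ang (idx \<phi>) \<le> t" "t \<le> ang (idx \<phi> + 1)" for t
    using x_on_run[of "idx \<phi>" "idx \<phi> + 1" t] that assms(2) by (metis order_antisym_conv zle_add1_eq_le zless_add1_eq)
  have "cis (ang i) = cis \<phi>"
  proof (rule arc_normal_unique[OF _ \<phi>, of "v (idx \<phi> + int n)" 1])
    show "v (idx \<phi> + int n) + complex_of_real 1 * cis t \<in> R" if "ang (idx \<phi>) < t" "t < ang (idx \<phi> + 1)" for t
      using arc[of t] x_in[of t] that by simp
    show "x (ang i) = v (idx \<phi> + int n) + complex_of_real 1 * cis \<phi>"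
      using arc[of \<phi>] \<phi> by (simp add: x_ang flip: i)
  qed simp
  thus ?thesis by metis
qed metis

text \<open>Of the two ends of a diameter one lies on a moving piece, where
  \<open>arc_direction\<close> applies.\<close>

lemma diameter_direction:
  assumes "y \<in> P" "y - cis \<phi> \<in> P"
  shows "\<exists>i. cis \<phi> = cis (ang i)"
proof -
  have "y = x \<phi>" "y - cis \<phi> = x (\<phi> + pi)"
    using diameter_ends[of y "y - cis \<phi>" \<phi>] assms P_subset_R by auto
  hence xP: "x \<phi> \<in> P" "x (\<phi> + pi) \<in> P" using assms by metis+
  show ?thesis
  proof (cases "ed (idx \<phi>)")
    case True
    thus ?thesis using arc_direction xP by blast
  next
    case False
    have "idx (\<phi> + pi) = idx \<phi> + int n"
      using idx_bounds[of \<phi>] ang_add[of "idx \<phi>"] ang_add[of "idx \<phi> + 1"] by (subst idx_iff) (simp add: algebra_simps)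
    hence "ed (idx (\<phi> + pi))" using False ed_antipode[of "idx \<phi>"] by simp
    then obtain i where "cis (\<phi> + pi) = cis (ang i)" using arc_direction[of "\<phi> + pi"] xP(2) by blast
    hence "- cis \<phi> = cis (ang i)" by (simp add: cis_add_pi)
    hence "cis \<phi> = cis (ang (i + int n))" unfolding cis_ang_antipode by (metis minus_minus)
    thus ?thesis by blast
  qed
qed

end

definition edge_word :: "(int \<Rightarrow> complex) \<Rightarrow> int \<Rightarrow> bool" where
  "edge_word v j \<longleftrightarrow> v (j + 1) \<noteq> v j"

text \<open>The correction by the parity of \<open>j\<close> turns an \<open>n\<close>-antiperiodic word with odd \<open>n\<close> into an \<open>n\<close>-periodic one.\<close>

definition sign_word :: "(int \<Rightarrow> complex) \<Rightarrow> int \<Rightarrow> bool" where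
  "sign_word v j \<longleftrightarrow> edge_word v j \<noteq> odd j"

lemma sign_word_dih:
  "(sign_word v, sign_word v') \<in> dih \<longleftrightarrow>
     (\<exists>k. (\<forall>j. edge_word v' j = edge_word v (j + k)) \<or> (\<forall>j. edge_word v' j = edge_word v (k - j)))"
proof -
  have "(\<forall>j. sign_word v' j = (sign_word v (j + k) \<noteq> odd k)) \<longleftrightarrow> (\<forall>j. edge_word v' j = edge_word v (j + k))"
    "(\<forall>j. sign_word v' j = (sign_word v (k - j) \<noteq> odd k)) \<longleftrightarrow> (\<forall>j. edge_word v' j = edge_word v (k - j))" for k
    unfolding sign_word_def by auto
  thus ?thesis unfolding dih_def by simp
qed

lemma root_angle_add: "root_angle n (i + j) = root_angle n i + root_angle n j"
  by (simp add: root_angle_def add_divide_distrib distrib_right)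

lemma cis_root_angle_add: "cis (root_angle n (i + j)) = cis (root_angle n i) * cis (root_angle n j)"
  by (simp add: root_angle_add cis_mult)

lemma cis_root_angle_diff: "cis (root_angle n (i - j)) = cis (root_angle n i) * cnj (cis (root_angle n j))"
proof -
  have "root_angle n (i - j) = root_angle n i - root_angle n j"
    using root_angle_add[of n "i - j" j] by simp
  thus ?thesis by (simp add: cis_cnj cis_mult)
qed

lemma affine_from_steps:
  fixes u v :: "int \<Rightarrow> complex"
  assumes "\<And>j. u (j + 1) - u j = a * (v (j + 1) - v j)"
  shows "u j = a * v j + (u 0 - a * v 0)"
proof -
  have "periodic 1 (\<lambda>j. u j - a * v j)" using assms by (simp add: periodic_def algebra_simps)
  from periodic_cong[OF this, of j 0] show ?thesis by (simp add: algebra_simps)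
qed

lemma convex_hull_affine_image: "convex hull ((\<lambda>z. a * z + b) ` S) = (\<lambda>z. a * z + b :: complex) ` (convex hull S)"
proof -
  have "(\<lambda>z. a * z + b) ` T = (\<lambda>z. b + z) ` ((\<lambda>z. a * z) ` T)" for T :: "complex set"
    by (auto simp: image_image add.commute)
  moreover have "linear (\<lambda>z. a * z)" by (intro bounded_linear.linear bounded_linear_mult_right)
  ultimately show ?thesis
    by (simp add: convex_hull_translation convex_hull_linear_image)
qed

lemma convex_hull_cnj_image: "convex hull (cnj ` S) = cnj ` (convex hull S)"
  by (rule convex_hull_linear_image[symmetric]) (simp add: bounded_linear.linear[OF bounded_linear_cnj])

lemma convex_hull_affine_cnj_image:
  "convex hull ((\<lambda>z. a * cnj z + b) ` S) = (\<lambda>z. a * cnj z + b :: complex) ` (convex hull S)"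
  using convex_hull_affine_image[of a b "cnj ` S"] by (simp add: convex_hull_cnj_image image_image)

text \<open>Both hulls have diameter 1, attained by a vertex and its antipode, while
  \<open>f\<close> scales distances by \<open>r\<close>.\<close>

lemma similarity_modulus:
  assumes W: "walk n v" "walk n' v'" and sim: "convex hull (range v') = f ` (convex hull (range v))"
    and f: "\<And>y z. norm (f y - f z) = r * norm (y - z)" and r: "r \<ge> 0"
  shows "r = 1"
proof -
  interpret A: walk n v by (rule W)
  interpret B: walk n' v' by (rule W)
  have "f (v j) \<in> B.R" for j
  proof -
    have "f (v j) \<in> f ` A.P" using A.v_in_P by (rule imageI)
    thus ?thesis using B.P_subset_R sim by (auto simp: A.P_def B.P_def)
  qed
  hence "norm (f (v 0) - f (v (0 + int n))) \<le> 1" by (intro B.norm_diff_le)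
  hence "r \<le> 1" using A.antipode[of 0] by (simp add: f)
  moreover have "r \<ge> 1"
  proof -
    obtain y y' where y: "v' 0 = f y" "v' (0 + int n') = f y'" "y \<in> A.P" "y' \<in> A.P"
      using B.v_in_P[of 0] B.v_in_P[of "0 + int n'"] sim unfolding A.P_def B.P_def by blast
    have "1 = norm (f y - f y')" using B.antipode[of 0] by (simp add: y(1,2)[symmetric])
    also have "\<dots> \<le> r * 1" unfolding f using r y(3,4) A.P_subset_R A.norm_diff_le by (intro mult_left_mono) auto
    finally show ?thesis by simp
  qed
  ultimately show ?thesis by simp
qed

text \<open>A similarity carries diameters to diameters, so its rotation is some
  \<open>cis (root_angle n k)\<close>, and each vertex is recognised by a diameter that ends in it.
  Conversely the edge word determines every step of a walk, so matching words give step vectors that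
  differ by a fixed rotation or flip.\<close>

lemma similar_walks_iff:
  assumes W: "walk n v" "walk n v'"
  shows "(convex hull (range v), convex hull (range v')) \<in> similarity \<longleftrightarrow> (sign_word v, sign_word v') \<in> dih"
proof -
  interpret A: walk n v by (rule W)
  interpret B: walk n v' by (rule W)
  let ?c = "\<lambda>j. cis (root_angle n j)"
  show ?thesis
  proof
    assume "(convex hull (range v), convex hull (range v')) \<in> similarity"
    then obtain a b where a: "a \<noteq> 0" and
      "convex hull (range v') = (\<lambda>z. a * z + b) ` (convex hull (range v)) \<or>
       convex hull (range v') = (\<lambda>z. a * cnj z + b) ` (convex hull (range v))"
      unfolding similarity_def by auto
    then consider (rot) "B.P = (\<lambda>z. a * z + b) ` A.P" | (flip) "B.P = (\<lambda>z. a * cnj z + b) ` A.P"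
      by (auto simp: A.P_def B.P_def)
    thus "(sign_word v, sign_word v') \<in> dih"
    proof cases
      case rot
      have "norm a = 1"
        using rot by (intro similarity_modulus[OF W]) (auto simp: A.P_def B.P_def norm_mult simp flip: right_diff_distrib)
      then obtain \<alpha> where \<alpha>: "a = cis \<alpha>" using A.unit_cis by blast
      have img: "a * v j + b \<in> B.P" for j using rot A.v_in_P by auto
      have "a * v 0 + b - cis \<alpha> = a * v (0 + int n) + b"
        using A.antipode[of 0] by (simp add: \<alpha> root_angle_def algebra_simps)
      then obtain k where k: "a = ?c k" using B.diameter_direction[of "a * v 0 + b" \<alpha>] img \<alpha> by metis
      have v': "v' (k + j) = a * v j + b" for j
      proof -
        have "a * v j + b - ?c (k + j) = a * v (j + int n) + b"
          using A.antipode[of j] by (simp add: cis_root_angle_add k algebra_simps)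
        thus ?thesis using B.diameter_pair_in_P[of "a * v j + b" "k + j"] img by metis
      qed
      have "edge_word v' j = edge_word v (j + - k)" for j
        using v'[of "j - k"] v'[of "j - k + 1"] a by (simp add: edge_word_def algebra_simps)
      thus ?thesis unfolding sign_word_dih by blast
    next
      case flip
      have "norm a = 1"
        using flip by (intro similarity_modulus[OF W])
          (auto simp: A.P_def B.P_def norm_mult simp flip: right_diff_distrib complex_cnj_diff)
      then obtain \<alpha> where \<alpha>: "a = cis \<alpha>" using A.unit_cis by blast
      have img: "a * cnj (v j) + b \<in> B.P" for j using flip A.v_in_P by auto
      have cnj_anti: "cnj (v j) - cnj (v (j + int n)) = cnj (?c j)" for j
        by (simp flip: complex_cnj_diff A.antipode)
      have "a * cnj (v 0) + b - cis \<alpha> = a * cnj (v (0 + int n)) + b"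
        using cnj_anti[of 0] by (simp add: \<alpha> root_angle_def algebra_simps)
      then obtain k where k: "a = ?c k" using B.diameter_direction[of "a * cnj (v 0) + b" \<alpha>] img \<alpha> by metis
      have v': "v' (k - j) = a * cnj (v j) + b" for j
      proof -
        have "a * cnj (v j) + b - ?c (k - j) = a * cnj (v (j + int n)) + b"
          using cnj_anti[of j] by (simp add: cis_root_angle_diff k algebra_simps)
        thus ?thesis using B.diameter_pair_in_P[of "a * cnj (v j) + b" "k - j"] img by metis
      qed
      \<comment> \<open>The flip sends the step from \<open>j\<close> to \<open>j + 1\<close> to the
        one between \<open>k - j - 1\<close> and \<open>k - j\<close>; hence the shift by
        one.\<close>
      have "edge_word v' j = edge_word v (k - 1 - j)" for j
        using v'[of "k - j"] v'[of "k - 1 - j"] a by (auto simp: edge_word_def algebra_simps)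
      thus ?thesis unfolding sign_word_dih by blast
    qed
  next
    assume "(sign_word v, sign_word v') \<in> dih"
    then consider (rot) k where "\<And>j. edge_word v' j = edge_word v (j + k)"
      | (flip) k where "\<And>j. edge_word v' j = edge_word v (k - j)"
      unfolding sign_word_dih by blast
    thus "(convex hull (range v), convex hull (range v')) \<in> similarity"
    proof cases
      case rot
      define a where "a = ?c (- k)"
      define b where "b = v' (0 - k) - a * v 0"
      have "v' (j - k) = a * v j + b" for j
        unfolding b_def
      proof (rule affine_from_steps[where u = "\<lambda>j. v' (j - k)"])
        fix j
        have "v' (j - k + 1) - v' (j - k) = a * (v (j + 1) - v j)"
          unfolding B.step A.step using rot[of "j - k"] cis_root_angle_add[of n "j + 1" "- k"] cis_root_angle_add[of n j "- k"]
          by (auto simp: edge_word_def a_def algebra_simps)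
        thus "v' (j + 1 - k) - v' (j - k) = a * (v (j + 1) - v j)" by (simp add: algebra_simps)
      qed
      hence "v' j = a * v (j + k) + b" for j by (metis add_diff_cancel_right')
      hence "v' = (\<lambda>j. a * v (j + k) + b)" by blast
      hence "range v' = (\<lambda>z. a * z + b) ` range (\<lambda>j. v (j + k))" by (simp add: image_image)
      also have "range (\<lambda>j. v (j + k)) = range v"

      proof (intro equalityI subsetI)
        fix y assume "y \<in> range v"
        then obtain i where "y = v i" by blast
        thus "y \<in> range (\<lambda>j. v (j + k))" by (intro image_eqI[of _ _ "i - k"]) auto
      qed auto
      finally have "convex hull (range v') = (\<lambda>z. a * z + b) ` (convex hull (range v))"
        by (simp add: convex_hull_affine_image)
      moreover have "a \<noteq> 0" by (simp add: a_def)
      ultimately show ?thesis unfolding similarity_def by blast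
    next
      case flip
      \<comment> \<open>Inverse of the same shift: steps are mirrored by \<open>k - j\<close>,
        vertices by \<open>k + 1 - j\<close>.\<close>
      define a where "a = ?c (k + 1)"
      define b where "b = v' (k + 1 - 0) - a * cnj (v 0)"
      have "v' (k + 1 - j) = a * cnj (v j) + b" for j
        unfolding b_def
      proof (rule affine_from_steps[where u = "\<lambda>j. v' (k + 1 - j)" and v = "\<lambda>j. cnj (v j)"])
        fix j
        have "v' (k - j + 1) - v' (k - j) = a * (cnj (v j) - cnj (v (j + 1)))"
        proof -
          have neg: "cnj (v j) - cnj (v (j + 1)) = - cnj (v (j + 1) - v j)" by simp
          show ?thesis unfolding neg B.step A.step
            using flip[of "k - j"] cis_root_angle_diff[of n "k + 1" j] cis_root_angle_diff[of n "k + 1" "j + 1"]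
            by (auto simp: edge_word_def a_def algebra_simps)
        qed
        thus "v' (k + 1 - (j + 1)) - v' (k + 1 - j) = a * (cnj (v (j + 1)) - cnj (v j))" by (simp add: algebra_simps)
      qed
      hence "v' j = a * cnj (v (k + 1 - j)) + b" for j by (metis diff_diff_eq2 add_diff_cancel_left')
      hence "v' = (\<lambda>j. a * cnj (v (k + 1 - j)) + b)" by blast
      hence "range v' = (\<lambda>z. a * cnj z + b) ` range (\<lambda>j. v (k + 1 - j))" by (simp add: image_image)
      also have "range (\<lambda>j. v (k + 1 - j)) = range v"
      proof (intro equalityI subsetI)
        fix y assume "y \<in> range v"
        then obtain i where "y = v i" by blast
        thus "y \<in> range (\<lambda>j. v (k + 1 - j))" by (intro image_eqI[of _ _ "k + 1 - i"]) auto
      qed auto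
      finally have "convex hull (range v') = (\<lambda>z. a * cnj z + b) ` (convex hull (range v))"
        by (simp add: convex_hull_affine_cnj_image)
      moreover have "a \<noteq> 0" by (simp add: a_def)
      ultimately show ?thesis unfolding similarity_def by blast
    qed
  qed
qed

section \<open>Walks with a prescribed edge word\<close>

definition pm :: "bool \<Rightarrow> int" where
  "pm b = (if b then 1 else -1)"

definition edge_step :: "nat \<Rightarrow> (int \<Rightarrow> bool) \<Rightarrow> int \<Rightarrow> complex" where
  "edge_step n e j = (if e j then cis (root_angle n (j + 1)) - cis (root_angle n j) else 0)"

lemma cis_root_angle_n: "n > 0 \<Longrightarrow> cis (root_angle n (j + int n)) = - cis (root_angle n j)"
proof -
  assume "n > 0"
  hence "root_angle n (j + int n) = root_angle n j + pi" by (simp add: root_angle_def field_simps)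
  thus ?thesis by (simp add: complex_eq_iff)
qed

text \<open>The indicator of a moving step is one half plus half its sign. The constant halves
  telescope to half the change of \<open>cis\<close> over half a turn, from 1 to -1, which is the
  term \<open>- 1\<close>.\<close>

lemma sum_edge_steps:
  assumes "n > 0"
  shows "(\<Sum>j<n. edge_step n e (int j)) =
     (cis (root_angle n 1) - 1) / 2 * (\<Sum>j<n. of_int (pm (e (int j))) * cis (root_angle n (int j))) - 1"
proof -
  let ?c = "\<lambda>j. cis (root_angle n j)"
  have c1: "?c (j + 1) - ?c j = (?c 1 - 1) * ?c j" for j
    by (simp add: cis_root_angle_add algebra_simps)
  have tele: "(\<Sum>j<n. ?c (int j + 1) - ?c (int j)) = - 2"
  proof -
    have "(\<Sum>j<n. ?c (int (Suc j)) - ?c (int j)) = ?c (int n) - ?c (int 0)"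
      by (rule sum_lessThan_telescope)
    also have "\<dots> = - 2" using cis_root_angle_n[OF assms, of 0] by (simp add: root_angle_def)
    finally show ?thesis by (simp add: add.commute)
  qed
  have "edge_step n e j = (?c 1 - 1) / 2 * (of_int (pm (e j)) * ?c j) + (?c (j + 1) - ?c j) / 2" for j
    unfolding c1 by (simp add: edge_step_def pm_def c1)
  hence "(\<Sum>j<n. edge_step n e (int j)) = (\<Sum>j<n. (?c 1 - 1) / 2 * (of_int (pm (e (int j))) * ?c (int j)) + (?c (int j + 1) - ?c (int j)) / 2)"
    by simp
  also have "\<dots> = (?c 1 - 1) / 2 * (\<Sum>j<n. of_int (pm (e (int j))) * ?c (int j)) + (\<Sum>j<n. ?c (int j + 1) - ?c (int j)) / 2"
    by (simp only: sum.distrib sum_distrib_left sum_divide_distrib)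
  finally show ?thesis unfolding tele by simp
qed

lemma (in walk) edge_word_sum:
  "(\<Sum>j<n. of_int (pm (edge_word v (int j))) * cis (ang (int j))) = 0"
proof -
  have "edge_step n (edge_word v) j = v (j + 1) - v j" for j
    unfolding step by (simp add: edge_step_def edge_word_def)
  hence "(\<Sum>j<n. edge_step n (edge_word v) (int j)) = (\<Sum>j<n. v (int (Suc j)) - v (int j))"
    by (simp add: add.commute)
  also have "\<dots> = v (int n) - v (int 0)" by (rule sum_lessThan_telescope)
  also have "\<dots> = - 1" using antipode[of 0] by (simp add: root_angle_def algebra_simps)
  finally have "(cis (ang 1) - 1) / 2 * (\<Sum>j<n. of_int (pm (edge_word v (int j))) * cis (ang (int j))) = 0"
    using sum_edge_steps[of n "edge_word v"] n2 by simp
  moreover have "cis (ang 1) \<noteq> 1" using cis_ang_Suc_neq[of 0] by (simp add: root_angle_def)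
  ultimately show ?thesis by simp
qed

text \<open>The sign condition says that the steps of a half turn add up to -1; by antiperiodicity
  the other half adds up to 1, so the path closes after \<open>2 * n\<close> steps.\<close>

lemma ex_walk:
  assumes n: "n \<ge> 2" and anti: "\<And>j. e (j + int n) \<longleftrightarrow> \<not> e j"
    and zero: "(\<Sum>j<n. of_int (pm (e (int j))) * cis (root_angle n (int j))) = 0"
  shows "\<exists>v. walk n v \<and> edge_word v = e"
proof -
  let ?c = "\<lambda>j. cis (root_angle n j)"
  define d where "d = edge_step n e"
  have c_n: "?c (j + int n) = - ?c j" for j using n by (intro cis_root_angle_n) simp
  have d_n: "d (j + int n) = d j - (?c (j + 1) - ?c j)" for j
    using c_n[of j] c_n[of "j + 1"] anti[of j] by (auto simp: d_def edge_step_def algebra_simps)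
  have sum_n: "(\<Sum>j<n. d (int j)) = - 1"
    using sum_edge_steps[of n e] zero n by (simp add: d_def)
  have "(\<Sum>j<n. d (int j + int n)) = 1"
  proof -
    have "(\<Sum>j<n. d (int j + int n)) = (\<Sum>j<n. d (int j)) - (\<Sum>j<n. ?c (int (Suc j)) - ?c (int j))"
      by (simp add: d_n sum_subtractf add.commute)
    also have "(\<Sum>j<n. ?c (int (Suc j)) - ?c (int j)) = ?c (int n) - ?c (int 0)" by (rule sum_lessThan_telescope)
    also have "\<dots> = - 2" using c_n[of 0] by (simp add: root_angle_def)
    finally show ?thesis by (simp add: sum_n)
  qed
  moreover have "(\<Sum>j<k + n. d (int j)) = (\<Sum>j<n. d (int j)) + (\<Sum>j<k. d (int j + int n))" for k
    by (induction k) (simp_all add: algebra_simps)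
  ultimately have sum_2n: "(\<Sum>j<2 * n. d (int j)) = 0" using sum_n by (simp add: mult_2)
  have d_2n: "d (j + 2 * int n) = d j" for j
    using d_n[of j] d_n[of "j + int n"] c_n[of j] c_n[of "j + 1"] by (simp add: algebra_simps)
  have d_mod: "d (j mod (2 * int n)) = d j" for j
    by (rule periodic_cong[of "2 * n" d]) (simp_all add: periodic_def d_2n cong_def)
  \<comment> \<open>Partial sums within one turn, starting from 0. At the seam between turns the
    step is correct because of \<open>sum_2n\<close>.\<close>
  define v where "v j = (\<Sum>i<nat (j mod (2 * int n)). d (int i))" for j
  have step: "v (j + 1) - v j = d j" for j
  proof (cases "j mod (2 * int n) = 2 * int n - 1")
    case True
    hence "(j + 1) mod (2 * int n) = 0" by (metis add.commute diff_add_cancel mod_add_left_eq mod_self)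
    moreover have "nat (j mod (2 * int n)) = 2 * n - 1" using True by simp
    moreover have "{..<2 * n} = insert (2 * n - 1) {..<2 * n - 1}" using n by auto
    hence "(\<Sum>i<2 * n - 1. d (int i)) + d (int (2 * n - 1)) = 0" using sum_2n by (simp add: add.commute)
    moreover have "d (int (2 * n - 1)) = d j" using d_mod[of j] True n by (simp add: of_nat_diff)
    ultimately show ?thesis by (simp add: v_def add_eq_0_iff)
  next
    case False
    have b: "0 \<le> j mod (2 * int n)" "j mod (2 * int n) < 2 * int n" using n by simp_all
    have "(j + 1) mod (2 * int n) = (j mod (2 * int n) + 1) mod (2 * int n)" by (simp add: mod_simps)
    also have "\<dots> = j mod (2 * int n) + 1" using b False by (intro mod_pos_pos_trivial) auto
    finally have "nat ((j + 1) mod (2 * int n)) = Suc (nat (j mod (2 * int n)))" using b by simp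
    thus ?thesis using b d_mod[of j] by (simp add: v_def)
  qed
  have "v j - v (j + int n) - ?c j = v 0 - v (0 + int n) - ?c 0" for j
  proof -
    have "(v (j + 1) - v (j + 1 + int n) - ?c (j + 1)) = (v j - v (j + int n) - ?c j)" for j
      using step[of j] step[of "j + int n"] d_n[of j] by (simp add: algebra_simps)
    hence per: "periodic 1 (\<lambda>j. v j - v (j + int n) - ?c j)" by (simp add: periodic_def)
    show ?thesis using periodic_cong[OF per, of j 0] by simp
  qed
  moreover have "v 0 - v (0 + int n) - ?c 0 = 0"
    using n by (simp add: v_def sum_n root_angle_def)
  ultimately have antipode: "v j - v (j + int n) = ?c j" for j by (metis eq_iff_diff_eq_0)
  have d0: "d j = 0 \<longleftrightarrow> \<not> e j" for j
  proof -
    have "?c (j + 1) \<noteq> ?c j" using n by (rule cis_root_angle_Suc_neq)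
    thus ?thesis by (simp add: d_def edge_step_def)
  qed
  have eq: "v (j + 1) = v j \<longleftrightarrow> \<not> e j" for j using step[of j] d0[of j] by (metis eq_iff_diff_eq_0)
  have "walk n v"
  proof
    have "v (j + 1) = v j \<or> v (j + 1 + int n) = v (j + int n)" for j
      using eq[of j] eq[of "j + int n"] anti[of j] by (auto simp: algebra_simps)
    thus "reuleaux_walk n v" using antipode by (simp add: reuleaux_walk_def)
  qed (rule n)
  moreover have "edge_word v = e" using eq by (auto simp: edge_word_def fun_eq_iff)
  ultimately show ?thesis by blast
qed

text \<open>Squaring removes the sign: if the \<open>k\<close>-th power is 1, then
  \<open>2 * k\<close> is a multiple of the order \<open>2 * n\<close> of
  \<open>cis (pi / n)\<close>.\<close>

lemma neg_root_primitive:
  assumes "odd n"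
  shows "primitive_root (- cis (root_angle n 1)) n"
proof
  show n: "n > 0" using assms by (cases n) auto
  have pow: "cis (root_angle n 1) ^ k = cis (root_angle n (int k))" for k
    by (simp add: Complex.DeMoivre root_angle_def)
  show "(- cis (root_angle n 1)) ^ n = 1"
  proof -
    have "cis (root_angle n 1) ^ n = - 1"
      using cis_root_angle_n[OF n, of 0] by (subst pow) (simp add: root_angle_def)
    thus ?thesis using assms by (simp add: power_minus_odd)
  qed
  show "n dvd k" if "(- cis (root_angle n 1)) ^ k = 1" for k
  proof -
    have "cis (root_angle n 1) ^ (2 * k) = ((- cis (root_angle n 1)) ^ k)\<^sup>2"
      by (metis mult.commute power2_minus power_mult)
    hence "cis (root_angle n (2 * int k)) = cis 0" using that by (simp add: pow)
    then obtain l :: int where "root_angle n (2 * int k) = 0 + 2 * pi * of_int l" by (rule cis_eqD)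
    hence "of_int (2 * int k) = real_of_int (2 * l * int n)" using n by (simp add: root_angle_def field_simps)
    hence "2 * int k = 2 * l * int n" by (simp only: of_int_eq_iff)
    hence "int k = l * int n" by simp
    thus ?thesis by (metis dvd_triv_right of_nat_dvd_iff)
  qed
qed

lemma sign_word_range:
  assumes n: "n \<ge> 2" "odd n"
  shows "sign_word ` {v. walk n v} =
     {f. periodic n f \<and> (\<Sum>j<n. of_int (pm (f (int j))) * (- cis (root_angle n 1)) ^ j) = 0}"
proof -
  have pow: "(- cis (root_angle n 1)) ^ j = (-1) ^ j * cis (root_angle n (int j))" for j
    by (subst power_minus) (simp add: Complex.DeMoivre root_angle_def)
  have sum_eq: "(\<Sum>j<n. of_int (pm (f (int j))) * (- cis (root_angle n 1)) ^ j)
      = (\<Sum>j<n. of_int (pm (e (int j))) * cis (root_angle n (int j)))"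
    if "\<And>j. e j \<longleftrightarrow> f j \<noteq> odd j" for e f
    by (intro sum.cong refl) (auto simp: pow pm_def that)
  show ?thesis
  proof (intro equalityI subsetI)
    fix f assume "f \<in> sign_word ` {v. walk n v}"
    then obtain v where f: "f = sign_word v" and W: "walk n v" by blast
    interpret walk n v by (rule W)
    have "periodic n f" using ed_antipode n(2)
      by (auto simp: periodic_def f sign_word_def edge_word_def)
    moreover have "(\<Sum>j<n. of_int (pm (f (int j))) * (- cis (root_angle n 1)) ^ j) = 0"
      using sum_eq[of "edge_word v" f] edge_word_sum by (auto simp: f sign_word_def)
    ultimately show "f \<in> {f. periodic n f \<and> (\<Sum>j<n. of_int (pm (f (int j))) * (- cis (root_angle n 1)) ^ j) = 0}"
      by simp
  next
    fix f assume f: "f \<in> {f. periodic n f \<and> (\<Sum>j<n. of_int (pm (f (int j))) * (- cis (root_angle n 1)) ^ j) = 0}"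
    define e where "e j \<longleftrightarrow> f j \<noteq> odd j" for j
    have "\<exists>v. walk n v \<and> edge_word v = e"
    proof (rule ex_walk[OF n(1)])
      show "e (j + int n) \<longleftrightarrow> \<not> e j" for j using f n(2) by (auto simp: e_def periodic_def)
      show "(\<Sum>j<n. of_int (pm (e (int j))) * cis (root_angle n (int j))) = 0"
        using f sum_eq[of e f] by (simp add: e_def)
    qed
    then obtain v where "walk n v" "edge_word v = e" by blast
    moreover from this have "sign_word v = f" by (auto simp: sign_word_def e_def fun_eq_iff)
    ultimately show "f \<in> sign_word ` {v. walk n v}" by blast
  qed
qed

lemma sign_words_pq:
  assumes "prime p" "odd p" "prime q" "odd q" "p \<noteq> q"
  shows "sign_word ` {v. walk (p * q) v} = periodics p \<union> periodics q"
proof -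
  define n where "n = p * q"
  have n: "odd n" "n \<ge> 2"
    using assms(2,4) mult_le_mono[OF prime_ge_2_nat[OF assms(1)] prime_ge_2_nat[OF assms(3)]] by (auto simp: n_def)
  interpret primitive_root "- cis (root_angle n 1)" n by (rule neg_root_primitive) (rule n)
  have pm_iff: "periodic d (\<lambda>j. pm (f j)) \<longleftrightarrow> periodic d f" for d and f :: "int \<Rightarrow> bool"
    by (simp add: periodic_def pm_def) (metis one_neq_neg_one)
  have "(\<Sum>j<n. of_int (pm (f (int j))) * (- cis (root_angle n 1)) ^ j) = 0 \<longleftrightarrow> periodic p f \<or> periodic q f"
    if "periodic n f" for f
    using vanishing_sum_iff_periodic[of "\<lambda>j. pm (f j)" p q] that assms
    unfolding pm_iff by (simp add: n_def pm_def)
  moreover have "periodic n f" if "periodic p f \<or> periodic q f" for f :: "int \<Rightarrow> bool"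
    using that periodic_mult[of p f _ "int q"] periodic_mult[of q f _ "int p"]
    by (auto simp: periodic_def n_def mult.commute)
  ultimately show ?thesis
    unfolding n_def[symmetric] sign_word_range[OF n(2,1)] periodics_def by blast
qed

section \<open>The walk of a Reinhardt polygon\<close>

lemma ex_cw_body:
  assumes "compact R" "R \<noteq> {}" "constant_width R w" "w > 0"
  shows "\<exists>x. cw_body R w x"
proof -
  have "\<exists>y\<in>R. \<forall>z\<in>R. z \<bullet> cis \<phi> \<le> y \<bullet> cis \<phi>" for \<phi>
    by (rule continuous_attains_sup[OF assms(1,2)]) (intro continuous_intros)
  then obtain x where x: "\<And>\<phi>. x \<phi> \<in> R" "\<And>\<phi> z. z \<in> R \<Longrightarrow> z \<bullet> cis \<phi> \<le> x \<phi> \<bullet> cis \<phi>"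
    by metis
  have "cw_body R w x"
  proof
    show "(x \<phi> - x (\<phi> + pi)) \<bullet> cis \<phi> = w" for \<phi>
    proof -
      have "(SUP y\<in>R. y \<bullet> cis \<phi>) = x \<phi> \<bullet> cis \<phi>"
        by (intro cSup_eq_maximum) (auto intro: x)
      moreover have "(INF y\<in>R. y \<bullet> cis \<phi>) = x (\<phi> + pi) \<bullet> cis \<phi>"
      proof (intro cInf_eq_minimum)
        fix r assume "r \<in> (\<lambda>y. y \<bullet> cis \<phi>) ` R"
        then obtain y where "y \<in> R" "r = y \<bullet> cis \<phi>" by blast
        thus "x (\<phi> + pi) \<bullet> cis \<phi> \<le> r" using x(2)[of y "\<phi> + pi"] by (simp add: inner_complex_def)
      qed (auto intro: x)
      ultimately show ?thesis
        using assms(3)[unfolded constant_width_def, rule_format, of "cis \<phi>"] by (simp add: inner_diff_left)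
    qed
  qed (use assms x in auto)
  thus ?thesis by blast
qed

lemma norm_cis_diff:
  "norm (cis t - cis s) = 2 * \<bar>sin ((t - s) / 2)\<bar>"
proof -
  define h where "h = (t - s) / 2"
  have "t = (s + t) / 2 + h" "s = (s + t) / 2 - h" by (simp_all add: h_def field_simps)
  hence "cis t - cis s = cis ((s + t) / 2) * (cis h - cis (- h))"
    by (metis cis_mult right_diff_distrib uminus_add_conv_diff add.commute)
  moreover have "cis h - cis (- h) = complex_of_real (2 * sin h) * \<i>" by (simp add: complex_eq_iff)
  ultimately show ?thesis by (simp add: norm_mult h_def)
qed

section \<open>Radius and centres of the arcs of a Reuleaux polygon\<close>

locale reuleaux = cw_body +
  fixes V :: "complex set" and m :: nat and c :: "nat \<Rightarrow> complex" and \<rho> :: real and a b :: "nat \<Rightarrow> real"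
  assumes compact: "compact R" and convex: "convex R" and \<rho>_pos: "\<rho> > 0"
    and angles: "\<And>i. i < m \<Longrightarrow> a i < b i" "\<And>i. i < m \<Longrightarrow> b i < a i + 2 * pi"
    and joint: "\<And>i. i < m \<Longrightarrow> c i + of_real \<rho> * cis (b i) = c (Suc i mod m) + of_real \<rho> * cis (a (Suc i mod m))"
    and centres: "\<And>i. i < m \<Longrightarrow> c i \<noteq> c (Suc i mod m)"
    and boundary: "frontier R = (\<Union>i<m. (\<lambda>t. c i + of_real \<rho> * cis t) ` {a i..b i})"
    and vertices: "V = (\<lambda>i. c i + of_real \<rho> * cis (a i)) ` {..<m}"
begin

lemma frontier_range: "frontier R = range x"
  by (rule frontier_eq_range[OF compact convex])

lemma arc_in_R: "i < m \<Longrightarrow> a i \<le> t \<Longrightarrow> t \<le> b i \<Longrightarrow> c i + of_real \<rho> * cis t \<in> range x"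
  unfolding frontier_range[symmetric] boundary by (intro UN_I[of i] image_eqI[of _ _ t]) auto

text \<open>An inner arc point is a support point in some direction, and
  \<open>arc_normal_unique\<close> identifies that direction with the angle on the circle. The end
  points follow by continuity.\<close>

lemma x_on_arc:
  assumes i: "i < m" and \<theta>: "a i \<le> \<theta>" "\<theta> \<le> b i"
  shows "x \<theta> = c i + of_real \<rho> * cis \<theta>"
proof -
  have inner: "x t = c i + of_real \<rho> * cis t" if t: "a i < t" "t < b i" for t
  proof -
    obtain \<psi> where \<psi>: "x \<psi> = c i + of_real \<rho> * cis t" using arc_in_R[OF i, of t] t by force
    have "cis \<psi> = cis t"
    proof (rule arc_normal_unique[OF _ t \<rho>_pos \<psi>])
      fix t' assume "a i < t'" "t' < b i"
      thus "c i + complex_of_real \<rho> * cis t' \<in> R" using arc_in_R[OF i, of t'] x_in by auto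
    qed
    thus ?thesis using x_cis_cong \<psi> by metis
  qed
  \<comment> \<open>At inner angles the arc point is \<open>x t\<close>, which is at least as high
    as \<open>x \<theta>\<close>; the inequality passes to the closed arc and makes the arc point at
    \<open>\<theta>\<close> a support point.\<close>
  define f where "f t = (c i + of_real \<rho> * cis t - x \<theta>) \<bullet> cis t" for t
  have "f \<theta> \<ge> 0"
  proof (rule continuous_ge_on_closure[of "{a i<..<b i}" f])
    show "continuous_on (closure {a i<..<b i}) f" unfolding f_def by (intro continuous_intros)
    show "\<theta> \<in> closure {a i<..<b i}" using \<theta> angles(1)[OF i] by (simp add: closure_greaterThanLessThan)
    show "f t \<ge> 0" if "t \<in> {a i<..<b i}" for t
      using x_max[OF x_in[of \<theta>], of t] inner[of t] that by (simp add: f_def inner_diff_left)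
  qed
  moreover have "c i + of_real \<rho> * cis \<theta> \<in> R" using arc_in_R[OF i \<theta>] x_in by auto
  ultimately show ?thesis
    using x_max[of "c i + of_real \<rho> * cis \<theta>" \<theta>] by (intro x_unique[symmetric]) (auto simp: f_def inner_diff_left)
qed

lemma m_pos: "m > 0"
proof (rule ccontr)
  assume "\<not> m > 0"
  hence "frontier R = {}" unfolding boundary by simp
  thus False using x_frontier by blast
qed

lemma arc_end_in_V: "i < m \<Longrightarrow> c i + of_real \<rho> * cis (b i) \<in> V" "i < m \<Longrightarrow> c i + of_real \<rho> * cis (a i) \<in> V"
  unfolding joint vertices using m_pos by auto

lemma outside_V:
  assumes "x \<phi> \<notin> V"
  obtains i \<theta> where "i < m" "a i < \<theta>" "\<theta> < b i" "cis \<phi> = cis \<theta>"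
proof -
  have "x \<phi> \<in> frontier R" using x_frontier .
  then obtain i \<theta> where i: "i < m" "a i \<le> \<theta>" "\<theta> \<le> b i" "x \<phi> = c i + of_real \<rho> * cis \<theta>"
    unfolding boundary by auto
  have "\<theta> \<noteq> a i" "\<theta> \<noteq> b i" using assms i arc_end_in_V[of i] by auto
  hence \<theta>: "a i < \<theta>" "\<theta> < b i" using i by auto
  have "cis \<phi> = cis \<theta>"
  proof (rule arc_normal_unique[OF _ \<theta> \<rho>_pos i(4)])
    fix t assume "a i < t" "t < b i"
    thus "c i + complex_of_real \<rho> * cis t \<in> R" using arc_in_R[OF i(1), of t] x_in by auto
  qed
  thus ?thesis using that i(1) \<theta> by blast
qed

lemma finite_V: "finite V" unfolding vertices by simp

lemma x_on_corner:
  assumes "\<alpha> \<le> \<phi>" "\<phi> \<le> \<beta>" "\<beta> < \<alpha> + pi" "x \<beta> = x \<alpha>"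
  shows "x (\<phi> + pi) = x \<alpha> - of_real w * cis \<phi>"
  using x_const_between[OF assms] x_diff[of \<phi>] by (simp add: algebra_simps)

text \<open>
  At a corner a whole interval of directions shares its support point, so the opposite support points run through an
  arc of radius \<open>w\<close> in the boundary; infinitely many of them lie on one of the arcs of radius \<open>\<rho>\<close>.
\<close>

lemma corner_radius:
  assumes "\<alpha> < \<beta>" "\<beta> < \<alpha> + pi" "x \<beta> = x \<alpha>"
  shows "\<rho> = w"
proof -
  define \<Phi> where "\<Phi> = {\<alpha><..<\<beta>}"
  have opp: "x (\<phi> + pi) = x \<alpha> - of_real w * cis \<phi>" if "\<phi> \<in> \<Phi>" for \<phi>
    using that assms by (intro x_on_corner[of \<alpha> \<phi> \<beta>]) (auto simp: \<Phi>_def)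
  have cis_inj: "\<phi> = \<psi>" if "\<phi> \<in> \<Phi>" "\<psi> \<in> \<Phi>" "cis \<phi> = cis \<psi>" for \<phi> \<psi>
    using that assms pi_gt_zero by (intro cis_inj_near) (auto simp: \<Phi>_def abs_if)
  have "inj_on (\<lambda>\<phi>. x (\<phi> + pi)) \<Phi>"
  proof (rule inj_onI)
    fix \<phi> \<psi> assume "\<phi> \<in> \<Phi>" "\<psi> \<in> \<Phi>" "x (\<phi> + pi) = x (\<psi> + pi)"
    thus "\<phi> = \<psi>" using opp[of \<phi>] opp[of \<psi>] w_pos by (intro cis_inj) auto
  qed
  hence "finite ((\<lambda>\<phi>. x (\<phi> + pi)) -` V \<inter> \<Phi>)" by (intro finite_vimage_IntI finite_V)
  moreover have "infinite \<Phi>" using assms(1) by (simp add: \<Phi>_def)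
  moreover have "\<Phi> - (\<lambda>\<phi>. x (\<phi> + pi)) -` V = \<Phi> - ((\<lambda>\<phi>. x (\<phi> + pi)) -` V \<inter> \<Phi>)" by blast
  ultimately have inf: "infinite (\<Phi> - (\<lambda>\<phi>. x (\<phi> + pi)) -` V)" by (metis Diff_infinite_finite)
  define \<Phi>' where "\<Phi>' = \<Phi> - (\<lambda>\<phi>. x (\<phi> + pi)) -` V"
  have "\<exists>k<m. x (\<phi> + pi) = c k - of_real \<rho> * cis \<phi>" if "\<phi> \<in> \<Phi>'" for \<phi>
  proof -
    have "x (\<phi> + pi) \<notin> V" using that by (auto simp: \<Phi>'_def)
    then obtain k \<theta> where k: "k < m" "a k < \<theta>" "\<theta> < b k" "cis (\<phi> + pi) = cis \<theta>" by (rule outside_V)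
    have "x (\<phi> + pi) = x \<theta>" using k(4) by (rule x_cis_cong)
    also have "\<dots> = c k + of_real \<rho> * cis (\<phi> + pi)" using x_on_arc[of k \<theta>] k by simp
    also have "cis (\<phi> + pi) = - cis \<phi>" by (simp add: complex_eq_iff)
    finally show ?thesis using k(1) by (intro exI[of _ k]) simp
  qed
  then obtain \<kappa> where \<kappa>: "\<And>\<phi>. \<phi> \<in> \<Phi>' \<Longrightarrow> \<kappa> \<phi> < m \<and> x (\<phi> + pi) = c (\<kappa> \<phi>) - of_real \<rho> * cis \<phi>" by metis
  \<comment> \<open>Pigeonhole: two directions use the same arc. Subtracting their two descriptions
    of the opposite point leaves
    \<open>(w - \<rho>) * (cis \<phi> - cis \<psi>) = 0\<close>.\<close>
  have "\<not> inj_on \<kappa> \<Phi>'"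
  proof
    assume "inj_on \<kappa> \<Phi>'"
    hence "finite \<Phi>'" using \<kappa> by (intro inj_on_finite[of \<kappa> \<Phi>' "{..<m}"]) auto
    thus False using inf by (simp add: \<Phi>'_def)
  qed
  then obtain \<phi> \<psi> where *: "\<phi> \<in> \<Phi>'" "\<psi> \<in> \<Phi>'" "\<kappa> \<phi> = \<kappa> \<psi>" "\<phi> \<noteq> \<psi>" by (auto simp: inj_on_def)
  have in\<Phi>: "\<phi> \<in> \<Phi>" "\<psi> \<in> \<Phi>" using * by (auto simp: \<Phi>'_def)
  have "x \<alpha> - of_real w * cis \<phi> = c (\<kappa> \<psi>) - of_real \<rho> * cis \<phi>" "x \<alpha> - of_real w * cis \<psi> = c (\<kappa> \<psi>) - of_real \<rho> * cis \<psi>"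
    using \<kappa>[OF *(1)] \<kappa>[OF *(2)] *(3) opp[OF in\<Phi>(1)] opp[OF in\<Phi>(2)] by simp_all
  hence "of_real (w - \<rho>) * cis \<phi> = x \<alpha> - c (\<kappa> \<psi>)" "of_real (w - \<rho>) * cis \<psi> = x \<alpha> - c (\<kappa> \<psi>)"
    by (simp_all add: algebra_simps)
  hence "of_real (w - \<rho>) * (cis \<phi> - cis \<psi>) = 0" by (simp only: right_diff_distrib) simp
  moreover have "cis \<phi> \<noteq> cis \<psi>" using cis_inj in\<Phi> *(4) by blast
  ultimately have "w - \<rho> = 0" by (simp del: of_real_diff)
  thus ?thesis by simp
qed

text \<open>Where arcs with different centres meet, their common end point supports two different
  directions. These are not opposite, since antipodal support points differ, so
  \<open>corner_radius\<close> applies.\<close>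

lemma \<rho>_eq: "\<rho> = w"
proof -
  define i where "i = Suc 0 mod m"
  have i: "i < m" using m_pos by (simp add: i_def)
  have eq: "x (b 0) = x (a i)"
    using x_on_arc[OF m_pos, of "b 0"] x_on_arc[OF i, of "a i"] angles(1)[OF m_pos] angles(1)[OF i] joint[OF m_pos]
    by (simp add: i_def)
  have neq: "cis (b 0) \<noteq> cis (a i)" using joint[OF m_pos] centres[OF m_pos] by (auto simp: i_def)
  obtain k :: int where k: "b 0 - pi \<le> a i + 2 * pi * of_int k" "a i + 2 * pi * of_int k \<le> b 0 + pi"
    by (rule angle_near)
  define t where "t = a i + 2 * pi * of_int k"
  have ct: "cis t = cis (a i)" by (simp add: t_def flip: cis_mult)
  hence xt: "x t = x (b 0)" using x_cis_cong eq by metis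
  have "t \<noteq> b 0 + pi" using x_neq_antipode[of "b 0"] xt by auto
  moreover have "b 0 \<noteq> t + pi" using x_neq_antipode[of t] xt by auto
  moreover have "t \<noteq> b 0" using neq ct by auto
  ultimately have "b 0 < t \<and> t < b 0 + pi \<or> t < b 0 \<and> b 0 < t + pi" using k unfolding t_def by linarith
  thus ?thesis using corner_radius xt by metis
qed

lemma x_opposite_arc:
  assumes "i < m" "a i \<le> \<theta>" "\<theta> \<le> b i"
  shows "x (\<theta> + pi) = c i"
  using x_on_arc[OF assms] x_diff[of \<theta>] by (simp add: \<rho>_eq)

text \<open>The centre supports all directions opposite to its arc, whereas a boundary point outside
  \<open>V\<close> has only one normal.\<close>

lemma centre_in_V:
  assumes i: "i < m"
  shows "c i \<in> V"
proof (rule ccontr)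
  assume "c i \<notin> V"
  define d where "d = (a i + b i) / 2"
  have d: "a i < d" "d < b i" using angles(1)[OF i] by (auto simp: d_def)
  have opp: "x (a i + pi) = c i" "x (d + pi) = c i" using x_opposite_arc[OF i] d by auto
  hence "x (a i + pi) \<notin> V" using \<open>c i \<notin> V\<close> by simp
  then obtain k \<theta> where k: "k < m" "a k < \<theta>" "\<theta> < b k" "cis (a i + pi) = cis \<theta>" by (rule outside_V)
  have "x (d + pi) = c k + of_real \<rho> * cis \<theta>"
    using opp x_cis_cong[OF k(4)] x_on_arc[of k \<theta>] k by simp
  hence "cis (d + pi) = cis \<theta>"
  proof (rule arc_normal_unique[OF _ k(2,3) \<rho>_pos, rotated])
    fix t assume "a k < t" "t < b k"
    thus "c k + complex_of_real \<rho> * cis t \<in> R" using arc_in_R[OF k(1), of t] x_in by auto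
  qed
  hence "d + pi = a i + pi" using k(4) d angles(2)[OF i] by (intro cis_inj_near) auto
  thus False using d by simp
qed

end

section \<open>Special directions of an inscribed equilateral polygon\<close>

locale inscribed = reuleaux +
  fixes W :: "complex set" and s :: real
  assumes finite_W: "finite W" and V_W: "V \<subseteq> W" and W_frontier: "W \<subseteq> frontier R"
    and edges: "\<And>e. e edge_of (convex hull W) \<Longrightarrow> diameter e = s"
begin

definition T :: "real \<Rightarrow> bool" where
  "T \<theta> \<longleftrightarrow> x \<theta> \<in> W \<and> x (\<theta> + pi) \<in> W"

lemma x_2pi: "x (\<theta> + pi + pi) = x \<theta>"
  by (rule x_cis_cong) (simp flip: cis_mult)

lemma T_pi: "T (\<theta> + pi) \<longleftrightarrow> T \<theta>"
  unfolding T_def x_2pi by blast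

lemma T_pi_mult: "T (\<theta> + pi * of_int k) \<longleftrightarrow> T \<theta>"
proof (induction k rule: int_induct[where k = 0])
  case (step1 i)
  thus ?case using T_pi[of "\<theta> + pi * of_int i"] by (simp add: algebra_simps)
next
  case (step2 i)
  thus ?case using T_pi[of "\<theta> + pi * of_int (i - 1)"] by (simp add: algebra_simps)
qed simp

text \<open>A special direction is the normalised difference of two points of \<open>W\<close>, and
  \<open>cis\<close> is injective on a half turn.\<close>

lemma finite_T: "finite {t \<in> {\<theta><..\<theta> + pi}. T t}"
proof -
  define F where "F = (\<lambda>(u, v). (u - v) / of_real w) ` (W \<times> W)"
  have "inj_on cis {\<theta><..\<theta> + pi}"
    by (intro inj_onI cis_inj_near) (auto simp: abs_if)
  hence "finite (cis -` F \<inter> {\<theta><..\<theta> + pi})" using finite_W by (intro finite_vimage_IntI) (auto simp: F_def)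
  moreover have "cis t \<in> F" if "T t" for t
  proof -
    have "cis t = (x t - x (t + pi)) / of_real w" using x_diff[of t] w_pos by simp
    thus ?thesis using that unfolding F_def T_def by (intro image_eqI[of _ _ "(x t, x (t + pi))"]) auto
  qed
  ultimately show ?thesis by (elim finite_subset[rotated]) auto
qed

definition consecutive :: "real \<Rightarrow> real \<Rightarrow> bool" where
  "consecutive \<theta> \<theta>' \<longleftrightarrow> T \<theta> \<and> T \<theta>' \<and> \<theta> < \<theta>' \<and> \<theta>' \<le> \<theta> + pi \<and> (\<forall>t. \<theta> < t \<longrightarrow> t < \<theta>' \<longrightarrow> \<not> T t)"

lemma ex_consecutive:
  assumes "T \<theta>"
  shows "\<exists>\<theta>'. consecutive \<theta> \<theta>'"
proof -
  define A where "A = {t \<in> {\<theta><..\<theta> + pi}. T t}"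
  have A: "finite A" "A \<noteq> {}" using finite_T assms T_pi[of \<theta>] by (auto simp: A_def)
  have "Min A \<in> A" using A by (rule Min_in)
  moreover have "\<not> T t" if "\<theta> < t" "t < Min A" for t
  proof
    assume "T t"
    hence "t \<in> A" using that \<open>Min A \<in> A\<close> by (auto simp: A_def)
    thus False using Min_le[OF A(1)] that(2) by fastforce
  qed
  ultimately show ?thesis using assms unfolding consecutive_def
    by (intro exI[of _ "Min A"]) (auto simp: A_def)
qed

lemma consecutive_pi: "consecutive \<theta> \<theta>' \<Longrightarrow> consecutive (\<theta> + pi) (\<theta>' + pi)"
proof -
  assume *: "consecutive \<theta> \<theta>'"
  have "\<not> T t" if "\<theta> + pi < t" "t < \<theta>' + pi" for t
    using * that T_pi[of "t - pi"] by (auto simp: consecutive_def)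
  thus ?thesis using * by (auto simp: consecutive_def T_pi)
qed

text \<open>The ends of the arc through \<open>x \<phi>\<close> are special directions, so the whole
  gap lies on that arc and the opposite point rests at its centre. A point of \<open>W\<close>
  inside the gap would give another special direction, so the chord over the gap is an edge and has
  length \<open>s\<close>.\<close>

lemma gap_on_arc:
  assumes consec: "consecutive \<theta> \<theta>'"
    and \<phi>: "\<theta> < \<phi>" "\<phi> < \<theta>'" "x \<phi> \<notin> V"
  shows "\<And>t. \<theta> \<le> t \<Longrightarrow> t \<le> \<theta>' \<Longrightarrow> x (t + pi) = x (\<theta> + pi)"
    and "\<And>t. \<theta> < t \<Longrightarrow> t < \<theta>' \<Longrightarrow> x t \<notin> W"
    and "2 * w * sin ((\<theta>' - \<theta>) / 2) = s"
proof -
  have T: "T \<theta>" "T \<theta>'" "\<And>t. \<theta> < t \<Longrightarrow> t < \<theta>' \<Longrightarrow> \<not> T t" and \<theta>: "\<theta>' \<le> \<theta> + pi"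
    using consec by (auto simp: consecutive_def)
  obtain i \<psi> where i: "i < m" "a i < \<psi>" "\<psi> < b i" "cis \<phi> = cis \<psi>" using \<phi>(3) by (rule outside_V)
  obtain l :: int where l: "\<phi> = \<psi> + 2 * pi * of_int l" using i(4) by (rule cis_eqD)
  \<comment> \<open>The angles of the arc, moved by whole turns so that they enclose
    \<open>\<phi>\<close>.\<close>
  define A where "A = a i + 2 * pi * of_int l"
  define B where "B = b i + 2 * pi * of_int l"
  have shift: "x (t + 2 * pi * of_int l) = x t" for t
    by (rule x_cis_cong) (simp flip: cis_mult)
  have arc: "x t = c i + of_real w * cis t" "x (t + pi) = c i" if t: "A \<le> t" "t \<le> B" for t
  proof -
    define t' where "t' = t - 2 * pi * of_int l"
    have t': "t = t' + 2 * pi * of_int l" "a i \<le> t'" "t' \<le> b i" using t by (auto simp: t'_def A_def B_def)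
    have "cis t = cis t'" by (simp add: t'(1) flip: cis_mult)
    thus "x t = c i + of_real w * cis t" using x_on_arc[OF i(1) t'(2,3)] shift[of t'] by (simp add: t'(1) \<rho>_eq)
    have "x (t + pi) = x (t' + pi)" using shift[of "t' + pi"] by (simp add: t'(1) algebra_simps)
    thus "x (t + pi) = c i" using x_opposite_arc[OF i(1) t'(2,3)] by simp
  qed
  have AB: "A < \<phi>" "\<phi> < B" using i l by (auto simp: A_def B_def)
  have cW: "c i \<in> W" using centre_in_V[OF i(1)] V_W by auto
  have "x A \<in> V" "x B \<in> V"
    using arc_end_in_V[OF i(1)] shift x_on_arc[OF i(1), of "a i"] x_on_arc[OF i(1), of "b i"] angles(1)[OF i(1)]
    by (simp_all add: A_def B_def)
  hence "T A" "T B" using V_W cW arc(2)[of A] arc(2)[of B] AB by (auto simp: T_def)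
  hence A\<theta>: "A \<le> \<theta>" "\<theta>' \<le> B" using T(3)[of A] T(3)[of B] AB \<phi> by (meson not_le order_less_trans)+
  show opp: "\<And>t. \<theta> \<le> t \<Longrightarrow> t \<le> \<theta>' \<Longrightarrow> x (t + pi) = x (\<theta> + pi)"
    using arc(2) A\<theta> by (metis order_trans)
  show out: "x t \<notin> W" if "\<theta> < t" "t < \<theta>'" for t
    using T(3)[OF that] arc(2)[of t] A\<theta> that cW by (auto simp: T_def)
  \<comment> \<open>The middle direction is normal to the chord. Monotonicity of heights on both
    sides leaves only \<open>x \<theta>\<close> and \<open>x \<theta>'\<close> as points of
    \<open>W\<close> on the supporting line.\<close>
  define \<mu> where "\<mu> = (\<theta> + \<theta>') / 2"
  have \<mu>: "\<theta> < \<mu>" "\<mu> < \<theta>'" "\<theta>' < \<mu> + pi" "\<mu> - pi < \<theta>" using \<phi> \<theta> pi_gt_zero by (auto simp: \<mu>_def field_simps)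
  have x\<theta>: "x \<theta> = c i + of_real w * cis \<theta>" "x \<theta>' = c i + of_real w * cis \<theta>'"
    using arc(1)[of \<theta>] arc(1)[of \<theta>'] A\<theta> \<mu> by auto
  have same: "x \<theta> \<bullet> cis \<mu> = x \<theta>' \<bullet> cis \<mu>"
  proof -
    have "cos (\<theta> - \<mu>) = cos (\<theta>' - \<mu>)"
    proof -
      have "\<theta> - \<mu> = - (\<theta>' - \<mu>)" by (simp add: \<mu>_def field_simps)
      thus ?thesis by (simp only: cos_minus)
    qed
    hence "cis \<theta> \<bullet> cis \<mu> = cis \<theta>' \<bullet> cis \<mu>" by (simp add: inner_complex_def cos_diff)
    thus ?thesis unfolding x\<theta> by (simp add: inner_add_left flip: scaleR_conv_of_real)
  qed
  have sup: "z \<bullet> cis \<mu> \<le> x \<theta> \<bullet> cis \<mu> \<and> (z \<bullet> cis \<mu> = x \<theta> \<bullet> cis \<mu> \<longrightarrow> z = x \<theta> \<or> z = x \<theta>')" if z: "z \<in> W" for z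
  proof -
    obtain \<psi>0 where "z = x \<psi>0" using z W_frontier frontier_range by blast
    moreover obtain k :: int where k: "\<mu> - pi \<le> \<psi>0 + 2 * pi * of_int k" "\<psi>0 + 2 * pi * of_int k \<le> \<mu> + pi"
      by (rule angle_near)
    moreover define \<psi>1 where "\<psi>1 = \<psi>0 + 2 * pi * of_int k"
    moreover have "cis \<psi>1 = cis \<psi>0" by (simp add: \<psi>1_def flip: cis_mult)
    ultimately have \<psi>1: "z = x \<psi>1" "\<mu> - pi \<le> \<psi>1" "\<psi>1 \<le> \<mu> + pi" using x_cis_cong[of \<psi>1 \<psi>0] by auto
    have "\<not> (\<theta> < \<psi>1 \<and> \<psi>1 < \<theta>')" using out[of \<psi>1] z \<psi>1(1) by auto
    then consider "\<theta>' \<le> \<psi>1" | "\<psi>1 \<le> \<theta>" by linarith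
    thus ?thesis
    proof cases
      case 1
      have "z \<bullet> cis \<mu> \<le> x \<theta>' \<bullet> cis \<mu>" unfolding \<psi>1(1) using 1 \<psi>1 \<mu> by (intro x_antimono) auto
      moreover have "z = x \<theta>'" if "z \<bullet> cis \<mu> = x \<theta>' \<bullet> cis \<mu>"
        unfolding \<psi>1(1) using 1 \<psi>1 \<mu> that by (intro x_antimono_strict[of \<mu>]) auto
      ultimately show ?thesis by (simp add: same)
    next
      case 2
      have "z \<bullet> cis \<mu> \<le> x \<theta> \<bullet> cis \<mu>" unfolding \<psi>1(1) using 2 \<psi>1 \<mu> by (intro x_mono_left) auto
      moreover have "z = x \<theta>" if "z \<bullet> cis \<mu> = x \<theta> \<bullet> cis \<mu>"
        unfolding \<psi>1(1) using 2 \<psi>1 \<mu> that by (intro x_mono_left_strict[of \<mu>]) auto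
      ultimately show ?thesis by simp
    qed
  qed
  have "x \<theta> \<noteq> x \<theta>'"
  proof
    assume "x \<theta> = x \<theta>'"
    hence "cis \<theta> = cis \<theta>'" using x\<theta> w_pos by simp
    hence "\<theta> = \<theta>'" using \<theta> \<mu> by (intro cis_inj_near) auto
    thus False using \<mu> by simp
  qed
  have set: "{z \<in> W. cis \<mu> \<bullet> z = x \<theta> \<bullet> cis \<mu>} = {x \<theta>, x \<theta>'}"
    using sup T(1,2) same by (auto simp: T_def inner_commute)
  have le: "\<And>z. z \<in> W \<Longrightarrow> cis \<mu> \<bullet> z \<le> x \<theta> \<bullet> cis \<mu>" using sup by (simp add: inner_commute)
  have "(convex hull {x \<theta>, x \<theta>'}) face_of convex hull W"
    using face_of_convex_hull_supporting[OF finite_W le] unfolding set by simp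
  hence "(convex hull {x \<theta>, x \<theta>'}) edge_of convex hull W"
    using \<open>x \<theta> \<noteq> x \<theta>'\<close> by (simp add: edge_of_def aff_dim_convex_hull aff_dim_2)
  hence "s = dist (x \<theta>) (x \<theta>')" using edges diameter_convex_hull_pair by metis
  also have "\<dots> = norm (of_real w * (cis \<theta>' - cis \<theta>))" unfolding x\<theta>
    by (simp add: dist_norm norm_minus_commute right_diff_distrib)
  also have "\<dots> = 2 * w * \<bar>sin ((\<theta>' - \<theta>) / 2)\<bar>" using w_pos by (simp add: norm_mult norm_cis_diff)
  finally have "s = 2 * w * \<bar>sin ((\<theta>' - \<theta>) / 2)\<bar>" .
  moreover have "sin ((\<theta>' - \<theta>) / 2) \<ge> 0" using \<theta> \<mu> by (intro sin_ge_zero) auto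
  ultimately show "2 * w * sin ((\<theta>' - \<theta>) / 2) = s" by simp
qed

text \<open>The middle direction is not special, so one of its two support points lies outside
  \<open>V\<close>; if it is the opposite one, everything is shifted by half a turn.\<close>

lemma gap:
  assumes consec: "consecutive \<theta> \<theta>'"
  shows "x \<theta>' = x \<theta> \<or> x (\<theta>' + pi) = x (\<theta> + pi)"
    and "\<And>t. \<theta> < t \<Longrightarrow> t < \<theta>' \<Longrightarrow> x t \<in> W \<Longrightarrow> x t = x \<theta>"
    and "2 * w * sin ((\<theta>' - \<theta>) / 2) = s"
proof -
  have \<theta>: "\<theta> < \<theta>'" using consec by (simp add: consecutive_def)
  define \<mu> where "\<mu> = (\<theta> + \<theta>') / 2"
  have \<mu>: "\<theta> < \<mu>" "\<mu> < \<theta>'" using \<theta> by (auto simp: \<mu>_def)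
  hence "\<not> T \<mu>" using consec by (simp add: consecutive_def)
  hence "x \<mu> \<notin> V \<or> x (\<mu> + pi) \<notin> V" using V_W by (auto simp: T_def)
  hence "(x \<theta>' = x \<theta> \<or> x (\<theta>' + pi) = x (\<theta> + pi)) \<and> (\<forall>t. \<theta> < t \<longrightarrow> t < \<theta>' \<longrightarrow> x t \<in> W \<longrightarrow> x t = x \<theta>)
    \<and> 2 * w * sin ((\<theta>' - \<theta>) / 2) = s"
  proof
    assume "x \<mu> \<notin> V"
    note g = gap_on_arc[OF consec \<mu> this]
    have "x (\<theta>' + pi) = x (\<theta> + pi)" using g(1)[of \<theta>'] \<theta> by simp
    moreover have "x t \<notin> W" if "\<theta> < t" "t < \<theta>'" for t using g(2)[OF that] .
    ultimately show ?thesis using g(3) by blast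
  next
    assume "x (\<mu> + pi) \<notin> V"
    have \<mu>': "\<theta> + pi < \<mu> + pi" "\<mu> + pi < \<theta>' + pi" using \<mu> by simp_all
    note g = gap_on_arc[OF consecutive_pi[OF consec] \<mu>' \<open>x (\<mu> + pi) \<notin> V\<close>]
    have "x t = x \<theta>" if "\<theta> \<le> t" "t \<le> \<theta>'" for t
      using g(1)[of "t + pi"] that unfolding x_2pi by simp
    moreover have "2 * w * sin ((\<theta>' - \<theta>) / 2) = s" using g(3) by simp
    ultimately show ?thesis using \<theta> by (meson less_imp_le order_refl)
  qed
  thus "x \<theta>' = x \<theta> \<or> x (\<theta>' + pi) = x (\<theta> + pi)" "\<And>t. \<theta> < t \<Longrightarrow> t < \<theta>' \<Longrightarrow> x t \<in> W \<Longrightarrow> x t = x \<theta>"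
    "2 * w * sin ((\<theta>' - \<theta>) / 2) = s" by blast+
qed

lemma ex_walk_hull:
  "\<exists>n u \<kappa>. \<kappa> \<noteq> 0 \<and> walk n u \<and> W = (\<lambda>z. \<kappa> * z) ` range u"
proof -
  \<comment> \<open>An arc starts at a vertex, and the opposite support point is its centre, a
    vertex as well; so this direction is special.\<close>
  define \<theta>0 where "\<theta>0 = a 0"
  have T0: "T \<theta>0"
    using x_opposite_arc[OF m_pos, of "a 0"] x_on_arc[OF m_pos, of "a 0"] centre_in_V[OF m_pos]
      arc_end_in_V(2)[OF m_pos] angles(1)[OF m_pos] V_W by (auto simp: T_def \<theta>0_def)
  obtain \<theta>1 where \<theta>1: "consecutive \<theta>0 \<theta>1" using ex_consecutive[OF T0] by blast
  define \<Delta> where "\<Delta> = \<theta>1 - \<theta>0"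
  have \<Delta>: "\<Delta> > 0" "\<Delta> \<le> pi" using \<theta>1 by (auto simp: \<Delta>_def consecutive_def)
  have \<Delta>s: "2 * w * sin (\<Delta> / 2) = s" unfolding \<Delta>_def by (rule gap(3)[OF \<theta>1])
  have consec: "consecutive \<theta> (\<theta> + \<Delta>)" if T\<theta>: "T \<theta>" for \<theta>
  proof -
    obtain \<theta>' where \<theta>': "consecutive \<theta> \<theta>'" using ex_consecutive[OF T\<theta>] by blast
    \<comment> \<open>The edge length determines the gap, because half a gap is at most a right
      angle and the sine is injective there.\<close>
    have "2 * w * sin ((\<theta>' - \<theta>) / 2) = 2 * w * sin (\<Delta> / 2)"
      unfolding \<Delta>s by (rule gap(3)[OF \<theta>'])
    moreover have "2 * w \<noteq> 0" using w_pos by simp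
    ultimately have "sin ((\<theta>' - \<theta>) / 2) = sin (\<Delta> / 2)" by (rule mult_left_cancel[THEN iffD1, rotated])
    hence "(\<theta>' - \<theta>) / 2 = \<Delta> / 2" using \<theta>' \<Delta> by - (rule sin_inj_pi, auto simp: consecutive_def)
    hence "\<theta>' = \<theta> + \<Delta>" by simp
    thus ?thesis using \<theta>' by simp
  qed
  have T_next: "T (\<theta> + \<Delta>)" "\<And>t. \<theta> < t \<Longrightarrow> t < \<theta> + \<Delta> \<Longrightarrow> \<not> T t" if "T \<theta>" for \<theta>
    using consec[OF that] by (auto simp: consecutive_def)
  have T_nat: "T (\<theta>0 + real j * \<Delta>)" for j
  proof (induction j)
    case (Suc j)
    thus ?case using T_next(1)[of "\<theta>0 + real j * \<Delta>"] by (simp add: algebra_simps)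
  qed (simp add: T0)
  define n where "n = nat \<lfloor>pi / \<Delta>\<rfloor>"
  have n_le: "real n * \<Delta> \<le> pi" and n_gt: "pi < (real n + 1) * \<Delta>"
  proof -
    have "pi / \<Delta> \<ge> 0" using \<Delta> by simp
    hence "real n \<le> pi / \<Delta>" "pi / \<Delta> < real n + 1" unfolding n_def by linarith+
    thus "real n * \<Delta> \<le> pi" "pi < (real n + 1) * \<Delta>" using \<Delta> by (simp_all add: field_simps)
  qed
  \<comment> \<open>The direction \<open>\<theta>0 + pi\<close> is special too and cannot fall
    strictly inside a gap.\<close>
  have n\<Delta>: "real n * \<Delta> = pi"
  proof (rule ccontr)
    assume "real n * \<Delta> \<noteq> pi"
    hence "\<not> T (\<theta>0 + pi)" using n_le n_gt by (intro T_next(2)[OF T_nat[of n]]) (auto simp: algebra_simps)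
    thus False using T0 T_pi by simp
  qed
  have n0: "n > 0" using n\<Delta> by (cases n) auto
  have root_\<Delta>: "root_angle n j = of_int j * \<Delta>" for j
    using n0 by (simp add: root_angle_def n\<Delta>[symmetric])
  have T_int: "T (\<theta>0 + root_angle n j)" for j
  proof -
    have "root_angle n j = real (nat (j mod int n)) * \<Delta> + pi * of_int (j div int n)"
    proof -
      have "real_of_int j = of_int (j mod int n) + real n * of_int (j div int n)"
        by (metis mod_mult_div_eq of_int_add of_int_mult of_int_of_nat_eq)
      thus ?thesis using n0 by (simp add: root_\<Delta> n\<Delta>[symmetric] algebra_simps)
    qed
    thus ?thesis using T_pi_mult[of "\<theta>0 + real (nat (j mod int n)) * \<Delta>"] T_nat by (simp add: add.assoc)
  qed
  have root_Suc: "root_angle n (j + 1) = root_angle n j + \<Delta>" for j by (simp add: root_\<Delta> algebra_simps)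
  have root_n: "root_angle n (j + int n) = root_angle n j + pi" for j
    by (simp add: root_\<Delta> n\<Delta>[symmetric] algebra_simps)
  have gap_int: "x (\<theta>0 + root_angle n (j + 1)) = x (\<theta>0 + root_angle n j) \<or>
       x (\<theta>0 + root_angle n (j + 1) + pi) = x (\<theta>0 + root_angle n j + pi)"
      "\<And>t. \<theta>0 + root_angle n j < t \<Longrightarrow> t < \<theta>0 + root_angle n (j + 1) \<Longrightarrow> x t \<in> W \<Longrightarrow> x t = x (\<theta>0 + root_angle n j)" for j
  proof -
    have g: "consecutive (\<theta>0 + root_angle n j) (\<theta>0 + root_angle n (j + 1))"
      using consec[OF T_int[of j]] by (simp add: root_Suc add.assoc)
    show "x (\<theta>0 + root_angle n (j + 1)) = x (\<theta>0 + root_angle n j) \<or>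
       x (\<theta>0 + root_angle n (j + 1) + pi) = x (\<theta>0 + root_angle n j + pi)"
      "\<And>t. \<theta>0 + root_angle n j < t \<Longrightarrow> t < \<theta>0 + root_angle n (j + 1) \<Longrightarrow> x t \<in> W \<Longrightarrow> x t = x (\<theta>0 + root_angle n j)"
      using gap(1,2)[OF g] by auto
  qed
  \<comment> \<open>Division by \<open>\<kappa>\<close> makes the width 1 and turns
    \<open>\<theta>0\<close> to angle 0.\<close>
  define \<kappa> where "\<kappa> = of_real w * cis \<theta>0"
  have \<kappa>: "\<kappa> \<noteq> 0" using w_pos by (simp add: \<kappa>_def)
  define u where "u j = x (\<theta>0 + root_angle n j) / \<kappa>" for j
  \<comment> \<open>For \<open>n = 1\<close> a gap would be half a turn, across which one support
    point would have to rest, yet antipodal support points differ.\<close>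
  have n2: "n \<ge> 2"
  proof (rule ccontr)
    assume "\<not> n \<ge> 2"
    hence "n = 1" using n0 by simp
    hence "root_angle n 1 = pi" "root_angle n 0 = 0" by (simp_all add: root_angle_def)
    thus False using gap_int(1)[of 0] x_neq_antipode[of \<theta>0] x_neq_antipode[of "\<theta>0 + pi"] by auto
  qed
  have "walk n u"
  proof
    have "u j - u (j + int n) = cis (root_angle n j)" for j
    proof -
      have "u j - u (j + int n) = (x (\<theta>0 + root_angle n j) - x (\<theta>0 + root_angle n j + pi)) / \<kappa>"
        by (simp add: u_def root_n diff_divide_distrib add.assoc)
      also have "\<dots> = cis (root_angle n j)" using w_pos by (simp add: x_diff \<kappa>_def flip: cis_mult)
      finally show ?thesis .
    qed
    moreover have "u (j + 1) = u j \<or> u (j + 1 + int n) = u (j + int n)" for j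
    proof -
      have "\<theta>0 + root_angle n (j + 1 + int n) = \<theta>0 + root_angle n (j + 1) + pi"
        "\<theta>0 + root_angle n (j + int n) = \<theta>0 + root_angle n j + pi"
        by (simp_all add: root_n)
      thus ?thesis using gap_int(1)[of j] unfolding u_def by metis
    qed
    ultimately show "reuleaux_walk n u" by (simp add: reuleaux_walk_def)
  qed (rule n2)
  moreover have "W = (\<lambda>z. \<kappa> * z) ` range u"
  proof -
    have "(\<lambda>z. \<kappa> * z) ` range u = range (\<lambda>j. x (\<theta>0 + root_angle n j))"
      using \<kappa> by (auto simp: u_def image_image)
    also have "\<dots> = W"
    proof
      show "range (\<lambda>j. x (\<theta>0 + root_angle n j)) \<subseteq> W" using T_int by (auto simp: T_def)
      show "W \<subseteq> range (\<lambda>j. x (\<theta>0 + root_angle n j))"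
      proof
        fix z assume z: "z \<in> W"
        then obtain \<phi> where \<phi>: "z = x \<phi>" using W_frontier frontier_range by blast
        define j where "j = \<lfloor>(\<phi> - \<theta>0) / \<Delta>\<rfloor>"
        have "of_int j \<le> (\<phi> - \<theta>0) / \<Delta>" "(\<phi> - \<theta>0) / \<Delta> < of_int j + 1" unfolding j_def by linarith+
        hence "\<theta>0 + root_angle n j \<le> \<phi>" "\<phi> < \<theta>0 + root_angle n (j + 1)"
          using \<Delta> by (simp_all add: root_\<Delta> field_simps)
        hence "z = x (\<theta>0 + root_angle n j)" using gap_int(2)[of j \<phi>] z \<phi> by (cases "\<phi> = \<theta>0 + root_angle n j") auto
        thus "z \<in> range (\<lambda>j. x (\<theta>0 + root_angle n j))" by blast
      qed
    qed
    finally show ?thesis ..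
  qed
  ultimately show ?thesis using \<kappa> by blast
qed

end

lemma reinhardt_polygon_walk:
  assumes "reinhardt_polygon n P"
  shows "\<exists>u \<kappa>. \<kappa> \<noteq> 0 \<and> walk n u \<and> P = (\<lambda>z. \<kappa> * z + 0) ` (convex hull (range u))"
proof -
  define W where "W = polygon_vertices P"
  have poly: "polytope P" "card W = n" and eql: "equilateral P"
    using assms by (auto simp: reinhardt_polygon_def convex_polygon_def W_def)
  obtain R V where RV: "reuleaux_polygon R V" "W \<subseteq> frontier R" "V \<subseteq> W"
    using assms by (auto simp: reinhardt_polygon_def W_def)
  have P: "P = convex hull W"
    unfolding W_def polygon_vertices_def
    using poly(1) by (intro Krein_Milman_Minkowski polytope_imp_compact polytope_imp_convex)
  have finW: "finite W" unfolding W_def polygon_vertices_def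
    by (rule finite_polyhedron_extreme_points[OF polytope_imp_polyhedron[OF poly(1)]])
  obtain s where s: "\<And>e. e edge_of P \<Longrightarrow> diameter e = s" using eql by (auto simp: equilateral_def)
  obtain w where R: "R \<noteq> {}" "compact R" "convex R" "w > 0" "constant_width R w"
    using RV(1) by (auto simp: reuleaux_polygon_def)
  obtain x where x: "cw_body R w x" using ex_cw_body[OF R(2,1,5,4)] by blast
  obtain m c \<rho> a b where arcs: "\<rho> > 0" "\<forall>i<m. a i < b i \<and> b i < a i + 2 * pi"
    "\<forall>i<m. pathfinish (part_circlepath (c i) \<rho> (a i) (b i)) =
        pathstart (part_circlepath (c (Suc i mod m)) \<rho> (a (Suc i mod m)) (b (Suc i mod m))) \<and> c i \<noteq> c (Suc i mod m)"
    "frontier R = (\<Union>i<m. path_image (part_circlepath (c i) \<rho> (a i) (b i)))"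
    "V = (\<lambda>i. pathstart (part_circlepath (c i) \<rho> (a i) (b i))) ` {..<m}"
    using RV(1) unfolding reuleaux_polygon_def Let_def by blast
  interpret cw_body R w x by (rule x)
  interpret inscribed R w x V m c \<rho> a b W s
  proof
    show "frontier R = (\<Union>i<m. (\<lambda>t. c i + complex_of_real \<rho> * cis t) ` {a i..b i})"
      unfolding arcs(4) using arcs(2)
      by (intro SUP_cong refl) (simp add: path_image_part_circlepath' closed_segment_eq_real_ivl less_imp_le)
  qed (use R arcs RV finW s in \<open>auto simp: cis_conv_exp P\<close>)
  obtain n' u \<kappa> where u: "\<kappa> \<noteq> 0" "walk n' u" "W = (\<lambda>z. \<kappa> * z) ` range u" using ex_walk_hull by blast
  \<comment> \<open>The walk arrives with its own number \<open>n'\<close>; counting vertices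
    identifies it with \<open>n\<close>.\<close>
  have "inj_on (\<lambda>z. \<kappa> * z) (range u)" using u(1) by (auto intro: inj_onI)
  hence "card W = n'" using walk.card_range_v[OF u(2)] unfolding u(3) by (simp add: card_image)
  hence "n' = n" using poly(2) by simp
  moreover have "P = (\<lambda>z. \<kappa> * z + 0) ` (convex hull (range u))"
    unfolding P u(3) using convex_hull_affine_image[of \<kappa> 0 "range u"] by simp
  ultimately show ?thesis using u by blast
qed

section \<open>Counting\<close>

lemma equiv_similarity: "equiv UNIV similarity"
proof (rule equivI)
  show "refl similarity"
  proof (rule reflI)
    fix P :: "complex set"
    have "P = (\<lambda>z. 1 * z + 0) ` P" by simp
    thus "(P, P) \<in> similarity" unfolding similarity_def using one_neq_zero by blast
  qed
  show "sym similarity"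
  proof (rule symI)
    fix P Q assume "(P, Q) \<in> similarity"
    then obtain a b where a: "a \<noteq> 0"
      and "Q = (\<lambda>z. a * z + b) ` P \<or> Q = (\<lambda>z. a * cnj z + b) ` P" unfolding similarity_def by blast
    then consider "Q = (\<lambda>z. a * z + b) ` P" | "Q = (\<lambda>z. a * cnj z + b) ` P" by blast
    thus "(Q, P) \<in> similarity"
    proof cases
      case 1
      have "P = (\<lambda>z. (1 / a) * z + (- b / a)) ` Q" unfolding 1 image_image using a by (simp add: field_simps)
      moreover have "1 / a \<noteq> 0" using a by simp
      ultimately show ?thesis unfolding similarity_def by blast
    next
      case 2
      have "P = (\<lambda>z. cnj (1 / a) * cnj z + cnj (- b / a)) ` Q" unfolding 2 image_image using a by (simp add: field_simps)
      moreover have "cnj (1 / a) \<noteq> 0" using a by simp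
      ultimately show ?thesis unfolding similarity_def by blast
    qed
  qed
  show "trans similarity"
  proof (rule transI)
    fix P Q S assume "(P, Q) \<in> similarity" "(Q, S) \<in> similarity"
    then obtain a b c d where ac: "a \<noteq> 0" "c \<noteq> 0"
      and "Q = (\<lambda>z. a * z + b) ` P \<or> Q = (\<lambda>z. a * cnj z + b) ` P"
        "S = (\<lambda>z. c * z + d) ` Q \<or> S = (\<lambda>z. c * cnj z + d) ` Q" unfolding similarity_def by blast
    then consider "S = (\<lambda>z. (c * a) * z + (c * b + d)) ` P" | "S = (\<lambda>z. (c * cnj a) * cnj z + (c * cnj b + d)) ` P"
      | "S = (\<lambda>z. (c * a) * cnj z + (c * b + d)) ` P" | "S = (\<lambda>z. (c * cnj a) * z + (c * cnj b + d)) ` P"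
      by (elim disjE) (simp_all add: image_image algebra_simps)
    moreover have "c * a \<noteq> 0" "c * cnj a \<noteq> 0" using ac by simp_all
    ultimately show "(P, S) \<in> similarity" unfolding similarity_def by cases blast+
  qed
qed simp

lemma card_image_eq_if_same_kernel:
  assumes "\<And>v v'. v \<in> S \<Longrightarrow> v' \<in> S \<Longrightarrow> F v = F v' \<longleftrightarrow> G v = G v'"
  shows "card (F ` S) = card (G ` S)"
proof (rule bij_betw_same_card)
  have h: "G (inv_into S F (F v)) = G v" if "v \<in> S" for v
    using assms[of "inv_into S F (F v)" v] that by (simp add: inv_into_into f_inv_into_f)
  show "bij_betw (\<lambda>X. G (inv_into S F X)) (F ` S) (G ` S)"
    unfolding bij_betw_def
  proof
    show "inj_on (\<lambda>X. G (inv_into S F X)) (F ` S)"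
    proof (rule inj_onI)
      fix X Y assume "X \<in> F ` S" "Y \<in> F ` S" and eq: "G (inv_into S F X) = G (inv_into S F Y)"
      then obtain v v' where v: "v \<in> S" "X = F v" "v' \<in> S" "Y = F v'" by blast
      hence "G v = G v'" using eq h by simp
      thus "X = Y" using assms v by blast
    qed
    show "(\<lambda>X. G (inv_into S F X)) ` F ` S = G ` S"
      unfolding image_image by (intro image_cong refl h)
  qed
qed

text \<open>Classes of polygons and classes of words are both images of the set of walks, and by
  \<open>similar_walks_iff\<close> two walks agree in one image exactly when they agree in the
  other.\<close>

lemma E_eq_card_sign_words:
  assumes "n \<ge> 2"
  shows "E n = card ((sign_word ` {v. walk n v}) // dih)"
proof -
  define S where "S = {v. walk n v}"
  define F where "F v = similarity `` {convex hull (range v)}" for v :: "int \<Rightarrow> complex"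
  define G where "G v = dih `` {sign_word v}" for v
  have "{P. reinhardt_polygon n P} // similarity = F ` S"
  proof (intro equalityI subsetI)
    fix C assume "C \<in> {P. reinhardt_polygon n P} // similarity"
    then obtain P where P: "reinhardt_polygon n P" "C = similarity `` {P}" by (auto simp: quotient_def)
    obtain u \<kappa> where u: "\<kappa> \<noteq> 0" "walk n u" "P = (\<lambda>z. \<kappa> * z + 0) ` (convex hull (range u))"
      using reinhardt_polygon_walk[OF P(1)] by blast
    have "(convex hull (range u), P) \<in> similarity" unfolding similarity_def using u(1,3) by blast
    hence "F u = C" unfolding F_def P(2) by (rule equiv_class_eq[OF equiv_similarity])
    thus "C \<in> F ` S" using u(2) by (auto simp: S_def)
  next
    fix C assume "C \<in> F ` S"
    then obtain v where v: "walk n v" "C = F v" by (auto simp: S_def)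
    interpret walk n v by (rule v(1))
    have "reinhardt_polygon n (convex hull (range v))" using reinhardt_polygon_P unfolding P_def .
    thus "C \<in> {P. reinhardt_polygon n P} // similarity" unfolding v(2) F_def by (intro quotientI) simp
  qed
  moreover have "card (F ` S) = card (G ` S)"
  proof (rule card_image_eq_if_same_kernel)
    fix v v' assume "v \<in> S" "v' \<in> S"
    hence W: "walk n v" "walk n v'" by (auto simp: S_def)
    have "F v = F v' \<longleftrightarrow> (convex hull (range v), convex hull (range v')) \<in> similarity"
      unfolding F_def by (rule eq_equiv_class_iff[OF equiv_similarity]) auto
    also have "\<dots> \<longleftrightarrow> (sign_word v, sign_word v') \<in> dih" by (rule similar_walks_iff[OF W])
    also have "\<dots> \<longleftrightarrow> G v = G v'"
      unfolding G_def by (rule eq_equiv_class_iff[OF equiv_dih, symmetric]) auto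
    finally show "F v = F v' \<longleftrightarrow> G v = G v'" .
  qed
  moreover have "(sign_word ` S) // dih = G ` S" by (auto simp: quotient_def G_def)
  ultimately show ?thesis by (simp add: E_def S_def)
qed

lemma real_card_periodics_orbits:
  assumes "prime p" "odd p"
  shows "real (card (periodics p // dih)) = 2 ^ ((p - 3) div 2) + (2 ^ (p - 1) + real p - 1) / (2 * real p)"
proof -
  have "p \<noteq> 2" using assms(2) by auto
  hence "p \<ge> 3" using prime_ge_2_nat[OF assms(1)] by simp
  then obtain k where k: "p = 2 * k + 3" using assms(2) by (metis add.commute even_numeral le_Suc_ex oddE odd_add odd_numeral dvd_def)
  have "real (card (periodics p // dih) * (4 * p)) = real (2 ^ p + 2 * (p - 1) + p * 2 ^ ((p + 1) div 2))"
    using card_periodics_orbits[OF assms] by simp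
  also have "\<dots> = 4 * real p * 2 ^ k + 2 * (2 ^ (p - 1) + real p - 1)"
  proof -
    have "(p + 1) div 2 = k + 2" "(2::real) ^ p = 2 * 2 ^ (p - 1)" using k by (auto simp flip: power_Suc)
    thus ?thesis using k by (simp add: of_nat_diff algebra_simps)
  qed
  finally have "real (card (periodics p // dih)) * (4 * real p) = 4 * real p * 2 ^ k + 2 * (2 ^ (p - 1) + real p - 1)"
    by simp
  moreover have "(p - 3) div 2 = k" "real p > 0" using k by simp_all
  ultimately show ?thesis by (simp add: field_simps)
qed

theorem mainTheorem4:
  fixes p q :: nat
  assumes "prime p" and "odd p" and "prime q" and "odd q" and "p \<noteq> q"
  shows "real (E (p * q)) =
           2 ^ ((p - 3) div 2) + (2 ^ (p - 1) + real p - 1) / (2 * real p)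
         + 2 ^ ((q - 3) div 2) + (2 ^ (q - 1) + real q - 1) / (2 * real q) - 1"
proof -
  have "p * q \<ge> 2" using mult_le_mono[OF prime_ge_2_nat[OF assms(1)] prime_ge_2_nat[OF assms(3)]] by simp
  hence "E (p * q) = card ((periodics p \<union> periodics q) // dih)"
    using sign_words_pq[OF assms] by (simp add: E_eq_card_sign_words)
  hence "E (p * q) + 1 = card (periodics p // dih) + card (periodics q // dih)"
    using card_two_periodics_orbits[OF primes_coprime[OF assms(1,3,5)]] assms prime_gt_0_nat by simp
  hence "real (E (p * q)) + 1 = real (card (periodics p // dih)) + real (card (periodics q // dih))"
    by (metis of_nat_1 of_nat_add)
  thus ?thesis by (simp add: real_card_periodics_orbits assms)
qed

end
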